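(* Let $\mathcal{A}$ be diagonalizable with a Riesz basis of eigenvectors $(\varphi_n^i)_{(i,n)\in\{1,\dots,m\}\times\mathbb{N}^*}$ and eigenvalues $\lambda_n^i$ as described in the context, and assume that there are $(\alpha_1,\dots,\alpha_m)\in(1,+\infty)^m$ and $c,C>0$ such that for all $i\in\{1,\dots,m\}$ and all $n,p\in\mathbb{N}^*$ $$c\,n^{\alpha_i}\le|\lambda_n^i|+1\le C\,n^{\alpha_i},\qquad |\lambda_n^i-\lambda_p^i|\ge c\,n^{\alpha_i-1}|n-p|.$$ Let $B=(B_1,\dots,B_m)\in\mathcal{H}_1^{-\alpha_1/2}\times\cdots\times\mathcal{H}_m^{-\alpha_m/2}$ be such that $$c_1\le|\langle B_i,\widetilde{\varphi_n}^i\rangle|\le c_2n^{\gamma_i},\qquad\forall n\in\mathbb{N}^*,\ i\in\{1,\dots,m\},$$ for some constants $c_1,c_2>0$ and some $\gamma_i\in[0,(\alpha_i-1)/2)$, $i\in\{1,\dots,m\}$. Set $\vec\alpha=(\alpha_1,\dots,\alpha_m)$. Then for any $\lambda_0>0$ there exist $\lambda>\lambda_0$, a bounded linear feedback $K\in\mathcal{L}(\mathcal{H}^{\vec\alpha/2},\mathbb{C}^m)$ and a mapping $T$ that is an isomorphism from $\mathcal{H}^{\vec r}$ to itself for any $\vec r=(r_1,\dots,r_m)$ with $r_i\in(1/2-\alpha_i+\gamma_i,\ \alpha_i-1/2-\gamma_i)$, such that $T$ maps the system $\partial_tu=\mathcal{A}u+BK(u)$ to the system $\partial_tv=\mathcal{A}v-\lambda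 v$. In particular, for any $\mu>0$, $\lambda_0$ can be chosen sufficiently large such that the closed-loop system $\partial_tu=\mathcal{A}u+BK(u)$ is exponentially stable with decay rate $\mu$ in $\mathcal{H}^{\vec r}$ for any $\vec r=(r_1,\dots,r_m)$ with $r_i\in(1/2-\alpha_i+\gamma_i,\ \alpha_i-1/2-\gamma_i)$.
   Context: $\mathbb{N}^*=\{1,2,\dots\}$. $(X,\langle\cdot,\cdot\rangle)$ is a complex Hilbert space and $\mathcal{A}:\mathcal{D}(\mathcal{A})\subset X\to X$, $\mathcal{D}(\mathcal{A})=\{f\in X:\mathcal{A}f\in X\}$, generates a $C^0$ semigroup with finite growth bound. $\mathcal{A}$ is diagonalizable: there is a Riesz basis of $X$ consisting of eigenvectors of $\mathcal{A}$, and the eigenvalues have bounded multiplicities; $m\in\mathbb{N}^*$ is the highest multiplicity. The basis is arranged as $(\varphi_n^i)_{(i,n)\in\{1,\dots,m\}\times\mathbb{N}^*}$ (a Riesz basis of $X$) with $\mathcal{A}\varphi_n^i=\lambda_n^i\varphi_n^i$ and $\lambda_n^i\ne\lambda_p^i$ for $n\ne p$; $X_i$ is the closed span of $(\varphi_n^i)_{n}$, so $X=X_1+\dots+X_m$. For $s\in\mathbb{R}$, $\mathcal{H}_i^s$ is the Hilbert space of (possibly formal) series $f=\sum_{n\in\mathbb{N}^*}f_n^i\varphi_n^i$ with $\|f\|_{\mathcal{H}_i^s}^2=\sum_nn^{2s}|f_n^i|^2<\infty$. For $\vec s=(s_1,\dots,s_m)\in\mathbb{R}^m$, $\mathcal{H}^{\vec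 s}=\mathcal{H}_1^{s_1}+\dots+\mathcal{H}_m^{s_m}$ with the corresponding Hilbert structure. $\mathcal{A}$ acts on these spaces coefficientwise by $\mathcal{A}\varphi_n^i=\lambda_n^i\varphi_n^i$. $(\widetilde{\varphi_n}^i)_n$ is the biorthogonal family of $(\varphi_n^i)_n$ in $X_i$, and for $f\in\mathcal{H}_i^s$ (any $s\in\mathbb{R}$), $\langle f,\widetilde{\varphi_n}^i\rangle=f_n^i$ is the coefficient of $f$ along $\varphi_n^i$. For $B=(B_1,\dots,B_m)$ and $K=(K_1,\dots,K_m)$ with scalar-valued $K_i$, $BK(u)=\sum_{i=1}^mB_iK_i(u)$. "$T$ maps $\partial_tu=\mathcal{A}u+BK(u)$ to $\partial_tv=\mathcal{A}v-\lambda v$" means that $T$ satisfies the operator equality $T(\mathcal{A}+BK)=(\mathcal{A}-\lambda I)T$ from $\mathcal{H}^{\vec\alpha/2}$ to $\mathcal{H}^{-\vec\alpha/2}$ (and, by density, wherever both sides extend continuously), so that $v=Tu$ solves the second system when $u$ solves the first one, and conversely. The system $\partial_tu=\mathcal{A}u+BK(u)$ is exponentially stable with decay rate $\mu>0$ in a space $H$ (here $H=\mathcal{H}^{\vec r}$) if $\mathcal{A}+BK$, with domain $\{f\in H:(\mathcal{A}+BK)f\in H\}$, generates a $C^0$ semigroup on $H$ and there is $C>0$ such that for every $u_0\in H$ the unique solution $u\in C^0([0,+\infty),H)$ with $u(0)=u_0$ satisfies $\|u(t)\|_H\le Ce^{-\mu t}\|u_0\|_H$ for all $t\ge0$. Here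 $K$ is identified with its continuous extension to any larger space $\mathcal{H}^{\vec\sigma}$ on which it is bounded. *)

theory Defs
  imports "HOL-Analysis.Analysis" "HOL-Library.Function_Algebras"
begin

section \<open>Complex vector spaces and complex Hilbert spaces\<close>

class complex_vector = ab_group_add +
  fixes scaleC :: "complex \<Rightarrow> 'a \<Rightarrow> 'a"  (infixr "*C" 75)
  assumes scaleC_add_right: "a *C (x + y) = a *C x + a *C y"
    and scaleC_add_left: "(a + b) *C x = a *C x + b *C x"
    and scaleC_scaleC: "a *C b *C x = (a * b) *C x"
    and scaleC_one: "1 *C x = x"

global_interpretation complex_vector: vector_space "scaleC :: complex \<Rightarrow> 'a \<Rightarrow> 'a::complex_vector"
  by standard (simp_all add: scaleC_add_right scaleC_add_left scaleC_scaleC scaleC_one)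

instantiation complex :: complex_vector
begin
definition scaleC_complex :: "complex \<Rightarrow> complex \<Rightarrow> complex" where
  "scaleC_complex a x = a * x"
instance by standard (simp_all add: scaleC_complex_def algebra_simps)
end

instantiation "fun" :: (type, complex_vector) complex_vector
begin
definition scaleC_fun :: "complex \<Rightarrow> ('a \<Rightarrow> 'b) \<Rightarrow> 'a \<Rightarrow> 'b" where
  "scaleC_fun a f = (\<lambda>x. a *C f x)"
instance
  by standard (simp_all add: scaleC_fun_def plus_fun_def scaleC_add_right scaleC_add_left
      scaleC_scaleC scaleC_one)
end

instantiation vec :: (complex_vector, finite) complex_vector
begin
definition scaleC_vec :: "complex \<Rightarrow> ('a, 'b) vec \<Rightarrow> ('a, 'b) vec" where
  "scaleC_vec a x = (\<chi> i. a *C (x $ i))"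
instance
  by standard (simp_all add: scaleC_vec_def vec_eq_iff scaleC_add_right scaleC_add_left
      scaleC_scaleC scaleC_one)
end

text \<open>The inner product is linear in its first argument. The last axiom makes it positive definite
  and ties it to the library norm; completeness comes from the class of Banach spaces.\<close>

class complex_hilbert = banach + complex_vector +
  fixes cinner :: "'a \<Rightarrow> 'a \<Rightarrow> complex"
  assumes scaleR_scaleC: "r *\<^sub>R x = complex_of_real r *C x"
    and cinner_commute: "cinner x y = cnj (cinner y x)"
    and cinner_add_left: "cinner (x + y) z = cinner x z + cinner y z"
    and cinner_scaleC_left: "cinner (a *C x) y = a * cinner x y"
    and cinner_self: "cinner x x = complex_of_real ((norm x)\<^sup>2)"

section \<open>Operators and semigroups on normed spaces given by a carrier and a norm function\<close>

definition clinear_on :: "'a::complex_vector set \<Rightarrow> ('a \<Rightarrow> 'b::complex_vector) \<Rightarrow> bool" where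
  "clinear_on V F \<longleftrightarrow>
     (\<forall>f\<in>V. \<forall>g\<in>V. F (f + g) = F f + F g) \<and> (\<forall>a. \<forall>f\<in>V. F (a *C f) = a *C F f)"

definition bounded_op ::
  "'a::complex_vector set \<Rightarrow> ('a \<Rightarrow> real) \<Rightarrow> 'b::complex_vector set \<Rightarrow> ('b \<Rightarrow> real)
    \<Rightarrow> ('a \<Rightarrow> 'b) \<Rightarrow> bool" where
  "bounded_op V N W M F \<longleftrightarrow>
     clinear_on V F \<and> F ` V \<subseteq> W \<and> (\<exists>C. \<forall>f\<in>V. M (F f) \<le> C * N f)"

definition isomorphism ::
  "'a::complex_vector set \<Rightarrow> ('a \<Rightarrow> real) \<Rightarrow> 'b::complex_vector set \<Rightarrow> ('b \<Rightarrow> real)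
    \<Rightarrow> ('a \<Rightarrow> 'b) \<Rightarrow> bool" where
  "isomorphism V N W M F \<longleftrightarrow>
     bounded_op V N W M F \<and> bij_betw F V W \<and> bounded_op W M V N (inv_into V F)"

definition c0_semigroup ::
  "'a::complex_vector set \<Rightarrow> ('a \<Rightarrow> real) \<Rightarrow> (real \<Rightarrow> 'a \<Rightarrow> 'a) \<Rightarrow> bool" where
  "c0_semigroup V N S \<longleftrightarrow>
     (\<forall>t\<ge>0. bounded_op V N V N (S t)) \<and>
     (\<forall>f\<in>V. S 0 f = f) \<and>
     (\<forall>s\<ge>0. \<forall>t\<ge>0. \<forall>f\<in>V. S (s + t) f = S s (S t f)) \<and>
     (\<forall>f\<in>V. ((\<lambda>t. N (S t f - f)) \<longlongrightarrow> 0) (at_right 0))"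

text \<open>The operator \<open>A\<close> with domain \<open>D\<close> is the infinitesimal generator of the semigroup \<open>S\<close>.\<close>

definition generates ::
  "'a::complex_vector set \<Rightarrow> ('a \<Rightarrow> real) \<Rightarrow> 'a set \<Rightarrow> ('a \<Rightarrow> 'a) \<Rightarrow> (real \<Rightarrow> 'a \<Rightarrow> 'a) \<Rightarrow> bool" where
  "generates V N D A S \<longleftrightarrow>
     c0_semigroup V N S \<and> D \<subseteq> V \<and> A ` D \<subseteq> V \<and>
     (\<forall>f\<in>V. \<forall>g\<in>V.
        ((\<lambda>h. N (complex_of_real (1 / h) *C (S h f - f) - g)) \<longlongrightarrow> 0) (at_right 0)
          \<longleftrightarrow> f \<in> D \<and> A f = g)"

definition finite_growth_bound ::
  "'a set \<Rightarrow> ('a \<Rightarrow> real) \<Rightarrow> (real \<Rightarrow> 'a \<Rightarrow> 'a) \<Rightarrow> bool" where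
  "finite_growth_bound V N S \<longleftrightarrow>
     (\<exists>M \<omega>. \<forall>t\<ge>0. \<forall>f\<in>V. N (S t f) \<le> M * exp (\<omega> * t) * N f)"

text \<open>The unique solution with initial value \<open>u0\<close> is the semigroup orbit \<open>t \<mapsto> S t u0\<close>.\<close>

definition exponentially_stable ::
  "'a::complex_vector set \<Rightarrow> ('a \<Rightarrow> real) \<Rightarrow> 'a set \<Rightarrow> ('a \<Rightarrow> 'a) \<Rightarrow> real \<Rightarrow> bool" where
  "exponentially_stable V N D A \<mu> \<longleftrightarrow>
     (\<exists>S. generates V N D A S \<and>
        (\<exists>C>0. \<forall>u0\<in>V. \<forall>t\<ge>0. N (S t u0) \<le> C * exp (- \<mu> * t) * N u0))"

section \<open>Riesz bases and multiplicities\<close>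

text \<open>A Riesz basis is the image of an orthonormal basis under an isomorphism of the space.\<close>

definition riesz_basis :: "'i set \<Rightarrow> ('i \<Rightarrow> 'a::complex_hilbert) \<Rightarrow> bool" where
  "riesz_basis I e \<longleftrightarrow>
     (\<exists>(b :: 'i \<Rightarrow> 'a) (V :: 'a \<Rightarrow> 'a).
        (\<forall>j\<in>I. \<forall>k\<in>I. cinner (b j) (b k) = (if j = k then 1 else 0)) \<and>
        closure (complex_vector.span (b ` I)) = UNIV \<and>
        isomorphism UNIV norm UNIV norm V \<and>
        (\<forall>j\<in>I. e j = V (b j)))"

definition eigenspace :: "'a::complex_vector set \<Rightarrow> ('a \<Rightarrow> 'a) \<Rightarrow> complex \<Rightarrow> 'a set" where
  "eigenspace D A z = {f \<in> D. A f = z *C f}"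

text \<open>Since the library dimension of an infinite-dimensional space is \<open>0\<close>, the bound on the
  multiplicities is expressed through finite spanning sets.\<close>

definition highest_multiplicity :: "'a::complex_vector set \<Rightarrow> ('a \<Rightarrow> 'a) \<Rightarrow> nat \<Rightarrow> bool" where
  "highest_multiplicity D A m \<longleftrightarrow>
     (\<forall>z. \<exists>E. finite E \<and> card E \<le> m \<and> eigenspace D A z \<subseteq> complex_vector.span E) \<and>
     (\<exists>z. complex_vector.dim (eigenspace D A z) = m)"

section \<open>Spaces of formal series\<close>

text \<open>A formal series \<open>\<Sum>n\<ge>1. f n *C \<phi> i n\<close> is its coefficient sequence, with value \<open>0\<close> at the
  unused index \<open>0\<close>.\<close>

definition Hs :: "real \<Rightarrow> (nat \<Rightarrow> complex) set" where
  "Hs s = {f. f 0 = 0 \<and> summable (\<lambda>n. real n powr (2 * s) * (cmod (f n))\<^sup>2)}"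

definition Hs_norm :: "real \<Rightarrow> (nat \<Rightarrow> complex) \<Rightarrow> real" where
  "Hs_norm s f = sqrt (\<Sum>n. real n powr (2 * s) * (cmod (f n))\<^sup>2)"

text \<open>The direct sum of the spaces \<open>Hs (s i)\<close>, with \<open>f i n\<close> the coefficient along \<open>\<phi> i n\<close>; the index
  set \<open>{1, \<dots>, m}\<close> is the finite type \<open>'m\<close>.\<close>

definition HH :: "('m \<Rightarrow> real) \<Rightarrow> ('m \<Rightarrow> nat \<Rightarrow> complex) set" where
  "HH s = {f. \<forall>i. f i \<in> Hs (s i)}"

definition HH_norm :: "('m::finite \<Rightarrow> real) \<Rightarrow> ('m \<Rightarrow> nat \<Rightarrow> complex) \<Rightarrow> real" where
  "HH_norm s f = sqrt (\<Sum>i\<in>UNIV. (Hs_norm (s i) (f i))\<^sup>2)"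

section \<open>The closed-loop system\<close>

definition diagonal ::
  "('m \<Rightarrow> nat \<Rightarrow> complex) \<Rightarrow> ('m \<Rightarrow> nat \<Rightarrow> complex) \<Rightarrow> 'm \<Rightarrow> nat \<Rightarrow> complex" where
  "diagonal lam f = (\<lambda>i n. lam i n * f i n)"

text \<open>\<open>\<Sum>i. y $ i *C B i\<close>, where \<open>B i\<close> lies in the \<open>i\<close>-th summand.\<close>

definition control ::
  "('m::finite \<Rightarrow> nat \<Rightarrow> complex) \<Rightarrow> complex ^ 'm \<Rightarrow> 'm \<Rightarrow> nat \<Rightarrow> complex" where
  "control B y = (\<lambda>i n. y $ i * B i n)"

text \<open>\<open>L\<close> is the continuous extension of the feedback \<open>K\<close> from \<open>HH s\<close> to a larger space \<open>HH \<sigma>\<close>.\<close>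

definition feedback_extension ::
  "('m::finite \<Rightarrow> real) \<Rightarrow> (('m \<Rightarrow> nat \<Rightarrow> complex) \<Rightarrow> complex ^ 'm) \<Rightarrow>
   ('m \<Rightarrow> real) \<Rightarrow> (('m \<Rightarrow> nat \<Rightarrow> complex) \<Rightarrow> complex ^ 'm) \<Rightarrow> bool" where
  "feedback_extension s K \<sigma> L \<longleftrightarrow>
     (\<forall>i. \<sigma> i \<le> s i) \<and> bounded_op (HH \<sigma>) (HH_norm \<sigma>) UNIV norm L \<and> (\<forall>f\<in>HH s. L f = K f)"

definition ext_domain ::
  "('m::finite \<Rightarrow> real) \<Rightarrow> (('m \<Rightarrow> nat \<Rightarrow> complex) \<Rightarrow> complex ^ 'm) \<Rightarrow>
   ('m \<Rightarrow> nat \<Rightarrow> complex) set" where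
  "ext_domain s K = {f. \<exists>\<sigma> L. feedback_extension s K \<sigma> L \<and> f \<in> HH \<sigma>}"

text \<open>The extended value is unique: finitely supported families are dense in each \<open>HH \<sigma>\<close>, and
  truncations of \<open>f\<close> converge to \<open>f\<close> simultaneously in all \<open>HH \<sigma>\<close> containing \<open>f\<close>.\<close>

definition ext_feedback ::
  "('m::finite \<Rightarrow> real) \<Rightarrow> (('m \<Rightarrow> nat \<Rightarrow> complex) \<Rightarrow> complex ^ 'm) \<Rightarrow>
   ('m \<Rightarrow> nat \<Rightarrow> complex) \<Rightarrow> complex ^ 'm" where
  "ext_feedback s K f = (THE y. \<exists>\<sigma> L. feedback_extension s K \<sigma> L \<and> f \<in> HH \<sigma> \<and> L f = y)"

definition closed_loop ::
  "('m::finite \<Rightarrow> nat \<Rightarrow> complex) \<Rightarrow> ('m \<Rightarrow> nat \<Rightarrow> complex) \<Rightarrow>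
   (('m \<Rightarrow> nat \<Rightarrow> complex) \<Rightarrow> complex ^ 'm) \<Rightarrow> ('m \<Rightarrow> nat \<Rightarrow> complex) \<Rightarrow>
   'm \<Rightarrow> nat \<Rightarrow> complex" where
  "closed_loop lam B K f = diagonal lam f + control B (K f)"

text \<open>The domain of the closed-loop operator in \<open>HH r\<close>, for a feedback given on \<open>HH s\<close>.\<close>

definition closed_loop_domain ::
  "('m::finite \<Rightarrow> real) \<Rightarrow> ('m \<Rightarrow> nat \<Rightarrow> complex) \<Rightarrow> ('m \<Rightarrow> nat \<Rightarrow> complex) \<Rightarrow>
   (('m \<Rightarrow> nat \<Rightarrow> complex) \<Rightarrow> complex ^ 'm) \<Rightarrow> ('m \<Rightarrow> real) \<Rightarrow>
   ('m \<Rightarrow> nat \<Rightarrow> complex) set" where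
  "closed_loop_domain s lam B K r =
     {f \<in> HH r. f \<in> ext_domain s K \<and> closed_loop lam B (ext_feedback s K) f \<in> HH r}"

definition closed_loop_stable ::
  "('m::finite \<Rightarrow> real) \<Rightarrow> ('m \<Rightarrow> nat \<Rightarrow> complex) \<Rightarrow> ('m \<Rightarrow> nat \<Rightarrow> complex) \<Rightarrow>
   (('m \<Rightarrow> nat \<Rightarrow> complex) \<Rightarrow> complex ^ 'm) \<Rightarrow> ('m \<Rightarrow> real) \<Rightarrow> real \<Rightarrow> bool" where
  "closed_loop_stable s lam B K r \<mu> \<longleftrightarrow>
     exponentially_stable (HH r) (HH_norm r)
       (closed_loop_domain s lam B K r) (closed_loop lam B (ext_feedback s K)) \<mu>"

text \<open>\<open>T (A + B K) = (A - l I) T\<close> from \<open>HH s\<close> to \<open>HH (- s)\<close>.\<close>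

definition maps_to_damped ::
  "('m::finite \<Rightarrow> real) \<Rightarrow> ('m \<Rightarrow> nat \<Rightarrow> complex) \<Rightarrow> ('m \<Rightarrow> nat \<Rightarrow> complex) \<Rightarrow>
   (('m \<Rightarrow> nat \<Rightarrow> complex) \<Rightarrow> complex ^ 'm) \<Rightarrow>
   (('m \<Rightarrow> nat \<Rightarrow> complex) \<Rightarrow> 'm \<Rightarrow> nat \<Rightarrow> complex) \<Rightarrow> real \<Rightarrow> bool" where
  "maps_to_damped s lam B K T l \<longleftrightarrow>
     (\<forall>f\<in>HH s.
        T (closed_loop lam B K f) \<in> HH (\<lambda>i. - s i) \<and>
        T (closed_loop lam B K f) = diagonal lam (T f) - complex_of_real l *C T f)"

definition admissible :: "('m \<Rightarrow> real) \<Rightarrow> ('m \<Rightarrow> real) \<Rightarrow> ('m \<Rightarrow> real) \<Rightarrow> bool" where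
  "admissible \<alpha> \<gamma> r \<longleftrightarrow> (\<forall>i. r i \<in> {1/2 - \<alpha> i + \<gamma> i <..< \<alpha> i - 1/2 - \<gamma> i})"

text \<open>One map \<open>T\<close> serves all admissible \<open>r\<close> at once.\<close>

definition equivalence_pair ::
  "('m::finite \<Rightarrow> real) \<Rightarrow> ('m \<Rightarrow> real) \<Rightarrow> ('m \<Rightarrow> nat \<Rightarrow> complex) \<Rightarrow> ('m \<Rightarrow> nat \<Rightarrow> complex) \<Rightarrow>
   real \<Rightarrow> (('m \<Rightarrow> nat \<Rightarrow> complex) \<Rightarrow> complex ^ 'm) \<Rightarrow>
   (('m \<Rightarrow> nat \<Rightarrow> complex) \<Rightarrow> 'm \<Rightarrow> nat \<Rightarrow> complex) \<Rightarrow> bool" where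
  "equivalence_pair \<alpha> \<gamma> lam B l K T \<longleftrightarrow>
     bounded_op (HH (\<lambda>i. \<alpha> i / 2)) (HH_norm (\<lambda>i. \<alpha> i / 2)) UNIV norm K \<and>
     (\<forall>r. admissible \<alpha> \<gamma> r \<longrightarrow> isomorphism (HH r) (HH_norm r) (HH r) (HH_norm r) T) \<and>
     maps_to_damped (\<lambda>i. \<alpha> i / 2) lam B K T l"

end

theory Submission
  imports Defs
begin

text \<open>
  The blocks do not interact once the \<open>i\<close>-th component of the feedback looks at the \<open>i\<close>-th block only,
  so the construction concerns one spectrum \<open>lam n\<close> with growing gaps and one input vector \<open>b\<close>. Asking
  for \<open>T b = b\<close> besides \<open>T (A + b K) = (A - l) T\<close> turns the latter into
  \<open>T A + b K = (A - l) T\<close>, whose entries can be solved for: with \<open>K n = x n / b n\<close>,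
  \<open>T p n = b p * x n / (b n * (lam p - l - lam n))\<close>, a weighted Cauchy matrix. The remaining condition
  \<open>T b = b\<close> reads \<open>(\<Sum>n. x n / (lam p - l - lam n)) = 1\<close> for every \<open>p\<close>. It says that the meromorphic
  function \<open>1 - (\<Sum>n. x n / (z - lam n))\<close>, which has poles \<open>lam n\<close>, has the zeros \<open>lam p - l\<close>; hence it
  should be \<open>\<Prod>n. 1 + l / (z - lam n)\<close>, and \<open>x n\<close> is determined by its residue at \<open>lam n\<close>. Finite
  products obey this by partial fractions, and dominated convergence gives \<open>cauchy_residue_sums\<close>.

  The inverse of \<open>T\<close> is the same construction for the spectrum \<open>lam n - l\<close> and the shift \<open>-l\<close>. The
  product of the two matrices is diagonal by partial fractions, and it fixes \<open>b\<close>, whose coefficients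
  do not vanish; so it is the identity (\<open>cauchy_mat_inverse\<close>). All entries exist if \<open>l\<close> avoids the
  countably many differences of eigenvalues. Boundedness in the weighted spaces follows by splitting
  the Cauchy kernel into a part near the diagonal, dominated by a summable convolution, and a part
  far from it, dominated by a rank one matrix (\<open>cauchy_kernel_bounded\<close>); the range of the weights is
  what makes the latter square summable.

  Stability is claimed for every pair \<open>(K, T)\<close>, not only for the constructed one. Formally the closed
  loop is conjugate by \<open>T\<close> to the diagonal operator \<open>A - l\<close>, whose semigroup decays because the growth
  bound of the open loop bounds the real parts of the eigenvalues (\<open>eigenvalue_growth_bound\<close>). The point
  is to match the domains. Since \<open>T\<close> is an isomorphism of two spaces whose exponents differ by \<open>\<alpha>\<close>, the
  relation \<open>b K f = T\<inverse> (A - l) T f - A f\<close> extends \<open>K\<close> to every exponent above \<open>1/2 + \<gamma>\<close> (\<open>K_bound\<close>), and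
  both candidates for the domain in \<open>HH r\<close> consist of elements of such a space
  (\<open>closed_loop_domain_iff\<close>).
\<close>


section \<open>The weighted spaces\<close>

abbreviation wt :: "real \<Rightarrow> (nat \<Rightarrow> complex) \<Rightarrow> nat \<Rightarrow> real" where
  "wt s f n \<equiv> real n powr s * cmod (f n)"

lemma wt_power2: "(wt s f n)\<^sup>2 = real n powr (2 * s) * (cmod (f n))\<^sup>2"
  by (simp add: power_mult_distrib powr_powr[symmetric] mult.commute flip: powr_numeral)

lemma L2_set_wt: "L2_set (wt s f) F = sqrt (\<Sum>n\<in>F. real n powr (2 * s) * (cmod (f n))\<^sup>2)"
  unfolding L2_set_def wt_power2 ..

text \<open>Membership in \<open>Hs\<close> and upper bounds of its norm reduce to a uniform bound of finite
  \<open>L2_set\<close> norms, so that the inequalities for \<open>L2_set\<close> become available.\<close>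

lemma Hs_boundI:
  assumes "f 0 = 0" and C: "\<And>N. L2_set (wt s f) {..<N} \<le> C"
  shows "f \<in> Hs s" and "Hs_norm s f \<le> C"
proof -
  have C0: "C \<ge> 0" using C[of 0] by simp
  have b: "(\<Sum>n<N. real n powr (2 * s) * (cmod (f n))\<^sup>2) \<le> C\<^sup>2" for N
    using C[of N] unfolding L2_set_wt by (rule sqrt_le_D)
  have S: "summable (\<lambda>n. real n powr (2 * s) * (cmod (f n))\<^sup>2)"
    by (rule summableI_nonneg_bounded[OF _ b]) simp
  then show "f \<in> Hs s" using assms(1) by (simp add: Hs_def)
  show "Hs_norm s f \<le> C"
    unfolding Hs_norm_def by (rule real_le_lsqrt) (use suminf_le_const[OF S b] C0 in auto)
qed

lemma L2_set_le_Hs_norm: "f \<in> Hs s \<Longrightarrow> finite F \<Longrightarrow> L2_set (wt s f) F \<le> Hs_norm s f"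
  unfolding L2_set_wt Hs_norm_def Hs_def by (intro real_sqrt_le_mono sum_le_suminf) auto

lemma Hs_norm_nonneg: "f \<in> Hs s \<Longrightarrow> Hs_norm s f \<ge> 0"
  using L2_set_le_Hs_norm[of f s "{}"] by simp

lemma HH_norm_L2: "HH_norm s f = L2_set (\<lambda>i. Hs_norm (s i) (f i)) UNIV"
  by (simp add: HH_norm_def L2_set_def)

lemma HH_norm_nonneg [simp]: "HH_norm s f \<ge> 0"
  by (simp add: HH_norm_L2)

lemma HH_D: "f \<in> HH s \<Longrightarrow> f i \<in> Hs (s i)" and HH_0: "f \<in> HH s \<Longrightarrow> f i 0 = 0"
  by (auto simp: HH_def Hs_def)

text \<open>All mapping properties of diagonal operators between these spaces are instances of the
  following comparison and of its version for several blocks.\<close>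

lemma Hs_dominated:
  assumes "f \<in> Hs s" "C \<ge> 0" "g 0 = 0" and "\<And>n. n \<ge> 1 \<Longrightarrow> wt t g n \<le> C * wt s f n"
  shows "g \<in> Hs t" and "Hs_norm t g \<le> C * Hs_norm s f"
proof -
  have "L2_set (wt t g) {..<N} \<le> C * Hs_norm s f" for N
  proof -
    have "L2_set (wt t g) {..<N} \<le> L2_set (\<lambda>n. C * wt s f n) {..<N}"
    proof (rule L2_set_mono)
      show "wt t g n \<le> C * wt s f n" for n
        using assms(3) assms(4)[of n] by (cases n) auto
    qed simp
    also have "\<dots> = C * L2_set (wt s f) {..<N}"
      using assms(2) by (simp add: L2_set_right_distrib)
    also have "\<dots> \<le> C * Hs_norm s f"
      using assms by (intro mult_left_mono L2_set_le_Hs_norm) auto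
    finally show ?thesis .
  qed
  from Hs_boundI[OF assms(3) this] show "g \<in> Hs t" "Hs_norm t g \<le> C * Hs_norm s f" by auto
qed

lemma HH_dominated:
  assumes "f \<in> HH s" "C \<ge> 0" "\<forall>i. g i 0 = 0"
    and "\<forall>i. \<forall>n\<ge>1. wt (t i) (g i) n \<le> C * wt (s i) (f i) n"
  shows "g \<in> HH t" and "HH_norm t g \<le> C * HH_norm s f"
proof -
  have "n \<ge> 1 \<Longrightarrow> wt (t i) (g i) n \<le> C * wt (s i) (f i) n" for i n using assms(4) by simp
  note * = Hs_dominated[OF HH_D[OF assms(1)] assms(2) assms(3)[rule_format] this]
  show g: "g \<in> HH t" using * by (simp add: HH_def)
  have "HH_norm t g \<le> L2_set (\<lambda>i. C * Hs_norm (s i) (f i)) UNIV"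
    unfolding HH_norm_L2 by (intro L2_set_mono *(2) Hs_norm_nonneg HH_D[OF g])
  then show "HH_norm t g \<le> C * HH_norm s f"
    using assms(2) by (simp add: HH_norm_L2 L2_set_right_distrib)
qed

lemma HH_add:
  assumes f: "f \<in> HH s" and g: "g \<in> HH s"
  shows "f + g \<in> HH s" and "HH_norm s (f + g) \<le> HH_norm s f + HH_norm s g"
proof -
  have *: "L2_set (wt (s i) ((f + g) i)) {..<N} \<le> Hs_norm (s i) (f i) + Hs_norm (s i) (g i)" for i N
  proof -
    have "L2_set (wt (s i) ((f + g) i)) {..<N}
        \<le> L2_set (\<lambda>n. wt (s i) (f i) n + wt (s i) (g i) n) {..<N}"
      by (rule L2_set_mono)
        (auto simp: distrib_left[symmetric] intro!: mult_left_mono norm_triangle_ineq)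
    also have "\<dots> \<le> L2_set (wt (s i) (f i)) {..<N} + L2_set (wt (s i) (g i)) {..<N}"
      by (rule L2_set_triangle_ineq)
    also have "\<dots> \<le> Hs_norm (s i) (f i) + Hs_norm (s i) (g i)"
      by (intro add_mono L2_set_le_Hs_norm HH_D f g) auto
    finally show ?thesis .
  qed
  have 0: "(f + g) i 0 = 0" for i using HH_0[OF f] HH_0[OF g] by simp
  note ** = Hs_boundI[OF 0 *]
  show m: "f + g \<in> HH s" unfolding HH_def using **(1) by blast
  have "HH_norm s (f + g) \<le> L2_set (\<lambda>i. Hs_norm (s i) (f i) + Hs_norm (s i) (g i)) UNIV"
    unfolding HH_norm_L2 by (intro L2_set_mono **(2) Hs_norm_nonneg HH_D[OF m])
  also have "\<dots> \<le> HH_norm s f + HH_norm s g"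
    unfolding HH_norm_L2 by (rule L2_set_triangle_ineq)
  finally show "HH_norm s (f + g) \<le> HH_norm s f + HH_norm s g" .
qed

lemma HH_scale:
  assumes "f \<in> HH s"
  shows "a *C f \<in> HH s" and "HH_norm s (a *C f) \<le> cmod a * HH_norm s f"
  using HH_dominated[OF assms, of "cmod a" "a *C f" s] HH_0[OF assms]
  by (auto simp: scaleC_fun_def scaleC_complex_def norm_mult)

lemma HH_diff:
  assumes f: "f \<in> HH s" and g: "g \<in> HH s"
  shows "f - g \<in> HH s" and "HH_norm s (f - g) \<le> HH_norm s f + HH_norm s g"
proof -
  have e: "f - g = f + (-1) *C g"
    by (rule ext, rule ext) (simp add: scaleC_fun_def scaleC_complex_def)
  show "f - g \<in> HH s" unfolding e by (intro HH_add HH_scale f g)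
  show "HH_norm s (f - g) \<le> HH_norm s f + HH_norm s g"
    unfolding e using HH_add(2)[OF f HH_scale(1)[OF g, of "-1"]] HH_scale(2)[OF g, of "-1"] by simp
qed

lemma HH_mono:
  assumes "f \<in> HH s" "\<And>i. t i \<le> s i"
  shows "f \<in> HH t" and "HH_norm t f \<le> HH_norm s f"
proof -
  have *: "\<forall>i. \<forall>n\<ge>1. wt (t i) (f i) n \<le> 1 * wt (s i) (f i) n"
    using assms(2) by (auto intro!: mult_right_mono powr_mono)
  show "f \<in> HH t" "HH_norm t f \<le> HH_norm s f"
    using HH_dominated[OF assms(1) _ _ *] HH_0[OF assms(1)] by simp_all
qed

lemma HH_coeff:
  assumes "f \<in> HH s" shows "real n powr s i * cmod (f i n) \<le> HH_norm s f"
proof -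
  have "wt (s i) (f i) n \<le> L2_set (wt (s i) (f i)) {n}" by simp
  also have "\<dots> \<le> Hs_norm (s i) (f i)" by (intro L2_set_le_Hs_norm HH_D assms) auto
  also have "\<dots> \<le> HH_norm s f" unfolding HH_norm_L2 by (rule member_le_L2_set) auto
  finally show ?thesis .
qed

lemma HH_coeff_tendsto:
  assumes "\<And>h. g h \<in> HH s" "((\<lambda>h. HH_norm s (g h)) \<longlongrightarrow> 0) F"
  shows "((\<lambda>h. g h i n) \<longlongrightarrow> 0) F"
proof (cases "n = 0")
  case True
  then show ?thesis using HH_0[OF assms(1)] by simp
next
  case False
  show ?thesis
  proof (rule tendsto_norm_zero_cancel, rule tendsto_sandwich)
    show "\<forall>\<^sub>F h in F. 0 \<le> cmod (g h i n)" by simp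
    show "\<forall>\<^sub>F h in F. cmod (g h i n) \<le> HH_norm s (g h) / real n powr s i"
      using HH_coeff[OF assms(1), of n i] False by (intro always_eventually) (auto simp: field_simps)
    show "((\<lambda>h. HH_norm s (g h) / real n powr s i) \<longlongrightarrow> 0) F"
      using tendsto_divide_zero[OF assms(2)] .
  qed auto
qed

text \<open>Dominated convergence for multipliers: it yields the convergence of truncations as well as
  the strong continuity and the differentiability of diagonal semigroups.\<close>

lemma HH_multiplier_tendsto_0:
  fixes a :: "'b \<Rightarrow> 'm::finite \<Rightarrow> nat \<Rightarrow> complex"
  assumes f: "f \<in> HH s" and b: "\<forall>\<^sub>F h in F. \<forall>i. \<forall>n\<ge>1. cmod (a h i n) \<le> C"
    and lim: "\<And>i n. n \<ge> 1 \<Longrightarrow> ((\<lambda>h. a h i n) \<longlongrightarrow> 0) F" and F: "F \<noteq> bot"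
  shows "((\<lambda>h. HH_norm s (\<lambda>i n. a h i n * f i n)) \<longlongrightarrow> 0) F"
proof -
  have "((\<lambda>h. \<Sum>n. real n powr (2 * s i) * (cmod (a h i n * f i n))\<^sup>2) \<longlongrightarrow> (\<Sum>n::nat. 0)) F" for i
  proof (rule tannerys_theorem[THEN conjunct2, THEN conjunct2])
    show "((\<lambda>h. real n powr (2 * s i) * (cmod (a h i n * f i n))\<^sup>2) \<longlongrightarrow> 0) F" for n
    proof (cases "n = 0")
      case False
      then have "((\<lambda>h. real n powr (2 * s i) * (cmod (a h i n * f i n))\<^sup>2)
          \<longlongrightarrow> real n powr (2 * s i) * (cmod (0 * f i n))\<^sup>2) F"
        by (intro tendsto_intros lim) auto
      then show ?thesis by simp
    qed simp
    show "\<forall>\<^sub>F (n, h) in sequentially \<times>\<^sub>F F.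
        norm (real n powr (2 * s i) * (cmod (a h i n * f i n))\<^sup>2)
        \<le> C\<^sup>2 * (real n powr (2 * s i) * (cmod (f i n))\<^sup>2)"
    proof -
      have "\<forall>\<^sub>F (n, h) in sequentially \<times>\<^sub>F F. (\<forall>i. \<forall>n\<ge>1. cmod (a h i n) \<le> C)"
        using b by (subst eventually_prod2) auto
      then show ?thesis
      proof eventually_elim
        case (elim z)
        show ?case
        proof (cases "fst z = 0")
          case False
          then have "(cmod (a (snd z) i (fst z)))\<^sup>2 \<le> C\<^sup>2"
            using elim by (intro power_mono) (auto simp: case_prod_beta)
          then have "real (fst z) powr (2 * s i) * (cmod (f i (fst z)))\<^sup>2 * (cmod (a (snd z) i (fst z)))\<^sup>2
              \<le> real (fst z) powr (2 * s i) * (cmod (f i (fst z)))\<^sup>2 * C\<^sup>2"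
            by (rule mult_left_mono) simp
          then show ?thesis
            by (simp add: case_prod_beta norm_mult power_mult_distrib mult_ac)
        qed (simp add: case_prod_beta)
      qed
    qed
    show "summable (\<lambda>n. C\<^sup>2 * (real n powr (2 * s i) * (cmod (f i n))\<^sup>2))"
      using HH_D[OF f, of i] by (intro summable_mult) (simp add: Hs_def)
  qed (rule F)
  then have "((\<lambda>h. (Hs_norm (s i) (\<lambda>n. a h i n * f i n))\<^sup>2) \<longlongrightarrow> (sqrt 0)\<^sup>2) F" for i
    unfolding Hs_norm_def by (intro tendsto_intros) auto
  then have "((\<lambda>h. HH_norm s (\<lambda>i n. a h i n * f i n)) \<longlongrightarrow> sqrt (\<Sum>i\<in>(UNIV::'m set). (sqrt 0)\<^sup>2)) F"
    unfolding HH_norm_def by (intro tendsto_intros) auto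
  then show ?thesis by simp
qed

definition trunc :: "nat \<Rightarrow> ('m \<Rightarrow> nat \<Rightarrow> complex) \<Rightarrow> 'm \<Rightarrow> nat \<Rightarrow> complex" where
  "trunc N f = (\<lambda>i n. if n < N then f i n else 0)"

lemma trunc_linear: "trunc N (f + g) = trunc N f + trunc N g" "trunc N (a *C f) = a *C trunc N f"
  by (auto simp: trunc_def fun_eq_iff scaleC_fun_def scaleC_complex_def)

lemma trunc_HH:
  assumes "f \<in> HH s"
  shows "trunc N f \<in> HH t"
proof -
  have "summable (\<lambda>n. real n powr (2 * t i) * (cmod (trunc N f i n))\<^sup>2)" for i
    by (rule summable_finite[of "{..<N}"]) (auto simp: trunc_def)
  then show ?thesis using HH_0[OF assms] by (auto simp: HH_def Hs_def trunc_def)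
qed

lemma trunc_HH_norm_le: "f \<in> HH s \<Longrightarrow> HH_norm s (trunc N f) \<le> HH_norm s f"
  using HH_dominated(2)[of f s 1 "trunc N f" s] HH_0[of f s] by (auto simp: trunc_def)

lemma trunc_tendsto:
  assumes "f \<in> HH s"
  shows "(\<lambda>N. HH_norm s (trunc N f - f)) \<longlonglongrightarrow> 0"
proof -
  have "(\<lambda>N. HH_norm s (\<lambda>i n. (if n < N then 0 else -1) * f i n)) \<longlonglongrightarrow> 0"
  proof (rule HH_multiplier_tendsto_0[OF assms, where C = 1])
    show "(\<lambda>N. if n < N then 0 else - 1 :: complex) \<longlonglongrightarrow> 0" for n
      by (rule tendsto_eventually) (auto intro: eventually_mono[OF eventually_gt_at_top[of n]])
  qed (auto intro!: always_eventually)
  moreover have "trunc N f - f = (\<lambda>i n. (if n < N then 0 else -1) * f i n)" for N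
    by (auto simp: trunc_def fun_eq_iff)
  ultimately show ?thesis by simp
qed

section \<open>Matrices acting on weighted sequences\<close>

text \<open>The bound is stated on finite sections, which makes it stable under sums and majorisation
  without any summability side condition.\<close>

definition l2_bounded :: "(nat \<Rightarrow> nat \<Rightarrow> real) \<Rightarrow> real \<Rightarrow> bool" where
  "l2_bounded a C \<longleftrightarrow> C \<ge> 0 \<and> (\<forall>p n. a p n \<ge> 0) \<and>
     (\<forall>P N g. (\<forall>n. g n \<ge> 0) \<longrightarrow> L2_set (\<lambda>p. \<Sum>n<N. a p n * g n) {..<P} \<le> C * L2_set g {..<N})"

lemma l2_boundedD:
  "l2_bounded a C \<Longrightarrow> (\<And>n. g n \<ge> 0) \<Longrightarrow>
    L2_set (\<lambda>p. \<Sum>n<N. a p n * g n) {..<P} \<le> C * L2_set g {..<N}"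
  by (simp add: l2_bounded_def)

lemma l2_bounded_mono:
  assumes "l2_bounded b C" "\<And>p n. 0 \<le> a p n" "\<And>p n. a p n \<le> b p n"
  shows "l2_bounded a C"
  unfolding l2_bounded_def
proof (intro conjI allI impI)
  fix P N :: nat and g :: "nat \<Rightarrow> real" assume g: "\<forall>n. 0 \<le> g n"
  have "L2_set (\<lambda>p. \<Sum>n<N. a p n * g n) {..<P} \<le> L2_set (\<lambda>p. \<Sum>n<N. b p n * g n) {..<P}"
    using assms g by (intro L2_set_mono sum_mono mult_right_mono sum_nonneg mult_nonneg_nonneg) auto
  also have "\<dots> \<le> C * L2_set g {..<N}"
    using assms(1) g by (simp add: l2_boundedD)
  finally show "L2_set (\<lambda>p. \<Sum>n<N. a p n * g n) {..<P} \<le> C * L2_set g {..<N}" .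
qed (use assms in \<open>auto simp: l2_bounded_def\<close>)

lemma l2_bounded_add:
  assumes a: "l2_bounded a C" and b: "l2_bounded b E"
  shows "l2_bounded (\<lambda>p n. a p n + b p n) (C + E)"
  unfolding l2_bounded_def
proof (intro conjI allI impI)
  fix P N :: nat and g :: "nat \<Rightarrow> real" assume g: "\<forall>n. 0 \<le> g n"
  have "L2_set (\<lambda>p. \<Sum>n<N. (a p n + b p n) * g n) {..<P}
      = L2_set (\<lambda>p. (\<Sum>n<N. a p n * g n) + (\<Sum>n<N. b p n * g n)) {..<P}"
    by (simp add: distrib_right sum.distrib)
  also have "\<dots> \<le> L2_set (\<lambda>p. \<Sum>n<N. a p n * g n) {..<P} + L2_set (\<lambda>p. \<Sum>n<N. b p n * g n) {..<P}"
    by (rule L2_set_triangle_ineq)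
  also have "\<dots> \<le> (C + E) * L2_set g {..<N}"
    using l2_boundedD[OF a, of g N P] l2_boundedD[OF b, of g N P] g by (simp add: distrib_right)
  finally show "L2_set (\<lambda>p. \<Sum>n<N. (a p n + b p n) * g n) {..<P} \<le> (C + E) * L2_set g {..<N}" .
qed (use assms in \<open>auto simp: l2_bounded_def\<close>)

lemma l2_bounded_scale:
  assumes "l2_bounded a C" "e \<ge> 0"
  shows "l2_bounded (\<lambda>p n. e * a p n) (e * C)"
  unfolding l2_bounded_def
proof (intro conjI allI impI)
  fix P N :: nat and g :: "nat \<Rightarrow> real" assume g: "\<forall>n. 0 \<le> g n"
  have "L2_set (\<lambda>p. \<Sum>n<N. e * a p n * g n) {..<P} = e * L2_set (\<lambda>p. \<Sum>n<N. a p n * g n) {..<P}"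
    using assms(2) by (simp add: L2_set_right_distrib sum_distrib_left mult.assoc)
  then show "L2_set (\<lambda>p. \<Sum>n<N. e * a p n * g n) {..<P} \<le> e * C * L2_set g {..<N}"
    using mult_left_mono[OF l2_boundedD[OF assms(1), of g N P] assms(2)] g by (simp add: mult.assoc)
qed (use assms in \<open>auto simp: l2_bounded_def\<close>)

lemma L2_set_le_sqrt_suminf:
  assumes "summable (\<lambda>n::nat. (u n)\<^sup>2)"
  shows "L2_set u {..<N} \<le> sqrt (\<Sum>n. (u n)\<^sup>2)"
  unfolding L2_set_def using assms by (intro real_sqrt_le_mono sum_le_suminf) auto

lemma l2_bounded_rank_one:
  assumes u: "\<And>n. u n \<ge> 0" "summable (\<lambda>n. (u n)\<^sup>2)" and v: "\<And>n. v n \<ge> 0" "summable (\<lambda>n. (v n)\<^sup>2)"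
  shows "l2_bounded (\<lambda>p n. u p * v n) (sqrt (\<Sum>n. (u n)\<^sup>2) * sqrt (\<Sum>n. (v n)\<^sup>2))"
  unfolding l2_bounded_def
proof (intro conjI allI impI)
  fix P N :: nat and g :: "nat \<Rightarrow> real" assume g: "\<forall>n. 0 \<le> g n"
  have "(\<Sum>n<N. v n * g n) \<le> L2_set v {..<N} * L2_set g {..<N}"
    using L2_set_mult_ineq[of v g "{..<N}"] v g by simp
  also have "\<dots> \<le> sqrt (\<Sum>n. (v n)\<^sup>2) * L2_set g {..<N}"
    by (intro mult_right_mono L2_set_le_sqrt_suminf v) simp
  finally have 1: "(\<Sum>n<N. v n * g n) \<le> sqrt (\<Sum>n. (v n)\<^sup>2) * L2_set g {..<N}" .
  have "L2_set (\<lambda>p. \<Sum>n<N. u p * v n * g n) {..<P} = L2_set u {..<P} * (\<Sum>n<N. v n * g n)"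
    using v g by (subst L2_set_left_distrib) (auto simp: sum_distrib_left mult.assoc intro!: sum_nonneg)
  also have "\<dots> \<le> sqrt (\<Sum>n. (u n)\<^sup>2) * (sqrt (\<Sum>n. (v n)\<^sup>2) * L2_set g {..<N})"
    using v g by (intro mult_mono L2_set_le_sqrt_suminf u 1) (auto intro!: sum_nonneg suminf_nonneg u(2))
  finally show "L2_set (\<lambda>p. \<Sum>n<N. u p * v n * g n) {..<P}
      \<le> sqrt (\<Sum>n. (u n)\<^sup>2) * sqrt (\<Sum>n. (v n)\<^sup>2) * L2_set g {..<N}" by (simp add: mult.assoc)
qed (use u v in \<open>auto intro!: mult_nonneg_nonneg suminf_nonneg\<close>)

lemma sum_convolution_le:
  fixes k :: "nat \<Rightarrow> real"
  assumes k: "\<And>j. k j \<ge> 0" "summable k"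
  shows "(\<Sum>n<N. k ((p - n) + (n - p))) \<le> 2 * suminf k"
proof -
  have "(\<Sum>n<N. k ((p - n) + (n - p))) \<le> (\<Sum>n\<in>{..p} \<union> {p<..<N}. k ((p - n) + (n - p)))"
    by (rule sum_mono2) (auto simp: k)
  also have "\<dots> = (\<Sum>n\<in>{..p}. k ((p - n) + (n - p))) + (\<Sum>n\<in>{p<..<N}. k ((p - n) + (n - p)))"
    by (rule sum.union_disjoint) auto
  also have "(\<Sum>n\<in>{..p}. k ((p - n) + (n - p))) = (\<Sum>j\<in>(\<lambda>n. p - n) ` {..p}. k j)"
    by (subst sum.reindex) (auto simp: inj_on_def intro!: sum.cong)
  also have "\<dots> \<le> suminf k" using k by (intro sum_le_suminf) auto
  also have "(\<Sum>n\<in>{p<..<N}. k ((p - n) + (n - p))) = (\<Sum>j\<in>(\<lambda>n. n - p) ` {p<..<N}. k j)"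
    by (subst sum.reindex) (auto simp: inj_on_def intro!: sum.cong)
  also have "\<dots> \<le> suminf k" using k by (intro sum_le_suminf) auto
  finally show ?thesis by simp
qed

text \<open>The Schur test with trivial weights. On natural numbers \<open>(p - n) + (n - p)\<close> is the
  distance of \<open>p\<close> and \<open>n\<close>.\<close>

lemma l2_bounded_convolution:
  assumes k: "\<And>j. k j \<ge> 0" "summable k"
  shows "l2_bounded (\<lambda>p n. k ((p - n) + (n - p))) (2 * suminf k)"
  unfolding l2_bounded_def
proof (intro conjI allI impI)
  define R where "R = 2 * suminf k"
  have R: "R \<ge> 0" using k by (auto simp: R_def intro: suminf_nonneg)
  fix P N :: nat and g :: "nat \<Rightarrow> real" assume g: "\<forall>n. 0 \<le> g n"
  let ?k = "\<lambda>p n. k ((p - n) + (n - p))"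
  have row: "(\<Sum>n<N. ?k p n * g n)\<^sup>2 \<le> R * (\<Sum>n<N. ?k p n * (g n)\<^sup>2)" for p
  proof -
    have "(\<Sum>n<N. ?k p n * g n) = (\<Sum>n<N. \<bar>sqrt (?k p n)\<bar> * \<bar>sqrt (?k p n) * g n\<bar>)"
      using k g by (intro sum.cong) (auto simp: abs_mult mult.assoc[symmetric])
    also have "\<dots> \<le> L2_set (\<lambda>n. sqrt (?k p n)) {..<N} * L2_set (\<lambda>n. sqrt (?k p n) * g n) {..<N}"
      by (rule L2_set_mult_ineq)
    finally have "(\<Sum>n<N. ?k p n * g n)\<^sup>2
        \<le> (L2_set (\<lambda>n. sqrt (?k p n)) {..<N} * L2_set (\<lambda>n. sqrt (?k p n) * g n) {..<N})\<^sup>2"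
      using k g by (intro power_mono sum_nonneg) auto
    also have "\<dots> = (\<Sum>n<N. ?k p n) * (\<Sum>n<N. ?k p n * (g n)\<^sup>2)"
      using k g by (simp add: L2_set_def power_mult_distrib sum_nonneg)
    also have "\<dots> \<le> R * (\<Sum>n<N. ?k p n * (g n)\<^sup>2)"
      unfolding R_def using k by (intro mult_right_mono sum_convolution_le sum_nonneg) auto
    finally show ?thesis .
  qed
  have "(\<Sum>p<P. (\<Sum>n<N. ?k p n * g n)\<^sup>2) \<le> (\<Sum>p<P. R * (\<Sum>n<N. ?k p n * (g n)\<^sup>2))"
    by (intro sum_mono row)
  also have "\<dots> = R * (\<Sum>n<N. (\<Sum>p<P. ?k p n) * (g n)\<^sup>2)"
    by (subst sum_distrib_left[symmetric], subst sum.swap) (simp add: sum_distrib_right)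
  also have "\<dots> \<le> R * (\<Sum>n<N. R * (g n)\<^sup>2)"
  proof (intro mult_left_mono sum_mono mult_right_mono R)
    show "(\<Sum>p<P. ?k p n) \<le> R" for n
      using sum_convolution_le[of k n P] k by (simp add: R_def add.commute)
  qed simp
  also have "\<dots> = (R * L2_set g {..<N})\<^sup>2"
    by (simp add: L2_set_def power_mult_distrib sum_nonneg sum_distrib_left[symmetric] power2_eq_square)
  finally have "L2_set (\<lambda>p. \<Sum>n<N. ?k p n * g n) {..<P} \<le> sqrt ((R * L2_set g {..<N})\<^sup>2)"
    unfolding L2_set_def[of "\<lambda>p. \<Sum>n<N. ?k p n * g n"] by (rule real_sqrt_le_mono)
  then show "L2_set (\<lambda>p. \<Sum>n<N. ?k p n * g n) {..<P} \<le> 2 * suminf k * L2_set g {..<N}"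
    using R by (simp add: R_def)
qed (use k in \<open>auto intro: suminf_nonneg\<close>)

definition mat_apply :: "(nat \<Rightarrow> nat \<Rightarrow> complex) \<Rightarrow> (nat \<Rightarrow> complex) \<Rightarrow> nat \<Rightarrow> complex" where
  "mat_apply a f p = (if p = 0 then 0 else \<Sum>n. a p n * f n)"

text \<open>A majorant of the weighted entries that is bounded on square summable sequences makes the rows
  converge absolutely on \<open>Hs s\<close>: the partial sums of one row are bounded by the norm of the finite
  section, uniformly in the section.\<close>

lemma mat_apply_Hs:
  assumes k: "l2_bounded k C" and f: "f \<in> Hs s"
    and le: "\<forall>p\<ge>1. \<forall>n\<ge>1. real p powr t * cmod (a p n) \<le> k p n * real n powr s"
  shows "p \<ge> 1 \<Longrightarrow> summable (\<lambda>n. norm (a p n * f n))"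
    and "mat_apply a f \<in> Hs t" and "Hs_norm t (mat_apply a f) \<le> C * Hs_norm s f"
proof -
  have C: "C \<ge> 0" and k0: "\<And>p n. k p n \<ge> 0" using k by (auto simp: l2_bounded_def)
  have f0: "f 0 = 0" using f by (simp add: Hs_def)
  let ?S = "\<lambda>N p. \<Sum>n<N. k p n * wt s f n"
  have B: "L2_set (?S N) {..<P} \<le> C * Hs_norm s f" for N P
  proof -
    have "L2_set (?S N) {..<P} \<le> C * L2_set (wt s f) {..<N}" by (rule l2_boundedD[OF k]) simp
    also have "\<dots> \<le> C * Hs_norm s f" by (intro mult_left_mono L2_set_le_Hs_norm f C) simp
    finally show ?thesis .
  qed
  have le': "real p powr t * norm (a p n * f n) \<le> k p n * wt s f n" if "p \<ge> 1" for p n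
  proof (cases "n = 0")
    case False
    then show ?thesis using mult_right_mono[OF le[rule_format, OF that, of n], of "cmod (f n)"]
      by (simp add: norm_mult mult.assoc)
  qed (simp add: f0)
  have Sp: "?S N p \<le> C * Hs_norm s f" for N p
    using B[where P = "Suc p"] member_le_L2_set[of "{..<Suc p}" p "?S N"] by (meson finite_lessThan lessThan_iff lessI order_trans)
  have sum_k: "summable (\<lambda>n. k p n * wt s f n)" for p
    by (rule summableI_nonneg_bounded[OF _ Sp]) (simp add: k0)
  have sm: "summable (\<lambda>n. norm (a p n * f n))" if "p \<ge> 1" for p
  proof (rule summable_comparison_test'[of "\<lambda>n. k p n * wt s f n / real p powr t" 0])
    show "summable (\<lambda>n. k p n * wt s f n / real p powr t)" by (intro summable_divide sum_k)
    show "norm (norm (a p n * f n)) \<le> k p n * wt s f n / real p powr t" for n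
      using le'[OF that, of n] that by (simp add: field_simps)
  qed
  then show "p \<ge> 1 \<Longrightarrow> summable (\<lambda>n. norm (a p n * f n))" .
  have le2: "wt t (mat_apply a f) p \<le> (\<Sum>n. k p n * wt s f n)" for p
  proof (cases "p = 0")
    case False
    then have p: "p \<ge> 1" by simp
    have "wt t (mat_apply a f) p \<le> real p powr t * (\<Sum>n. norm (a p n * f n))"
      using False by (simp add: mat_apply_def mult_left_mono summable_norm[OF sm[OF p]])
    also have "\<dots> = (\<Sum>n. real p powr t * norm (a p n * f n))"
      by (rule suminf_mult[symmetric]) (rule sm[OF p])
    also have "\<dots> \<le> (\<Sum>n. k p n * wt s f n)"
      by (intro suminf_le le' p sum_k summable_mult sm)
    finally show ?thesis .
  qed (auto intro!: suminf_nonneg sum_k mult_nonneg_nonneg k0)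
  have "L2_set (wt t (mat_apply a f)) {..<P} \<le> C * Hs_norm s f" for P
  proof -
    have "L2_set (wt t (mat_apply a f)) {..<P} \<le> L2_set (\<lambda>p. \<Sum>n. k p n * wt s f n) {..<P}"
      by (intro L2_set_mono le2) simp
    also have "\<dots> \<le> C * Hs_norm s f"
    proof (rule LIMSEQ_le_const2)
      show "(\<lambda>N. L2_set (?S N) {..<P}) \<longlonglongrightarrow> L2_set (\<lambda>p. \<Sum>n. k p n * wt s f n) {..<P}"
        unfolding L2_set_def by (intro tendsto_intros summable_LIMSEQ sum_k)
      show "\<exists>N0. \<forall>N\<ge>N0. L2_set (?S N) {..<P} \<le> C * Hs_norm s f" using B by blast
    qed
    finally show ?thesis .
  qed
  then show "mat_apply a f \<in> Hs t" "Hs_norm t (mat_apply a f) \<le> C * Hs_norm s f"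
    using Hs_boundI[of "mat_apply a f" t] by (auto simp: mat_apply_def)
qed

text \<open>Up to a constant, this dominates the entries of the transformation of one block after
  conjugation with the weights \<open>real n powr r\<close>.\<close>

definition cauchy_kernel :: "real \<Rightarrow> real \<Rightarrow> real \<Rightarrow> nat \<Rightarrow> nat \<Rightarrow> real" where
  "cauchy_kernel a g r p n =
     (if p = 0 \<or> n = 0 then 0 else if p = n then 1
      else real p powr g * (real p powr r / real n powr r)
             / (real (max p n) powr (a - 1) * \<bar>real p - real n\<bar>))"

text \<open>Entries with \<open>max p n \<le> 2 * min p n\<close> are majorised by a summable convolution kernel, because
  the distance is at most the maximum. Far from the diagonal the distance is comparable with the
  maximum, whose negative power is split between the two indices; the exponent \<open>\<tau>\<close> is chosen so that
  both factors are square summable, and the bounds on \<open>r\<close> say that such a \<open>\<tau>\<close> exists.\<close>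

lemma cauchy_kernel_bounded:
  assumes g: "0 \<le> g" "g < a - 1" and r: "1/2 - a < r" "r < a - 1/2 - g"
  shows "\<exists>C. l2_bounded (cauchy_kernel a g r) C"
proof -
  obtain \<tau> where \<tau>: "max 0 (1/2 - r) < \<tau>" "\<tau> < min a (a - g - r - 1/2)"
    using dense[of "max 0 (1/2 - r)" "min a (a - g - r - 1/2)"] g r by auto
  define e where "e = a - 1 - g"
  have e: "e > 0" using g by (simp add: e_def)
  define k where "k = (\<lambda>j. if j = 0 then 1 else 2 powr \<bar>r\<bar> * real j powr (- 1 - e))"
  define u where "u = (\<lambda>p::nat. real p powr (g + r - a + \<tau>))"
  define v where "v = (\<lambda>n::nat. 2 * real n powr (- r - \<tau>))"
  have "summable (\<lambda>j. real j powr (- 1 - e))" using e by (simp add: summable_real_powr_iff)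
  then have "summable (\<lambda>j. 2 powr \<bar>r\<bar> * real j powr (- 1 - e))" by (rule summable_mult)
  then have sk: "summable k"
    by (subst summable_cong[where g = "\<lambda>j. 2 powr \<bar>r\<bar> * real j powr (- 1 - e)"])
      (auto simp: k_def intro: eventually_mono[OF eventually_gt_at_top[of 0]])
  have su: "summable (\<lambda>n. (u n)\<^sup>2)" and sv: "summable (\<lambda>n. (v n)\<^sup>2)"
  proof -
    have *: "(real n powr x)\<^sup>2 = real n powr (x * 2)" for n x
      by (simp add: powr_powr[symmetric])
    have "summable (\<lambda>n. real n powr ((g + r - a + \<tau>) * 2))"
      using \<tau> by (simp add: summable_real_powr_iff)
    then show "summable (\<lambda>n. (u n)\<^sup>2)" by (simp add: u_def *)
    have "summable (\<lambda>n. 4 * real n powr ((- r - \<tau>) * 2))"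
      using \<tau> by (intro summable_mult) (simp add: summable_real_powr_iff)
    then show "summable (\<lambda>n. (v n)\<^sup>2)" by (simp add: v_def power_mult_distrib *)
  qed
  have le: "cauchy_kernel a g r p n \<le> k ((p - n) + (n - p)) + u p * v n" for p n
  proof (cases "p = 0 \<or> n = 0 \<or> p = n")
    case True
    then show ?thesis by (auto simp: cauchy_kernel_def k_def u_def v_def)
  next
    case False
    then have p: "p \<ge> 1" and n: "n \<ge> 1" and pn: "p \<noteq> n" by auto
    define M D where "M = real (max p n)" and "D = \<bar>real p - real n\<bar>"
    have D: "D \<ge> 1" "D \<le> M" "D = real ((p - n) + (n - p))" using p n pn by (auto simp: D_def M_def)
    have M: "M \<ge> 1" "real p \<le> M" "real n \<le> M" using p by (auto simp: M_def)
    have K: "cauchy_kernel a g r p n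
        = real p powr g * (real p powr r / real n powr r) / (M powr (a - 1) * D)"
      using False by (simp add: cauchy_kernel_def M_def D_def)
    show ?thesis
    proof (cases "max p n \<le> 2 * min p n")
      case True
      have q: "real p powr r / real n powr r \<le> 2 powr \<bar>r\<bar>"
      proof -
        have "real p powr r / real n powr r = (real p / real n) powr r"
          by (simp add: powr_divide)
        also have "\<dots> \<le> 2 powr \<bar>r\<bar>"
        proof (cases "r \<ge> 0")
          case True
          have "p \<le> 2 * n" using \<open>max p n \<le> 2 * min p n\<close> by linarith
          then have "real p / real n \<le> 2" using n by (simp add: field_simps)
          then show ?thesis using True by (simp add: powr_mono2)
        next
          case False
          have "n \<le> 2 * p" using \<open>max p n \<le> 2 * min p n\<close> by linarith
          then have "1/2 \<le> real p / real n" using n by (simp add: field_simps)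
          then have "(real p / real n) powr r \<le> (1/2) powr r"
            using False by (intro powr_mono2') auto
          also have "\<dots> = 2 powr \<bar>r\<bar>" using False by (simp add: powr_divide powr_minus field_simps)
          finally show ?thesis .
        qed
        finally show ?thesis .
      qed
      have "cauchy_kernel a g r p n \<le> M powr g * 2 powr \<bar>r\<bar> / (M powr (a - 1) * D)"
        unfolding K using q g M D by (intro divide_right_mono mult_mono powr_mono2) auto
      also have "\<dots> = 2 powr \<bar>r\<bar> * (M powr g / M powr (a - 1)) / D" by simp
      also have "M powr g / M powr (a - 1) = M powr (- e)"
        by (simp add: e_def flip: powr_diff)
      also have "2 powr \<bar>r\<bar> * M powr (- e) / D \<le> 2 powr \<bar>r\<bar> * D powr (- e) / D"
        using M D e by (intro divide_right_mono mult_left_mono powr_mono2') auto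
      also have "\<dots> = k ((p - n) + (n - p))"
        using D pn by (simp add: k_def powr_diff powr_minus field_simps flip: D(3))
      finally show ?thesis by (simp add: u_def v_def add_increasing2)
    next
      case False
      then have D2: "M / 2 \<le> D" by (auto simp: M_def D_def)
      have "cauchy_kernel a g r p n
          \<le> real p powr g * (real p powr r / real n powr r) / (M powr (a - 1) * (M / 2))"
        unfolding K using D2 M D by (intro divide_left_mono mult_left_mono mult_pos_pos) auto
      also have "\<dots> = 2 * real p powr g * (real p powr r / real n powr r) * M powr (- a)"
        using M by (simp add: powr_diff powr_minus field_simps)
      also have "M powr (- a) = M powr (\<tau> - a) * M powr (- \<tau>)"
        by (simp add: powr_add[symmetric])
      also have "2 * real p powr g * (real p powr r / real n powr r) * (M powr (\<tau> - a) * M powr (- \<tau>))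
          \<le> 2 * real p powr g * (real p powr r / real n powr r)
              * (real p powr (\<tau> - a) * real n powr (- \<tau>))"
        using M p n \<tau> by (intro mult_left_mono mult_mono powr_mono2') auto
      also have "\<dots> = u p * v n"
        using p n by (simp add: u_def v_def powr_diff powr_add powr_minus field_simps)
      finally show ?thesis by (simp add: k_def add_increasing)
    qed
  qed
  have "l2_bounded (\<lambda>p n. k ((p - n) + (n - p)) + u p * v n)
      (2 * suminf k + sqrt (\<Sum>n. (u n)\<^sup>2) * sqrt (\<Sum>n. (v n)\<^sup>2))"
    by (intro l2_bounded_add l2_bounded_convolution l2_bounded_rank_one sk su sv)
      (auto simp: k_def u_def v_def)
  then show ?thesis
    by (intro exI) (erule l2_bounded_mono[OF _ _ le], simp add: cauchy_kernel_def)
qed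

section \<open>Cauchy matrices of gapped spectra\<close>

text \<open>This expands the rational function with poles \<open>lam n\<close> and zeros \<open>lam n - l\<close>. A new factor
  \<open>1 + l / (z - lam q)\<close> multiplies each old coefficient by its value at the old pole, and the
  coefficient of the new pole is \<open>l\<close> times the old product at \<open>lam q\<close>, to which the induction
  hypothesis applies.\<close>

lemma partial_fractions_prod:
  fixes lam :: "'i \<Rightarrow> 'a::field"
  assumes "finite F" "inj_on lam F" "\<And>n. n \<in> F \<Longrightarrow> z \<noteq> lam n"
  shows "(\<Prod>n\<in>F. 1 + l / (z - lam n))
       = 1 + (\<Sum>n\<in>F. l * (\<Prod>p\<in>F - {n}. 1 + l / (lam n - lam p)) / (z - lam n))"
  using assms
proof (induction F arbitrary: z rule: finite_induct)
  case (insert q F)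
  let ?c = "\<lambda>n. l * (\<Prod>p\<in>F - {n}. 1 + l / (lam n - lam p))"
  have inj: "inj_on lam F" and q: "\<And>n. n \<in> F \<Longrightarrow> lam q \<noteq> lam n"
    using insert.prems(1) insert.hyps by (auto simp: inj_on_def)
  have zq: "z \<noteq> lam q" and zn: "\<And>n. n \<in> F \<Longrightarrow> z \<noteq> lam n" using insert.prems(2) by auto
  have new: "(\<Prod>p\<in>insert q F - {n}. 1 + l / (lam n - lam p))
      = (1 + l / (lam n - lam q)) * (\<Prod>p\<in>F - {n}. 1 + l / (lam n - lam p))" if "n \<in> F" for n
  proof -
    have "insert q F - {n} = insert q (F - {n})" using that insert.hyps by auto
    then show ?thesis using insert.hyps by simp
  qed
  \<comment> \<open>splitting the products of simple poles at \<open>lam q\<close> and \<open>lam n\<close>\<close>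
  have split: "?c n / (z - lam n) * (1 + l / (z - lam q))
      = ?c n * (1 + l / (lam n - lam q)) / (z - lam n) + l * (?c n / (lam q - lam n)) / (z - lam q)"
    if "n \<in> F" for n
    using zq zn[OF that] q[OF that] by (simp add: divide_simps) (simp add: algebra_simps)
  have "(\<Prod>n\<in>insert q F. 1 + l / (z - lam n))
      = (1 + (\<Sum>n\<in>F. ?c n / (z - lam n))) * (1 + l / (z - lam q))"
    using insert.hyps insert.IH[OF inj zn] by (simp add: mult.commute)
  also have "\<dots> = 1 + l / (z - lam q) + (\<Sum>n\<in>F. ?c n / (z - lam n) * (1 + l / (z - lam q)))"
    by (simp add: distrib_right sum_distrib_right)
  also have "(\<Sum>n\<in>F. ?c n / (z - lam n) * (1 + l / (z - lam q)))
      = (\<Sum>n\<in>F. ?c n * (1 + l / (lam n - lam q)) / (z - lam n))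
        + l * (\<Sum>n\<in>F. ?c n / (lam q - lam n)) / (z - lam q)"
    unfolding sum_distrib_left sum_divide_distrib sum.distrib[symmetric] by (intro sum.cong refl split)
  also have "1 + l / (z - lam q) + \<dots> = 1 + l * (1 + (\<Sum>n\<in>F. ?c n / (lam q - lam n))) / (z - lam q)
      + (\<Sum>n\<in>F. ?c n * (1 + l / (lam n - lam q)) / (z - lam n))"
    by (simp add: distrib_left add_divide_distrib)
  also have "1 + (\<Sum>n\<in>F. ?c n / (lam q - lam n)) = (\<Prod>n\<in>F. 1 + l / (lam q - lam n))"
    using insert.IH[OF inj q] by simp
  also have "(\<Sum>n\<in>F. ?c n * (1 + l / (lam n - lam q)) / (z - lam n))
      = (\<Sum>n\<in>F. l * (\<Prod>p\<in>insert q F - {n}. 1 + l / (lam n - lam p)) / (z - lam n))"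
    by (rule sum.cong) (simp_all add: new mult_ac)
  finally show ?case using insert.hyps by (simp add: add.assoc)
qed simp

text \<open>This is minus the residue of \<open>\<Prod>p. 1 + l / (z - lam p)\<close> at \<open>lam n\<close>. The value \<open>0\<close> at the
  unused index lets sums over all natural numbers stand for sums over the eigenvalues.\<close>

definition cauchy_residue :: "(nat \<Rightarrow> complex) \<Rightarrow> complex \<Rightarrow> nat \<Rightarrow> complex" where
  "cauchy_residue lam l n =
     (if n = 0 then 0 else lim (\<lambda>N. - l * (\<Prod>p\<in>{1..N} - {n}. 1 + l / (lam n - lam p))))"

definition cauchy_mat :: "(nat \<Rightarrow> complex) \<Rightarrow> complex \<Rightarrow> (nat \<Rightarrow> complex) \<Rightarrow> nat \<Rightarrow> nat \<Rightarrow> complex" where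
  "cauchy_mat lam l b p n = b p * cauchy_residue lam l n / (b n * (lam p - l - lam n))"

text \<open>The parameter \<open>l\<close> is complex, although the damping is real and positive, because the inverse
  transformation belongs to the shift \<open>- l\<close>.\<close>

locale gapped_spectrum =
  fixes lam :: "nat \<Rightarrow> complex" and a c :: real and l :: complex
  assumes a: "a > 1" and c: "c > 0" and l: "l \<noteq> 0"
    and gap: "\<And>n p. n \<ge> 1 \<Longrightarrow> p \<ge> 1 \<Longrightarrow>
      c * real (max n p) powr (a - 1) * \<bar>real n - real p\<bar> \<le> cmod (lam n - lam p)"
    and nonresonant: "\<And>n p. n \<ge> 1 \<Longrightarrow> p \<ge> 1 \<Longrightarrow> lam p - lam n \<noteq> l"
begin

lemma shifted: "gapped_spectrum (\<lambda>n. lam n - l) a c (- l)"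
proof
  show "lam p - l - (lam n - l) \<noteq> - l" if "n \<ge> 1" "p \<ge> 1" for n p
    using nonresonant[OF that(2,1)] by (auto simp: algebra_simps)
qed (use a c l gap in auto)

lemma distinct: "n \<ge> 1 \<Longrightarrow> p \<ge> 1 \<Longrightarrow> n \<noteq> p \<Longrightarrow> lam n \<noteq> lam p"
proof
  assume *: "n \<ge> 1" "p \<ge> 1" "n \<noteq> p" "lam n = lam p"
  have "0 < c * real (max n p) powr (a - 1) * \<bar>real n - real p\<bar>"
    using c * by (auto simp: max_def)
  then show False using gap[OF *(1,2)] * by simp
qed

lemma shift_distinct: "n \<ge> 1 \<Longrightarrow> p \<ge> 1 \<Longrightarrow> lam p - l - lam n \<noteq> 0"
  using nonresonant[of n p] by (auto simp: algebra_simps)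

text \<open>Shifting one copy of the spectrum by \<open>l\<close> can spoil the gaps only for finitely many pairs of
  indices, since the gaps tend to infinity.\<close>

lemma shifted_gap:
  "\<exists>d>0. \<forall>n\<ge>1. \<forall>p\<ge>1. n \<noteq> p \<longrightarrow>
     d * (real (max n p) powr (a - 1) * \<bar>real n - real p\<bar>) \<le> cmod (lam p - l - lam n)"
proof -
  define w where "w = (\<lambda>z. real (max (fst z) (snd z)) powr (a - 1) * \<bar>real (fst z) - real (snd z)\<bar>)"
  define E where "E = {z::nat \<times> nat. fst z \<ge> 1 \<and> snd z \<ge> 1 \<and> fst z \<noteq> snd z \<and> c * w z < 2 * cmod l}"
  define q where "q = (2 * cmod l / c) powr (1 / (a - 1))"
  have wpos: "w z > 0" if "fst z \<ge> 1" "fst z \<noteq> snd z" for z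
    using that by (auto simp: w_def max_def)
  have "E \<subseteq> {..nat \<lceil>q\<rceil>} \<times> {..nat \<lceil>q\<rceil>}"
  proof
    fix z assume z: "z \<in> E"
    define M where "M = max (fst z) (snd z)"
    have M: "M \<ge> 1" using z by (auto simp: M_def E_def)
    have "1 \<le> \<bar>real (fst z) - real (snd z)\<bar>" using z by (auto simp: E_def)
    then have "real M powr (a - 1) \<le> w z"
      unfolding w_def M_def[symmetric] using mult_left_mono[of 1 _ "real M powr (a - 1)"] by simp
    also have "\<dots> \<le> 2 * cmod l / c" using z c by (simp add: E_def field_simps)
    finally have "(real M powr (a - 1)) powr (1 / (a - 1)) \<le> q"
      unfolding q_def using a by (intro powr_mono2) auto
    then have "real M \<le> q" using a M by (simp add: powr_powr)
    then have "M \<le> nat \<lceil>q\<rceil>" by linarith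
    then show "z \<in> {..nat \<lceil>q\<rceil>} \<times> {..nat \<lceil>q\<rceil>}" by (cases z) (auto simp: M_def)
  qed
  then have fin: "finite E" by (rule finite_subset) auto
  define S where "S = insert (c / 2) ((\<lambda>z. cmod (lam (snd z) - l - lam (fst z)) / w z) ` E)"
  have S: "finite S" "S \<noteq> {}" using fin by (auto simp: S_def)
  have "Min S \<in> S" by (rule Min_in[OF S])
  moreover have "x > 0" if "x \<in> S" for x
    using that c wpos shift_distinct by (auto simp: S_def E_def intro!: divide_pos_pos)
  ultimately have pos: "Min S > 0" by blast
  show ?thesis
  proof (intro exI[of _ "Min S"] conjI pos allI impI)
    fix n p :: nat assume np: "n \<ge> 1" "p \<ge> 1" "n \<noteq> p"
    have w: "w (n, p) > 0" using wpos[of "(n, p)"] np by simp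
    have "Min S * w (n, p) \<le> cmod (lam p - l - lam n)"
    proof (cases "(n, p) \<in> E")
      case True
      then have "Min S \<le> cmod (lam p - l - lam n) / w (n, p)"
        using S by (intro Min_le) (auto simp: S_def intro!: image_eqI[of _ _ "(n, p)"])
      then show ?thesis using w by (simp add: field_simps)
    next
      case False
      have "Min S \<le> c / 2" using S by (intro Min_le) (auto simp: S_def)
      then have "Min S * w (n, p) \<le> c / 2 * w (n, p)" using w by (intro mult_right_mono) auto
      moreover have "2 * cmod l \<le> c * w (n, p)" using False np by (simp add: E_def)
      moreover have "c * w (n, p) \<le> cmod (lam p - lam n)"
        using gap[OF np(2,1)] by (simp add: w_def max.commute abs_minus_commute mult.assoc)
      moreover have "cmod (lam p - lam n) \<le> cmod (lam p - l - lam n) + cmod l"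
        using norm_triangle_ineq[of "lam p - l - lam n" l] by (simp add: algebra_simps)
      ultimately show ?thesis by linarith
    qed
    then show "Min S * (real (max n p) powr (a - 1) * \<bar>real n - real p\<bar>) \<le> cmod (lam p - l - lam n)"
      by (simp add: w_def)
  qed
qed

text \<open>The distance of the indices is at most their maximum, so the reciprocals of the gaps are
  dominated by a summable convolution kernel.\<close>

definition recip :: "nat \<Rightarrow> real" where "recip j = real j powr (- a)"

lemma summable_recip: "summable recip" and recip_nonneg: "recip j \<ge> 0"
  unfolding recip_def using a by (simp_all add: summable_real_powr_iff)

lemma recip_gap:
  assumes "n \<ge> 1" "n \<noteq> p"
    and "0 < d" "d * (real (max n p) powr (a - 1) * \<bar>real n - real p\<bar>) \<le> w"
  shows "1 / w \<le> recip ((p - n) + (n - p)) / d"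
proof -
  define D where "D = \<bar>real n - real p\<bar>"
  have D: "D \<ge> 1" "D \<le> real (max n p)" "D = real ((p - n) + (n - p))"
    using assms(1,2) by (auto simp: D_def)
  have "D powr a = D powr (a - 1) * D" using D(1) by (simp add: powr_diff)
  also have "\<dots> \<le> real (max n p) powr (a - 1) * D"
    using D a by (intro mult_right_mono powr_mono2) auto
  finally have "d * D powr a \<le> w"
    using assms(3,4) mult_left_mono[of "D powr a" "real (max n p) powr (a - 1) * D" d]
    unfolding D_def by linarith
  moreover have "d * D powr a > 0" using assms(3) D by simp
  ultimately have "1 / w \<le> 1 / (d * D powr a)" by (intro divide_left_mono) auto
  also have "\<dots> = recip ((p - n) + (n - p)) / d"
    unfolding recip_def D(3)[symmetric] by (simp add: powr_minus field_simps)
  finally show ?thesis .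
qed

definition partial_residue :: "nat \<Rightarrow> nat \<Rightarrow> complex" where
  "partial_residue N n = - l * (\<Prod>p\<in>{1..N} - {n}. 1 + l / (lam n - lam p))"

lemma recip_difference:
  assumes "n \<ge> 1" "p \<ge> 1" "p \<noteq> n"
  shows "cmod (l / (lam n - lam p)) \<le> cmod l / c * recip ((n - p) + (p - n))"
  using mult_left_mono[OF recip_gap[of p n c "cmod (lam n - lam p)"], of "cmod l"] assms gap c
  by (simp add: norm_divide max.commute abs_minus_commute mult.assoc)

text \<open>The product of \<open>1 + cmod (l / (lam n - lam p))\<close> over \<open>p\<close> is at most the exponential of the sum
  of \<open>cmod (l / (lam n - lam p))\<close>, which has a bound independent of \<open>n\<close>.\<close>

definition residue_bound :: real where
  "residue_bound = cmod l * exp (cmod l / c * (2 * suminf recip))"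

lemma residue_bound_pos: "residue_bound > 0" using l by (simp add: residue_bound_def)

lemma partial_residue_bound:
  assumes n: "n \<ge> 1"
  shows "cmod (partial_residue N n) \<le> residue_bound"
proof -
  have "cmod (\<Prod>p\<in>{1..N} - {n}. 1 + l / (lam n - lam p))
      \<le> (\<Prod>p\<in>{1..N} - {n}. 1 + cmod (l / (lam n - lam p)))"
    unfolding prod_norm[symmetric]
    by (intro prod_mono conjI norm_ge_zero order_trans[OF norm_triangle_ineq]) auto
  also have "\<dots> \<le> exp (\<Sum>p\<in>{1..N} - {n}. cmod (l / (lam n - lam p)))"
    by (rule prod_le_exp_sum) simp
  also have "\<dots> \<le> exp (cmod l / c * (2 * suminf recip))"
  proof -
    have "(\<Sum>p\<in>{1..N} - {n}. cmod (l / (lam n - lam p)))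
        \<le> (\<Sum>p\<in>{1..N} - {n}. cmod l / c * recip ((n - p) + (p - n)))"
      by (intro sum_mono recip_difference n) auto
    also have "\<dots> \<le> (\<Sum>p<Suc N. cmod l / c * recip ((n - p) + (p - n)))"
      using c recip_nonneg by (intro sum_mono2) (auto intro!: mult_nonneg_nonneg)
    also have "\<dots> = cmod l / c * (\<Sum>p<Suc N. recip ((n - p) + (p - n)))"
      by (rule sum_distrib_left[symmetric])
    also have "\<dots> \<le> cmod l / c * (2 * suminf recip)"
      using c by (intro mult_left_mono sum_convolution_le recip_nonneg summable_recip) auto
    finally show ?thesis by simp
  qed
  finally show ?thesis by (simp add: partial_residue_def residue_bound_def norm_mult mult_left_mono)
qed

lemma partial_residue_tendsto:
  assumes n: "n \<ge> 1"
  shows "(\<lambda>N. partial_residue N n) \<longlonglongrightarrow> cauchy_residue lam l n"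
proof -
  define f where "f p = (if p = 0 \<or> p = n then 1 else 1 + l / (lam n - lam p))" for p
  have "summable (\<lambda>p. norm (f p - 1))"
  proof (rule summableI_nonneg_bounded[where x = "cmod l / c * (2 * suminf recip)"])
    fix N
    have "(\<Sum>p<N. norm (f p - 1)) \<le> (\<Sum>p<N. cmod l / c * recip ((n - p) + (p - n)))"
      using c recip_nonneg recip_difference[OF n]
      by (intro sum_mono) (auto simp: f_def intro!: mult_nonneg_nonneg divide_nonneg_pos)
    also have "\<dots> = cmod l / c * (\<Sum>p<N. recip ((n - p) + (p - n)))"
      by (rule sum_distrib_left[symmetric])
    also have "\<dots> \<le> cmod l / c * (2 * suminf recip)"
      using c by (intro mult_left_mono sum_convolution_le recip_nonneg summable_recip) auto
    finally show "(\<Sum>p<N. norm (f p - 1)) \<le> cmod l / c * (2 * suminf recip)" .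
  qed simp
  then have "abs_convergent_prod f" by (rule summable_imp_abs_convergent_prod)
  then have "convergent_prod f" by (rule abs_convergent_prod_imp_convergent_prod)
  then have "convergent (\<lambda>N. - l * (\<Prod>p\<le>N. f p))"
    by (intro convergent_mult convergent_const convergent_prod_imp_convergent)
  moreover have "(\<Prod>p\<le>N. f p) = (\<Prod>p\<in>{1..N} - {n}. 1 + l / (lam n - lam p))" for N
    by (rule prod.mono_neutral_cong_right) (auto simp: f_def)
  ultimately have "convergent (\<lambda>N. partial_residue N n)"
    by (simp add: partial_residue_def)
  then show ?thesis
    using n by (simp add: convergent_LIMSEQ_iff cauchy_residue_def partial_residue_def)
qed

lemma residue_le: "cmod (cauchy_residue lam l n) \<le> residue_bound"
proof (cases "n = 0")
  case False
  then have n: "n \<ge> 1" by simp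
  show ?thesis
    by (rule LIMSEQ_le_const2[OF tendsto_norm[OF partial_residue_tendsto[OF n]]])
      (use partial_residue_bound[OF n] in blast)
qed (use residue_bound_pos in \<open>simp add: cauchy_residue_def\<close>)

text \<open>The meromorphic function \<open>1 - \<Sum>n. cauchy_residue lam l n / (z - lam n)\<close> vanishes at the points
  \<open>lam p - l\<close>, being the limit of the rational functions in \<open>partial_fractions_prod\<close>, which vanish there as soon as
  \<open>p\<close> is among their indices.\<close>

theorem cauchy_residue_sums:
  assumes p: "p \<ge> 1"
  shows "(\<lambda>n. cauchy_residue lam l n / (lam p - l - lam n)) sums 1"
proof -
  let ?w = "\<lambda>n. lam p - l - lam n"
  let ?t = "\<lambda>n N. if n \<in> {1..N} then partial_residue N n / ?w n else 0"
  have sw: "summable (\<lambda>n. residue_bound * (1 / cmod (?w n)))"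
  proof (intro summable_mult)
    obtain d where d: "d > 0" and dgap: "\<And>n p. n \<ge> 1 \<Longrightarrow> p \<ge> 1 \<Longrightarrow> n \<noteq> p \<Longrightarrow>
      d * (real (max n p) powr (a - 1) * \<bar>real n - real p\<bar>) \<le> cmod (lam p - l - lam n)"
      using shifted_gap by blast
    have "summable (\<lambda>n. recip ((p - n) + (n - p)) / d)"
      by (intro summable_divide summableI_nonneg_bounded[where x = "2 * suminf recip"]
          sum_convolution_le recip_nonneg summable_recip)
    then show "summable (\<lambda>n. 1 / cmod (?w n))"
    proof (rule summable_comparison_test_ev[rotated])
      show "\<forall>\<^sub>F n in sequentially. norm (1 / cmod (?w n)) \<le> recip ((p - n) + (n - p)) / d"
        using eventually_gt_at_top[of p]
      proof eventually_elim
        case (elim n)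
        then show ?case using recip_gap[of n p d "cmod (?w n)"] dgap[of n p] p d by simp
      qed
    qed
  qed
  have "(\<forall>\<^sub>F N in sequentially. summable (\<lambda>n. norm (?t n N))) \<and>
    summable (\<lambda>n. norm (cauchy_residue lam l n / ?w n)) \<and>
    (\<lambda>N. suminf (\<lambda>n. ?t n N)) \<longlonglongrightarrow> (\<Sum>n. cauchy_residue lam l n / ?w n)"
  proof (rule tannerys_theorem[OF _ _ sw])
    show "(\<lambda>N. ?t n N) \<longlonglongrightarrow> cauchy_residue lam l n / ?w n" for n
    proof (cases "n = 0")
      case False
      then have "(\<lambda>N. partial_residue N n / ?w n) \<longlonglongrightarrow> cauchy_residue lam l n / ?w n"
        using shift_distinct[of n p] p by (intro tendsto_intros partial_residue_tendsto) auto
      moreover have "\<forall>\<^sub>F N in sequentially. partial_residue N n / ?w n = ?t n N"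
        using False by (intro eventually_mono[OF eventually_ge_at_top[of n]]) auto
      ultimately show ?thesis by (rule Lim_transform_eventually)
    qed (simp add: cauchy_residue_def)
    show "\<forall>\<^sub>F (n, N) in sequentially \<times>\<^sub>F sequentially. norm (?t n N) \<le> residue_bound * (1 / cmod (?w n))"
      using residue_bound_pos
      by (intro always_eventually) (auto simp: norm_divide intro!: divide_right_mono partial_residue_bound)
  qed simp
  then have lim: "(\<lambda>N. suminf (\<lambda>n. ?t n N)) \<longlonglongrightarrow> (\<Sum>n. cauchy_residue lam l n / ?w n)"
    and sm: "summable (\<lambda>n. norm (cauchy_residue lam l n / ?w n))" by auto
  have "suminf (\<lambda>n. ?t n N) = 1" if N: "N \<ge> p" for N
  proof -
    have "suminf (\<lambda>n. ?t n N) = (\<Sum>n\<in>{1..N}. ?t n N)" by (rule suminf_finite) auto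
    also have "\<dots> = - (\<Sum>n\<in>{1..N}. l * (\<Prod>p\<in>{1..N} - {n}. 1 + l / (lam n - lam p)) / ?w n)"
      by (simp add: partial_residue_def sum_negf)
    also have "\<dots> = 1 - (\<Prod>n\<in>{1..N}. 1 + l / (lam p - l - lam n))"
    proof -
      have "inj_on lam {1..N}" using distinct by (intro inj_onI) force
      moreover have "lam p - l \<noteq> lam n" if "n \<in> {1..N}" for n
        using shift_distinct[of n p] that p by auto
      ultimately show ?thesis by (subst partial_fractions_prod) auto
    qed
    also have "(\<Prod>n\<in>{1..N}. 1 + l / (lam p - l - lam n)) = 0"
      using p N l by (intro prod_zero bexI[of _ p]) auto
    finally show ?thesis by simp
  qed
  then have "(\<lambda>N. suminf (\<lambda>n. ?t n N)) \<longlonglongrightarrow> 1"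
    by (intro tendsto_eventually eventually_mono[OF eventually_ge_at_top[of p]])
  then have "(\<Sum>n. cauchy_residue lam l n / ?w n) = 1" using lim LIMSEQ_unique by blast
  then show "(\<lambda>n. cauchy_residue lam l n / ?w n) sums 1"
    using summable_sums[OF summable_norm_cancel[OF sm]] by simp
qed

end

section \<open>The transformation of one block and its inverse\<close>

text \<open>If the formal product of two bounded matrices is diagonal, then so is their composition. The
  double series may be rearranged because the matrix of absolute values of \<open>T\<close> has the same majorant,
  so that it maps the absolute values of \<open>f\<close> to a sequence on which the rows of \<open>S\<close> converge
  absolutely.\<close>

lemma l2_bounded_mat_apply_diag:
  assumes S: "l2_bounded k C" "\<forall>p\<ge>1. \<forall>n\<ge>1. real p powr r * cmod (S p n) \<le> k p n * real n powr r"
    and T: "l2_bounded k' C'" "\<forall>p\<ge>1. \<forall>n\<ge>1. real p powr r * cmod (T p n) \<le> k' p n * real n powr r"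
    and f: "f \<in> Hs r" and m: "m \<ge> 1" and S0: "S m 0 = 0"
    and off: "\<And>n. n \<ge> 1 \<Longrightarrow> n \<noteq> m \<Longrightarrow> (\<Sum>p. S m p * T p n) = 0"
  shows "mat_apply S (mat_apply T f) m = (\<Sum>p. S m p * T p m) * f m"
proof -
  have f0: "f 0 = 0" using f by (simp add: Hs_def)
  define T' where "T' p n = complex_of_real (cmod (T p n))" for p n
  define f' where "f' n = complex_of_real (cmod (f n))" for n
  have f': "f' \<in> Hs r" using f by (simp add: Hs_def f'_def)
  note A = mat_apply_Hs[OF T(1) f T(2)]
  have "mat_apply T' f' \<in> Hs r"
    using T(2) by (intro mat_apply_Hs(2)[OF T(1) f']) (auto simp: T'_def)
  from mat_apply_Hs(1)[OF S(1) this S(2) m]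
  have dom: "summable (\<lambda>p. norm (S m p * mat_apply T' f' p))" .
  have g: "norm (mat_apply T' f' p) = (\<Sum>n. norm (T p n * f n))" if "p \<ge> 1" for p
  proof -
    have "(\<Sum>n. complex_of_real (norm (T p n * f n))) = of_real (\<Sum>n. norm (T p n * f n))"
      by (rule suminf_of_real[symmetric]) (rule A(1)[OF that])
    then have "mat_apply T' f' p = of_real (\<Sum>n. norm (T p n * f n))"
      using that by (simp add: mat_apply_def T'_def f'_def norm_mult)
    then show ?thesis by (simp add: suminf_nonneg[OF A(1)[OF that]])
  qed
  have le: "norm (S m p * (\<Sum>n\<in>F. T p n * f n)) \<le> norm (S m p * mat_apply T' f' p)" if "finite F" for p F
  proof (cases "p = 0")
    case False
    then have p: "p \<ge> 1" by simp
    have "norm (\<Sum>n\<in>F. T p n * f n) \<le> (\<Sum>n\<in>F. norm (T p n * f n))" by (rule norm_sum)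
    also have "\<dots> \<le> norm (mat_apply T' f' p)"
      unfolding g[OF p] by (intro sum_le_suminf A(1) p that) auto
    finally show ?thesis by (simp add: norm_mult mult_left_mono)
  qed (simp add: S0)
  have "(\<lambda>N. \<Sum>p. S m p * (\<Sum>n<N. T p n * f n)) \<longlonglongrightarrow> (\<Sum>p. S m p * mat_apply T f p)"
  proof (rule tannerys_theorem[THEN conjunct2, THEN conjunct2, OF _ _ dom])
    show "(\<lambda>N. S m p * (\<Sum>n<N. T p n * f n)) \<longlonglongrightarrow> S m p * mat_apply T f p" for p
    proof (cases "p = 0")
      case False
      then have "summable (\<lambda>n. T p n * f n)" by (intro summable_norm_cancel[OF A(1)]) simp
      from tendsto_mult[OF tendsto_const summable_LIMSEQ[OF this], of "S m p"] False
      show ?thesis by (simp add: mat_apply_def)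
    qed (simp add: S0)
  qed (use le in \<open>auto intro!: always_eventually\<close>)
  moreover have "(\<Sum>p. S m p * (\<Sum>n<N. T p n * f n)) = (\<Sum>p. S m p * T p m) * f m" if "N > m" for N
  proof -
    have sm: "summable (\<lambda>p. S m p * T p n * f n)" for n
      using le[of "{n}"] by (intro summable_comparison_test'[OF dom, of 0]) (simp add: mult.assoc)
    have "(\<Sum>p. S m p * (\<Sum>n<N. T p n * f n)) = (\<Sum>n<N. \<Sum>p. S m p * T p n * f n)"
      by (subst suminf_sum[symmetric, OF sm]) (auto simp: sum_distrib_left mult.assoc)
    also have "\<dots> = (\<Sum>n<N. if n = m then (\<Sum>p. S m p * T p m) * f m else 0)"
    proof (rule sum.cong)
      fix n
      show "(\<Sum>p. S m p * T p n * f n) = (if n = m then (\<Sum>p. S m p * T p m) * f m else 0)"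
      proof (cases "f n = 0")
        case False
        then have "n \<ge> 1" using f0 by (cases n) auto
        moreover have "summable (\<lambda>p. S m p * T p n)"
          using summable_divide[OF sm[of n], of "f n"] False by simp
        ultimately show ?thesis using off[of n] by (auto simp: suminf_mult2[symmetric])
      qed auto
    qed simp
    also have "\<dots> = (\<Sum>p. S m p * T p m) * f m" using that by simp
    finally show ?thesis .
  qed
  then have "(\<lambda>N. \<Sum>p. S m p * (\<Sum>n<N. T p n * f n)) \<longlonglongrightarrow> (\<Sum>p. S m p * T p m) * f m"
    by (intro tendsto_eventually eventually_mono[OF eventually_gt_at_top[of m]])
  ultimately have "(\<Sum>p. S m p * mat_apply T f p) = (\<Sum>p. S m p * T p m) * f m"
    using LIMSEQ_unique by blast
  then show ?thesis using m by (simp add: mat_apply_def[of S])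
qed

locale controlled_block = gapped_spectrum +
  fixes b :: "nat \<Rightarrow> complex" and g c1 c2 :: real
  assumes g: "0 \<le> g" "g < a - 1" and c1: "c1 > 0" and c2: "c2 > 0"
    and b0: "b 0 = 0"
    and b: "\<And>n. n \<ge> 1 \<Longrightarrow> c1 \<le> cmod (b n)" "\<And>n. n \<ge> 1 \<Longrightarrow> cmod (b n) \<le> c2 * real n powr g"
begin

lemma shifted_block: "controlled_block (\<lambda>n. lam n - l) a c (- l) b g c1 c2"
proof -
  interpret s: gapped_spectrum "\<lambda>n. lam n - l" a c "- l" by (rule shifted)
  show ?thesis by unfold_locales (use g c1 c2 b0 b in auto)
qed

lemma b_nz: "n \<ge> 1 \<Longrightarrow> b n \<noteq> 0"
  using b(1)[of n] c1 by auto

text \<open>On the diagonal the two values of \<open>b\<close> cancel; elsewhere one of them costs the factor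
  \<open>real p powr g\<close> and the other one a constant. The constant \<open>e\<close> serves all weights \<open>r\<close>.\<close>

lemma cauchy_mat_bounded:
  "\<exists>e\<ge>0. \<forall>r p n. p \<ge> 1 \<longrightarrow> n \<ge> 1 \<longrightarrow>
     real p powr r * cmod (cauchy_mat lam l b p n) \<le> e * cauchy_kernel a g r p n * real n powr r"
proof -
  obtain d where d: "d > 0" and dgap: "\<And>n p. n \<ge> 1 \<Longrightarrow> p \<ge> 1 \<Longrightarrow> n \<noteq> p \<Longrightarrow>
      d * (real (max n p) powr (a - 1) * \<bar>real n - real p\<bar>) \<le> cmod (lam p - l - lam n)"
    using shifted_gap by blast
  define e where "e = residue_bound / cmod l + c2 * residue_bound / (c1 * d)"
  have e1: "residue_bound / cmod l \<le> e" and e2: "c2 * residue_bound / (c1 * d) \<le> e" and e0: "e \<ge> 0"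
    using residue_bound_pos c1 c2 d by (auto simp: e_def)
  have "real p powr r * cmod (cauchy_mat lam l b p n) \<le> e * cauchy_kernel a g r p n * real n powr r"
    if p: "p \<ge> 1" and n: "n \<ge> 1" for r p n
  proof (cases "p = n")
    case True
    have "cmod (cauchy_mat lam l b p n) = cmod (cauchy_residue lam l n) / cmod l"
      using True b_nz[OF n] by (simp add: cauchy_mat_def norm_mult norm_divide)
    also have "\<dots> \<le> residue_bound / cmod l" by (intro divide_right_mono residue_le) simp
    also have "\<dots> \<le> e" by (rule e1)
    finally have "cmod (cauchy_mat lam l b p n) \<le> e" .
    then show ?thesis using True n by (simp add: cauchy_kernel_def mult.commute mult_left_mono)
  next
    case False
    define W where "W = real (max p n) powr (a - 1) * \<bar>real p - real n\<bar>"
    have W: "W > 0" using p n False by (auto simp: W_def max_def)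
    have "d * W \<le> cmod (lam p - l - lam n)"
      using dgap[OF n p] False by (simp add: W_def max.commute abs_minus_commute)
    moreover have "cmod (cauchy_mat lam l b p n)
        = cmod (b p) * cmod (cauchy_residue lam l n) / (cmod (b n) * cmod (lam p - l - lam n))"
      by (simp add: cauchy_mat_def norm_mult norm_divide)
    moreover have "\<dots> \<le> (c2 * real p powr g) * residue_bound / (c1 * (d * W))"
      using calculation(1) W d c1 c2 residue_bound_pos
      by (intro frac_le mult_mono b p n residue_le mult_nonneg_nonneg mult_pos_pos) auto
    moreover have "\<dots> = c2 * residue_bound / (c1 * d) * (real p powr g / W)" by (simp add: mult_ac)
    moreover have "\<dots> \<le> e * (real p powr g / W)" using W by (intro mult_right_mono e2) auto
    ultimately have "cmod (cauchy_mat lam l b p n) \<le> e * (real p powr g / W)" by (simp add: mult_ac)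
    then have "real p powr r * cmod (cauchy_mat lam l b p n) \<le> real p powr r * (e * (real p powr g / W))"
      by (rule mult_left_mono) simp
    also have "\<dots> = e * cauchy_kernel a g r p n * real n powr r"
      using False p n by (simp add: cauchy_kernel_def W_def)
    finally show ?thesis .
  qed
  then show ?thesis using e0 by blast
qed

lemma cauchy_mat_kernel:
  assumes "1/2 - a < r" "r < a - 1/2 - g"
  obtains k C where "l2_bounded k C"
    and "\<forall>p\<ge>1. \<forall>n\<ge>1. real p powr r * cmod (cauchy_mat lam l b p n) \<le> k p n * real n powr r"
proof -
  obtain e where "e \<ge> 0" and e: "\<forall>p\<ge>1. \<forall>n\<ge>1.
     real p powr r * cmod (cauchy_mat lam l b p n) \<le> e * cauchy_kernel a g r p n * real n powr r"
    using cauchy_mat_bounded by blast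
  obtain C where "l2_bounded (cauchy_kernel a g r) C"
    using cauchy_kernel_bounded[OF g assms] by blast
  from l2_bounded_scale[OF this \<open>e \<ge> 0\<close>] e show thesis by (rule that)
qed

lemma cauchy_mat_b:
  assumes "p \<ge> 1"
  shows "(\<Sum>n. cauchy_mat lam l b p n * b n) = b p"
proof -
  have *: "cauchy_mat lam l b p n * b n = b p * (cauchy_residue lam l n / (lam p - l - lam n))" for n
    using b_nz[of n] by (cases "n = 0") (auto simp: cauchy_mat_def b0 cauchy_residue_def)
  show "(\<Sum>n. cauchy_mat lam l b p n * b n) = b p"
    unfolding * using sums_mult[OF cauchy_residue_sums[OF assms], of "b p"] by (simp add: sums_iff)
qed

lemma mat_apply_cauchy_mat_b: "mat_apply (cauchy_mat lam l b) b = b"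
  by (auto simp: mat_apply_def cauchy_mat_b b0)

text \<open>Off the diagonal the product of the two matrices vanishes by splitting the product of two
  simple poles and applying \<open>cauchy_residue_sums\<close> to the shifted spectrum. The product is therefore
  diagonal; since both matrices fix \<open>b\<close>, all of whose coefficients are nonzero, it is the
  identity.\<close>

lemma cauchy_mat_inverse:
  assumes r: "1/2 - a < r" "r < a - 1/2 - g" and f: "f \<in> Hs r" and s: "1/2 - a < s" "s < a - 1/2 - g" "b \<in> Hs s"
  shows "mat_apply (cauchy_mat (\<lambda>n. lam n - l) (- l) b) (mat_apply (cauchy_mat lam l b) f) = f"
proof (rule ext)
  fix m :: nat
  interpret s: controlled_block "\<lambda>n. lam n - l" a c "- l" b g c1 c2 by (rule shifted_block)
  define S T where "S = cauchy_mat (\<lambda>n. lam n - l) (- l) b" and "T = cauchy_mat lam l b"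
  let ?y = "cauchy_residue (\<lambda>n. lam n - l) (- l)" and ?x = "cauchy_residue lam l"
  \<comment> \<open>both series of simple poles have sum \<open>1\<close>, so their difference vanishes\<close>
  have off: "(\<Sum>p. S m p * T p n) = 0" if m: "m \<ge> 1" and n: "n \<ge> 1" "n \<noteq> m" for n
  proof -
    have sums: "(\<lambda>p. ?y p / (lam k - (lam p - l))) sums 1" if "k \<ge> 1" for k
      using s.cauchy_residue_sums[OF that] by (simp add: algebra_simps)
    have "S m p * T p n = b m * ?x n / (b n * (lam n - lam m))
        * (?y p / (lam n - (lam p - l)) - ?y p / (lam m - (lam p - l)))" (is "?lhs = ?K * ?rhs") for p
    proof (cases "p = 0")
      case False
      define u v where "u = lam n - (lam p - l)" and "v = lam m - (lam p - l)"
      define w where "w = u - v"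
      have nz: "b p \<noteq> 0" "u \<noteq> 0" "v \<noteq> 0" "u - v \<noteq> 0"
        using False b_nz[of p] s.shift_distinct[of p n] s.shift_distinct[of p m] m n distinct[of n m]
        by (auto simp: u_def v_def algebra_simps)
      have "?lhs = (b m * ?y p / (b p * v)) * (b p * ?x n / (b n * (- u)))"
        by (simp add: S_def T_def cauchy_mat_def u_def v_def algebra_simps)
      also have "\<dots> = - (b m * ?x n / b n) * (?y p * (1 / (u * v)))" using nz by (simp add: mult_ac)
      also have "1 / (u * v) = - ((1 / u - 1 / v) / w)"
        using nz unfolding w_def by (simp add: divide_simps)
      also have "- (b m * ?x n / b n) * (?y p * (- ((1 / u - 1 / v) / w)))
          = b m * ?x n / (b n * w) * (?y p / u - ?y p / v)"
        by (simp add: diff_divide_distrib right_diff_distrib mult_ac)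
      finally show ?thesis by (simp add: u_def v_def w_def)
    qed (simp add: S_def cauchy_mat_def cauchy_residue_def)
    moreover have "(\<lambda>p. ?K * (?y p / (lam n - (lam p - l)) - ?y p / (lam m - (lam p - l)))) sums (?K * (1 - 1))"
      by (intro sums_mult sums_diff sums m n)
    ultimately show ?thesis by (simp add: sums_iff)
  qed
  have *: "mat_apply S (mat_apply T h) m = (\<Sum>p. S m p * T p m) * h m"
    if m: "m \<ge> 1" and r: "1/2 - a < r" "r < a - 1/2 - g" and h: "h \<in> Hs r" for h r
  proof -
    obtain k C where k: "l2_bounded k C"
      "\<forall>p\<ge>1. \<forall>n\<ge>1. real p powr r * cmod (S p n) \<le> k p n * real n powr r"
      using s.cauchy_mat_kernel[OF r] unfolding S_def by blast
    obtain k' C' where k': "l2_bounded k' C'"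
      "\<forall>p\<ge>1. \<forall>n\<ge>1. real p powr r * cmod (T p n) \<le> k' p n * real n powr r"
      using cauchy_mat_kernel[OF r] unfolding T_def by blast
    show ?thesis
      by (rule l2_bounded_mat_apply_diag[OF k k' h m _ off[OF m]])
        (simp_all add: S_def cauchy_mat_def cauchy_residue_def)
  qed
  have "mat_apply S (mat_apply T f) m = f m"
  proof (cases "m = 0")
    case True
    then show ?thesis using f by (simp add: mat_apply_def Hs_def)
  next
    case False
    then have m: "m \<ge> 1" by simp
    have "(\<Sum>p. S m p * T p m) * b m = b m"
      using *[OF m s] mat_apply_cauchy_mat_b s.mat_apply_cauchy_mat_b by (simp add: S_def T_def)
    then have "(\<Sum>p. S m p * T p m) = 1" using b_nz[OF m] by simp
    then show ?thesis using *[OF m r f] by simp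
  qed
  then show "mat_apply (cauchy_mat (\<lambda>n. lam n - l) (- l) b) (mat_apply (cauchy_mat lam l b) f) m = f m"
    by (simp add: S_def T_def)
qed

end

section \<open>Construction of the feedback and the transformation\<close>

lemma diagonal_HH:
  assumes lam: "\<forall>i. \<forall>n\<ge>1. cmod (lam i n) \<le> C * real n powr \<alpha> i" and "C \<ge> 0"
    and f: "f \<in> HH s" and t: "\<And>i. t i \<le> s i - \<alpha> i"
  shows "diagonal lam f \<in> HH t" and "HH_norm t (diagonal lam f) \<le> C * HH_norm s f"
proof -
  have *: "\<forall>i. \<forall>n\<ge>1. wt (t i) (diagonal lam f i) n \<le> C * wt (s i) (f i) n"
  proof (intro allI impI)
    fix i n assume n: "n \<ge> (1::nat)"
    have "wt (t i) (diagonal lam f i) n \<le> real n powr t i * (C * real n powr \<alpha> i * cmod (f i n))"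
      unfolding diagonal_def norm_mult using lam n by (intro mult_left_mono mult_right_mono) auto
    also have "\<dots> = C * (real n powr (t i + \<alpha> i) * cmod (f i n))" by (simp add: powr_add)
    also have "\<dots> \<le> C * wt (s i) (f i) n"
      using n t[of i] \<open>C \<ge> 0\<close> by (intro mult_left_mono mult_right_mono powr_mono) (auto simp: algebra_simps)
    finally show "wt (t i) (diagonal lam f i) n \<le> C * wt (s i) (f i) n" .
  qed
  have 0: "\<forall>i. diagonal lam f i 0 = 0" using HH_0[OF f] by (simp add: diagonal_def)
  show "diagonal lam f \<in> HH t" "HH_norm t (diagonal lam f) \<le> C * HH_norm s f"
    using HH_dominated[OF f \<open>C \<ge> 0\<close> 0 *] .
qed

lemma control_HH:
  assumes B: "B \<in> HH t"
  shows "control B y \<in> HH t" and "HH_norm t (control B y) \<le> norm y * HH_norm t B"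
proof -
  have *: "\<forall>i. \<forall>n\<ge>1. wt (t i) (control B y i) n \<le> norm y * wt (t i) (B i) n"
  proof (intro allI impI)
    fix i n
    have "cmod (y $ i) * wt (t i) (B i) n \<le> norm y * wt (t i) (B i) n"
      by (intro mult_right_mono Finite_Cartesian_Product.norm_nth_le) auto
    then show "wt (t i) (control B y i) n \<le> norm y * wt (t i) (B i) n"
      by (simp add: control_def norm_mult mult_ac)
  qed
  have 0: "\<forall>i. control B y i 0 = 0" using HH_0[OF B] by (simp add: control_def)
  show "control B y \<in> HH t" "HH_norm t (control B y) \<le> norm y * HH_norm t B"
    using HH_dominated[OF B norm_ge_zero 0 *] .
qed

lemma isomorphismI:
  assumes F: "bounded_op (HH r) (HH_norm r) (HH r) (HH_norm r) F"
    and G: "bounded_op (HH r) (HH_norm r) (HH r) (HH_norm r) G"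
    and GF: "\<And>f. f \<in> HH r \<Longrightarrow> G (F f) = f" and FG: "\<And>f. f \<in> HH r \<Longrightarrow> F (G f) = f"
  shows "isomorphism (HH r) (HH_norm r) (HH r) (HH_norm r) F"
proof -
  have FV: "F f \<in> HH r" and GV: "G f \<in> HH r" if "f \<in> HH r" for f
    using F G that by (auto simp: bounded_op_def)
  have bij: "bij_betw F (HH r) (HH r)"
    by (rule bij_betw_byWitness[where f' = G]) (use GF FG FV GV in auto)
  have inv: "inv_into (HH r) F f = G f" if "f \<in> HH r" for f
    using inv_into_f_f[OF bij_betw_imp_inj_on[OF bij] GV[OF that]] FG[OF that] by simp
  have "bounded_op (HH r) (HH_norm r) (HH r) (HH_norm r) (inv_into (HH r) F)"
    using G HH_add(1)[of _ r] HH_scale(1)[of _ r]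
    unfolding bounded_op_def clinear_on_def by (auto simp: inv image_subset_iff)
  then show ?thesis using F bij by (simp add: isomorphism_def)
qed

definition blockwise :: "('m \<Rightarrow> nat \<Rightarrow> nat \<Rightarrow> complex) \<Rightarrow> ('m \<Rightarrow> nat \<Rightarrow> complex) \<Rightarrow> 'm \<Rightarrow> nat \<Rightarrow> complex" where
  "blockwise M f = (\<lambda>i. mat_apply (M i) (f i))"

lemma blockwise_bounded_op:
  fixes M :: "'m::finite \<Rightarrow> nat \<Rightarrow> nat \<Rightarrow> complex"
  assumes k: "\<And>i. l2_bounded (k i) (C i)"
    "\<And>i. \<forall>p\<ge>1. \<forall>n\<ge>1. real p powr r i * cmod (M i p n) \<le> k i p n * real n powr r i"
  shows "bounded_op (HH r) (HH_norm r) (HH r) (HH_norm r) (blockwise M)"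
proof -
  note A = mat_apply_Hs[OF k(1) HH_D[of _ r] k(2)]
  have sm: "summable (\<lambda>n. M i p n * f i n)" if "f \<in> HH r" "p \<noteq> 0" for f i p
    by (rule summable_norm_cancel[OF A(1)[OF that(1)]]) (use that in simp)
  have C: "C i \<ge> 0" for i using k(1) by (simp add: l2_bounded_def)
  have V: "blockwise M f \<in> HH r" if "f \<in> HH r" for f
    using A(2)[OF that] by (simp add: HH_def blockwise_def)
  have "HH_norm r (blockwise M f) \<le> (\<Sum>i\<in>UNIV. C i) * HH_norm r f" if f: "f \<in> HH r" for f
  proof -
    have "HH_norm r (blockwise M f) \<le> L2_set (\<lambda>i. (\<Sum>i\<in>UNIV. C i) * Hs_norm (r i) (f i)) UNIV"
      unfolding HH_norm_L2
    proof (rule L2_set_mono)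
      fix i
      have "Hs_norm (r i) (blockwise M f i) \<le> C i * Hs_norm (r i) (f i)"
        using A(3)[OF f] by (simp add: blockwise_def)
      also have "\<dots> \<le> (\<Sum>i\<in>UNIV. C i) * Hs_norm (r i) (f i)"
        by (intro mult_right_mono member_le_sum C Hs_norm_nonneg HH_D[OF f]) auto
      finally show "Hs_norm (r i) (blockwise M f i) \<le> (\<Sum>i\<in>UNIV. C i) * Hs_norm (r i) (f i)" .
    qed (intro Hs_norm_nonneg HH_D[OF V[OF f]])
    then show ?thesis by (simp add: HH_norm_L2 L2_set_right_distrib sum_nonneg C)
  qed
  moreover have "clinear_on (HH r) (blockwise M)"
    unfolding clinear_on_def
  proof (intro conjI ballI allI)
    fix f h assume fh: "f \<in> HH r" "h \<in> HH r"
    show "blockwise M (f + h) = blockwise M f + blockwise M h"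
    proof (intro ext)
      fix i p
      show "blockwise M (f + h) i p = (blockwise M f + blockwise M h) i p"
        using suminf_add[OF sm[OF fh(1)] sm[OF fh(2)], of p p i i]
        by (simp add: blockwise_def mat_apply_def distrib_left)
    qed
  next
    fix e f assume f: "f \<in> HH r"
    show "blockwise M (e *C f) = e *C blockwise M f"
    proof (intro ext)
      fix i p
      show "blockwise M (e *C f) i p = (e *C blockwise M f) i p"
        using suminf_mult[OF sm[OF f], of p e i]
        by (simp add: blockwise_def mat_apply_def scaleC_fun_def scaleC_complex_def mult.left_commute)
    qed
  qed
  ultimately show ?thesis using V by (auto simp: bounded_op_def)
qed

text \<open>Such a functional is the first row of a matrix of rank one, whose second factor is square
  summable because \<open>\<beta> > 1\<close>.\<close>

lemma bounded_coefficients_functional: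
  fixes \<kappa> :: "nat \<Rightarrow> complex"
  assumes "\<beta> > 1" and X: "\<And>n. n \<ge> 1 \<Longrightarrow> cmod (\<kappa> n) \<le> X"
  shows "\<exists>E\<ge>0. \<forall>f\<in>Hs (\<beta> / 2). summable (\<lambda>n. norm (\<kappa> n * f n))
           \<and> cmod (\<Sum>n. \<kappa> n * f n) \<le> E * Hs_norm (\<beta> / 2) f"
proof -
  have X0: "X \<ge> 0" using X[of 1] norm_ge_zero[of "\<kappa> 1"] by linarith
  define u where "u p = (if p = 1 then 1 else 0 :: real)" for p :: nat
  define v where "v n = X * real n powr (- \<beta> / 2)" for n :: nat
  define A where "A p n = (if p = 1 then \<kappa> n else 0)" for p n :: nat
  have "(v n)\<^sup>2 = X\<^sup>2 * real n powr (- \<beta>)" for n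
    by (simp add: v_def power_mult_distrib powr_powr flip: powr_realpow[of "real n powr _"] powr_numeral)
  then have sv: "summable (\<lambda>n. (v n)\<^sup>2)"
    using assms(1) by (simp add: summable_mult summable_real_powr_iff)
  have su: "summable (\<lambda>n. (u n)\<^sup>2)"
    by (rule summable_finite[of "{1}"]) (auto simp: u_def)
  have k: "l2_bounded (\<lambda>p n. u p * v n) (sqrt (\<Sum>n. (u n)\<^sup>2) * sqrt (\<Sum>n. (v n)\<^sup>2))"
    by (rule l2_bounded_rank_one[OF _ su _ sv]) (use X0 in \<open>auto simp: u_def v_def\<close>)
  have le: "\<forall>p\<ge>1. \<forall>n\<ge>1. real p powr 0 * cmod (A p n) \<le> u p * v n * real n powr (\<beta> / 2)"
    using X by (auto simp: A_def u_def v_def powr_minus field_simps)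
  show ?thesis
  proof (intro exI conjI ballI)
    show "0 \<le> sqrt (\<Sum>n. (u n)\<^sup>2) * sqrt (\<Sum>n. (v n)\<^sup>2)"
      using k by (simp add: l2_bounded_def)
    fix f assume f: "f \<in> Hs (\<beta> / 2)"
    note * = mat_apply_Hs[OF k f le]
    show "summable (\<lambda>n. norm (\<kappa> n * f n))" using *(1)[of 1] by (simp add: A_def)
    have "cmod (\<Sum>n. \<kappa> n * f n) = L2_set (wt 0 (mat_apply A f)) {1}"
      by (simp add: mat_apply_def A_def)
    also have "\<dots> \<le> Hs_norm 0 (mat_apply A f)" by (intro L2_set_le_Hs_norm *(2)) simp
    also note *(3)
    finally show "cmod (\<Sum>n. \<kappa> n * f n) \<le> sqrt (\<Sum>n. (u n)\<^sup>2) * sqrt (\<Sum>n. (v n)\<^sup>2) * Hs_norm (\<beta> / 2) f" .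
  qed
qed

definition block_feedback ::
  "('m::finite \<Rightarrow> nat \<Rightarrow> complex) \<Rightarrow> ('m \<Rightarrow> nat \<Rightarrow> complex) \<Rightarrow> complex \<Rightarrow>
   ('m \<Rightarrow> nat \<Rightarrow> complex) \<Rightarrow> complex ^ 'm" where
  "block_feedback lam B l f = (\<chi> i. \<Sum>n. cauchy_residue (lam i) l n / B i n * f i n)"

text \<open>Multiplying the entry at \<open>(p, n)\<close> of the transformation by \<open>lam p - l - lam n\<close> leaves
  \<open>B p\<close> times the \<open>n\<close>-th coefficient of the feedback. Summed against \<open>f\<close> this is the relation with
  \<open>T B\<close> replaced by \<open>B\<close>, and \<open>T\<close> fixes \<open>B\<close>. The exponent \<open>- \<alpha> / 2\<close> lies in the range of
  boundedness, so every series involved converges.\<close>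

theorem equivalence_pair_cauchy:
  fixes lam B :: "'m::finite \<Rightarrow> nat \<Rightarrow> complex"
  assumes block: "\<And>i. controlled_block (lam i) (\<alpha> i) c (complex_of_real l) (B i) (\<gamma> i) c1 c2"
    and \<gamma>: "\<And>i. \<gamma> i < (\<alpha> i - 1) / 2"
    and B: "B \<in> HH (\<lambda>i. - \<alpha> i / 2)"
    and lam: "\<forall>i. \<forall>n\<ge>1. cmod (lam i n) \<le> C * real n powr \<alpha> i" "C \<ge> 0"
  shows "equivalence_pair \<alpha> \<gamma> lam B l (block_feedback lam B l)
           (blockwise (\<lambda>i. cauchy_mat (lam i) l (B i)))"
proof -
  let ?M = "\<lambda>i. cauchy_mat (lam i) l (B i)" and ?K = "block_feedback lam B l"
  let ?S = "\<lambda>i. cauchy_mat (\<lambda>n. lam i n - l) (- complex_of_real l) (B i)"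
  let ?\<kappa> = "\<lambda>i n. cauchy_residue (lam i) l n / B i n"
  have g0: "0 \<le> \<gamma> i" and a1: "\<alpha> i > 1" for i
    using block[of i] by (auto simp: controlled_block_def controlled_block_axioms_def gapped_spectrum_def)
  have block': "controlled_block (\<lambda>n. lam i n - l) (\<alpha> i) c (- complex_of_real l) (B i) (\<gamma> i) c1 c2" for i
    by (rule controlled_block.shifted_block[OF block])
  have bounded: "bounded_op (HH r) (HH_norm r) (HH r) (HH_norm r) (blockwise (\<lambda>i. cauchy_mat (lam' i) l' (B i)))"
    if "\<And>i. controlled_block (lam' i) (\<alpha> i) c l' (B i) (\<gamma> i) c1 c2"
       "\<And>i. 1/2 - \<alpha> i < r i" "\<And>i. r i < \<alpha> i - 1/2 - \<gamma> i" for lam' l' r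
  proof -
    have "\<forall>i. \<exists>k C. l2_bounded k C \<and>
        (\<forall>p\<ge>1. \<forall>n\<ge>1. real p powr r i * cmod (cauchy_mat (lam' i) l' (B i) p n) \<le> k p n * real n powr r i)"
      using controlled_block.cauchy_mat_kernel[OF that] by blast
    then obtain k C where "\<And>i. l2_bounded (k i) (C i)"
      "\<And>i. \<forall>p\<ge>1. \<forall>n\<ge>1. real p powr r i * cmod (cauchy_mat (lam' i) l' (B i) p n) \<le> k i p n * real n powr r i"
      by metis
    then show ?thesis by (rule blockwise_bounded_op)
  qed
  have "- \<alpha> i / 2 > 1/2 - \<alpha> i" "- \<alpha> i / 2 < \<alpha> i - 1/2 - \<gamma> i" for i
    using \<gamma>[of i] a1[of i] g0[of i] by (auto simp: field_simps)
  note half = this HH_D[OF B]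
  have "isomorphism (HH r) (HH_norm r) (HH r) (HH_norm r) (blockwise ?M)" if "admissible \<alpha> \<gamma> r" for r
  proof -
    have r: "1/2 - \<alpha> i < r i" "r i < \<alpha> i - 1/2 - \<gamma> i" for i
    proof -
      have "1/2 - \<alpha> i + \<gamma> i < r i \<and> r i < \<alpha> i - 1/2 - \<gamma> i" using that by (simp add: admissible_def)
      then show "1/2 - \<alpha> i < r i" "r i < \<alpha> i - 1/2 - \<gamma> i" using g0[of i] by auto
    qed
    show ?thesis
    proof (rule isomorphismI[OF bounded[OF block r] bounded[OF block' r]])
      fix f assume f: "f \<in> HH r"
      show "blockwise ?S (blockwise ?M f) = f"
        unfolding blockwise_def by (rule ext) (rule controlled_block.cauchy_mat_inverse[OF block r HH_D[OF f] half])
      show "blockwise ?M (blockwise ?S f) = f"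
        unfolding blockwise_def
        using controlled_block.cauchy_mat_inverse[OF block' r HH_D[OF f] half] by (intro ext) simp
    qed
  qed
  moreover
  have "\<exists>E\<ge>0. \<forall>f\<in>Hs (\<alpha> i / 2). summable (\<lambda>n. norm (?\<kappa> i n * f n))
      \<and> cmod (\<Sum>n. ?\<kappa> i n * f n) \<le> E * Hs_norm (\<alpha> i / 2) f" for i
  proof -
    interpret controlled_block "lam i" "\<alpha> i" c l "B i" "\<gamma> i" c1 c2 by (rule block)
    have "cmod (?\<kappa> i n) \<le> residue_bound / c1" if "n \<ge> 1" for n
      using that b(1) c1 residue_le residue_bound_pos by (auto simp: norm_divide intro!: frac_le)
    then show ?thesis by (intro bounded_coefficients_functional a1)
  qed
  then have "\<exists>E. \<forall>i. E i \<ge> 0 \<and> (\<forall>f\<in>Hs (\<alpha> i / 2). summable (\<lambda>n. norm (?\<kappa> i n * f n))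
      \<and> cmod (\<Sum>n. ?\<kappa> i n * f n) \<le> E i * Hs_norm (\<alpha> i / 2) f)"
    by (intro choice allI)
  then obtain E where ex: "\<forall>i. E i \<ge> 0 \<and> (\<forall>f\<in>Hs (\<alpha> i / 2). summable (\<lambda>n. norm (?\<kappa> i n * f n))
      \<and> cmod (\<Sum>n. ?\<kappa> i n * f n) \<le> E i * Hs_norm (\<alpha> i / 2) f)" ..
  have E: "E i \<ge> 0" for i
    using ex by simp
  have sum\<kappa>: "summable (\<lambda>n. norm (?\<kappa> i n * f n))" if "f \<in> Hs (\<alpha> i / 2)" for i f
    using ex that by simp
  have E\<kappa>: "cmod (\<Sum>n. ?\<kappa> i n * f n) \<le> E i * Hs_norm (\<alpha> i / 2) f"
    if "f \<in> Hs (\<alpha> i / 2)" for i f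
    using ex that by simp
  have s\<kappa>: "summable (\<lambda>n. ?\<kappa> i n * f i n)" if "f \<in> HH (\<lambda>i. \<alpha> i / 2)" for f i
    by (rule summable_norm_cancel[OF sum\<kappa>]) (use HH_D[OF that] in simp)
  have "bounded_op (HH (\<lambda>i. \<alpha> i / 2)) (HH_norm (\<lambda>i. \<alpha> i / 2)) UNIV norm ?K"
    unfolding bounded_op_def clinear_on_def
  proof (intro conjI ballI allI exI)
    fix f h assume fh: "f \<in> HH (\<lambda>i. \<alpha> i / 2)" "h \<in> HH (\<lambda>i. \<alpha> i / 2)"
    from suminf_add[OF s\<kappa>[OF fh(1)] s\<kappa>[OF fh(2)]] show "?K (f + h) = ?K f + ?K h"
      by (simp add: vec_eq_iff block_feedback_def distrib_left)
  next
    fix e f assume "f \<in> HH (\<lambda>i. \<alpha> i / 2)"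
    from suminf_mult[OF s\<kappa>[OF this], of e] show "?K (e *C f) = e *C ?K f"
      by (simp add: vec_eq_iff block_feedback_def scaleC_vec_def scaleC_fun_def scaleC_complex_def mult.left_commute)
  next
    fix f :: "'m \<Rightarrow> nat \<Rightarrow> complex" assume f: "f \<in> HH (\<lambda>i. \<alpha> i / 2)"
    have "norm (?K f) \<le> (\<Sum>i\<in>UNIV. norm (?K f $ i))" unfolding norm_vec_def by (rule L2_set_le_sum) simp
    also have "\<dots> \<le> (\<Sum>i\<in>UNIV. E i * HH_norm (\<lambda>i. \<alpha> i / 2) f)"
    proof (rule sum_mono)
      fix i
      have "norm (?K f $ i) \<le> E i * Hs_norm (\<alpha> i / 2) (f i)"
        using E\<kappa>[of "f i" i] HH_D[OF f, of i] by (simp add: block_feedback_def)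
      also have "\<dots> \<le> E i * HH_norm (\<lambda>i. \<alpha> i / 2) f"
        unfolding HH_norm_L2 by (intro mult_left_mono E member_le_L2_set) auto
      finally show "norm (?K f $ i) \<le> E i * HH_norm (\<lambda>i. \<alpha> i / 2) f" .
    qed
    finally show "norm (?K f) \<le> (\<Sum>i\<in>UNIV. E i) * HH_norm (\<lambda>i. \<alpha> i / 2) f"
      by (simp add: sum_distrib_right)
  qed simp
  moreover have "maps_to_damped (\<lambda>i. \<alpha> i / 2) lam B ?K (blockwise ?M) l"
    unfolding maps_to_damped_def
  proof (intro ballI conjI)
    fix f :: "'m \<Rightarrow> nat \<Rightarrow> complex" assume f: "f \<in> HH (\<lambda>i. \<alpha> i / 2)"
    have Af: "diagonal lam f \<in> HH (\<lambda>i. - \<alpha> i / 2)"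
      by (rule diagonal_HH[OF lam f]) simp
    have BK: "control B (?K f) \<in> HH (\<lambda>i. - \<alpha> i / 2)" by (rule control_HH[OF B])
    have "closed_loop lam B ?K f \<in> HH (\<lambda>i. - \<alpha> i / 2)"
      unfolding closed_loop_def by (rule HH_add[OF Af BK])
    then show "blockwise ?M (closed_loop lam B ?K f) \<in> HH (\<lambda>i. - (\<alpha> i / 2))"
      using bounded[OF block half(1,2)] by (auto simp: bounded_op_def)
    show "blockwise ?M (closed_loop lam B ?K f)
        = diagonal lam (blockwise ?M f) - complex_of_real l *C blockwise ?M f"
    proof (intro ext)
      fix i p
      interpret controlled_block "lam i" "\<alpha> i" c l "B i" "\<gamma> i" c1 c2 by (rule block)
      show "blockwise ?M (closed_loop lam B ?K f) i p
        = (diagonal lam (blockwise ?M f) - complex_of_real l *C blockwise ?M f) i p"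
      proof (cases "p = 0")
        case False
        then have p: "p \<ge> 1" by simp
        have sm: "summable (\<lambda>n. ?M i p n * h i n)" if h: "h \<in> HH (\<lambda>i. - \<alpha> i / 2)" for h
        proof -
          obtain k E where "l2_bounded k E" "\<forall>p\<ge>1. \<forall>n\<ge>1.
              real p powr (- \<alpha> i / 2) * cmod (?M i p n) \<le> k p n * real n powr (- \<alpha> i / 2)"
            using cauchy_mat_kernel[OF half(1,2)] by blast
          from mat_apply_Hs(1)[OF this(1) HH_D[OF h] this(2) p]
          show ?thesis by (rule summable_norm_cancel)
        qed
        have f': "f \<in> HH (\<lambda>i. - \<alpha> i / 2)"
        proof (rule HH_mono[OF f])
          show "- \<alpha> i / 2 \<le> \<alpha> i / 2" for i using a1[of i] by simp
        qed
        have "(\<Sum>n. ?M i p n * f i n) * (lam i p - l) - (\<Sum>n. ?M i p n * diagonal lam f i n)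
            = (\<Sum>n. ?M i p n * f i n * (lam i p - l) - ?M i p n * diagonal lam f i n)"
          unfolding suminf_mult2[OF sm[OF f']] by (intro suminf_diff summable_mult2 sm Af f')
        also have "\<dots> = (\<Sum>n. B i p * (?\<kappa> i n * f i n))"
        proof (rule suminf_cong)
          fix n
          show "?M i p n * f i n * (lam i p - l) - ?M i p n * diagonal lam f i n = B i p * (?\<kappa> i n * f i n)"
          proof (cases "n = 0")
            case False
            then have "lam i p - l - lam i n \<noteq> 0" using shift_distinct[of n p] p by simp
            then have "?M i p n * (lam i p - l - lam i n) = B i p * ?\<kappa> i n"
              by (simp add: cauchy_mat_def)
            then show ?thesis by (simp add: diagonal_def algebra_simps)
          qed (use HH_0[OF f] in \<open>simp add: diagonal_def\<close>)
        qed
        also have "\<dots> = B i p * ?K f $ i"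
          unfolding suminf_mult[OF s\<kappa>[OF f]] by (simp add: block_feedback_def)
        also have "\<dots> = (\<Sum>n. ?M i p n * control B (?K f) i n)"
        proof -
          have "(\<Sum>n. ?M i p n * control B (?K f) i n) = (\<Sum>n. ?K f $ i * (?M i p n * B i n))"
            by (simp add: control_def mult_ac)
          also have "\<dots> = ?K f $ i * B i p"
            by (subst suminf_mult[OF sm[OF B]]) (simp add: cauchy_mat_b[OF p])
          finally show ?thesis by (simp add: mult.commute)
        qed
        finally have "(\<Sum>n. ?M i p n * f i n) * (lam i p - l)
            = (\<Sum>n. ?M i p n * diagonal lam f i n) + (\<Sum>n. ?M i p n * control B (?K f) i n)"
          by (simp add: algebra_simps)
        also have "\<dots> = (\<Sum>n. ?M i p n * closed_loop lam B ?K f i n)"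
          unfolding suminf_add[OF sm[OF Af] sm[OF BK]] by (simp add: closed_loop_def distrib_left)
        finally show ?thesis using False
          by (simp add: blockwise_def mat_apply_def diagonal_def scaleC_fun_def scaleC_complex_def algebra_simps)
      qed (simp add: blockwise_def mat_apply_def diagonal_def scaleC_fun_def scaleC_complex_def)
    qed
  qed
  ultimately show ?thesis by (simp add: equivalence_pair_def)
qed

section \<open>Growth of the eigenvalues\<close>

lemma norm_scaleC: "norm (a *C (x :: 'a::complex_hilbert)) = cmod a * norm x"
proof -
  have r: "cinner y (a *C x) = cnj a * cinner y x" for y :: 'a
    by (metis cinner_commute cinner_scaleC_left complex_cnj_mult)
  have "complex_of_real ((norm (a *C x))\<^sup>2) = a * cnj a * complex_of_real ((norm x)\<^sup>2)"
    by (simp only: cinner_self[symmetric] cinner_scaleC_left r mult_ac)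
  also have "\<dots> = complex_of_real ((cmod a * norm x)\<^sup>2)"
    by (simp only: complex_norm_square power_mult_distrib of_real_mult)
  finally have "(norm (a *C x))\<^sup>2 = (cmod a * norm x)\<^sup>2" by (simp only: of_real_eq_iff)
  then show ?thesis by (rule power2_eq_imp_eq) simp_all
qed

lemma riesz_basis_nonzero:
  fixes e :: "'i \<Rightarrow> 'a::complex_hilbert"
  assumes "riesz_basis I e" "j \<in> I"
  shows "e j \<noteq> 0"
proof
  assume e: "e j = 0"
  obtain b :: "'i \<Rightarrow> 'a" and V :: "'a \<Rightarrow> 'a" where b: "\<forall>j\<in>I. \<forall>k\<in>I. cinner (b j) (b k) = (if j = k then 1 else 0)"
    and V: "isomorphism UNIV norm UNIV norm V" and ej: "\<forall>j\<in>I. e j = V (b j)"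
    using assms(1) by (auto simp: riesz_basis_def)
  have "\<forall>f g. V (f + g) = V f + V g"
    using V by (simp add: isomorphism_def bounded_op_def clinear_on_def)
  then have "V (0 + 0) = V 0 + V 0" by blast
  then have "V 0 = V (b j)" using e ej assms(2) by simp
  moreover have "inj V" using V by (simp add: isomorphism_def bij_betw_def)
  ultimately have "b j = 0" by (metis injD)
  moreover have "cinner (b j) (b j) = 1" using b assms(2) by simp
  ultimately have "cinner (0::'a) 0 = 1" by simp
  then show False using cinner_self[of "0::'a"] by simp
qed

lemma exp_difference_quotient:
  "((\<lambda>h. (exp (of_real h * d) - 1) / complex_of_real h) \<longlongrightarrow> d) (at_right 0)"
proof -
  have "((\<lambda>h. exp (h * d)) has_field_derivative d) (at 0)"
    by (auto intro!: derivative_eq_intros)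
  then have "((\<lambda>h. (exp (h * d) - 1) / h) \<longlongrightarrow> d) (at 0)"
    by (simp add: DERIV_def)
  moreover have "filterlim complex_of_real (at 0) (at_right 0)"
    unfolding filterlim_at using tendsto_of_real[OF tendsto_ident_at, of 0 "{0<..}", where 'a = complex]
    by (auto intro!: eventually_at_rightI[of 0 1])
  ultimately show ?thesis by (rule filterlim_compose)
qed

text \<open>On an eigenvector the semigroup acts as \<open>exp (z * t)\<close>: the error of one step of length
  \<open>t / n\<close> is \<open>o(t / n)\<close> by the definition of the generator, and the errors of the \<open>n\<close> steps add up
  to \<open>o(1)\<close>.\<close>

lemma semigroup_eigenvector:
  fixes S :: "real \<Rightarrow> 'a::complex_hilbert \<Rightarrow> 'a"
  assumes gen: "generates UNIV norm D A S"
    and growth: "\<forall>t\<ge>0. \<forall>f. norm (S t f) \<le> M * exp (\<omega> * t) * norm f"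
    and x: "x \<in> D" "A x = z *C x" and t: "t > 0"
  shows "S t x = exp (z * of_real t) *C x"
proof -
  define v where "v h = S h x - exp (z * of_real h) *C x" for h
  define w where "w = max 0 (max \<omega> (Re z))"
  define M' where "M' = max M 0"
  have sg: "c0_semigroup UNIV norm S" using gen by (simp add: generates_def)
  have S0: "S 0 f = f" and Sadd: "0 \<le> s \<Longrightarrow> 0 \<le> t \<Longrightarrow> S (s + t) f = S s (S t f)" for s t f
    using sg by (auto simp: c0_semigroup_def)
  have Slin: "0 \<le> s \<Longrightarrow> S s (f + g) = S s f + S s g" "0 \<le> s \<Longrightarrow> S s (e *C f) = e *C S s f" for s f g e
    using sg by (auto simp: c0_semigroup_def bounded_op_def clinear_on_def)
  have Sn: "norm (S s f) \<le> M' * exp (w * s) * norm f" if "s \<ge> 0" for s f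
  proof -
    have "norm (S s f) \<le> M * exp (\<omega> * s) * norm f" using growth that by simp
    also have "\<dots> \<le> M' * exp (w * s) * norm f"
      using that by (intro mult_right_mono mult_mono) (auto simp: M'_def w_def mult_right_mono)
    finally show ?thesis .
  qed
  have step: "norm (v (real n * h)) \<le> real n * M' * exp (w * (real n * h)) * norm (v h)" if h: "h \<ge> 0" for n h
  proof (induction n)
    case 0
    then show ?case by (simp add: v_def S0 scaleC_one)
  next
    case (Suc n)
    have e: "real (Suc n) * h = real n * h + h" by (simp add: algebra_simps)
    have "S (real n * h + h) x = S (real n * h) (v h + exp (z * of_real h) *C x)"
      using h by (subst Sadd) (auto simp: v_def)
    also have "\<dots> = S (real n * h) (v h) + exp (z * of_real h) *C S (real n * h) x"
      using h by (simp add: Slin)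
    also have "S (real n * h) x = v (real n * h) + exp (z * of_real (real n * h)) *C x"
      by (simp add: v_def)
    finally have S: "S (real n * h + h) x = S (real n * h) (v h)
        + exp (z * of_real h) *C (v (real n * h) + exp (z * of_real (real n * h)) *C x)" .
    have E: "exp (z * of_real (real n * h + h)) *C x = exp (z * of_real h) *C exp (z * of_real (real n * h)) *C x"
      by (simp add: scaleC_scaleC exp_add distrib_left mult.commute)
    have "v (real (Suc n) * h) = S (real n * h) (v h) + exp (z * of_real h) *C v (real n * h)"
      unfolding e v_def[of "real n * h + h"] S E scaleC_add_right by simp
    then have "norm (v (real (Suc n) * h))
        \<le> norm (S (real n * h) (v h)) + norm (exp (z * of_real h) *C v (real n * h))"
      using norm_triangle_ineq by simp
    also have "\<dots> \<le> M' * exp (w * (real n * h)) * norm (v h)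
        + exp (w * h) * (real n * M' * exp (w * (real n * h)) * norm (v h))"
      unfolding norm_scaleC using h
      by (intro add_mono Sn mult_mono Suc.IH) (auto simp: w_def mult_right_mono)
    also have "\<dots> \<le> exp (w * h) * (M' * exp (w * (real n * h)) * norm (v h))
        + exp (w * h) * (real n * M' * exp (w * (real n * h)) * norm (v h))"
      using h mult_right_mono[of 1 "exp (w * h)" "M' * exp (w * (real n * h)) * norm (v h)"]
      by (simp add: M'_def w_def)
    also have "\<dots> = real (Suc n) * M' * exp (w * (real (Suc n) * h)) * norm (v h)"
      unfolding e by (simp add: exp_add algebra_simps)
    finally show ?case .
  qed
  have "((\<lambda>h. norm (complex_of_real (1 / h) *C (S h x - x) - z *C x)) \<longlongrightarrow> 0) (at_right 0)"
    using gen x by (simp add: generates_def)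
  moreover have "((\<lambda>h. norm ((exp (of_real h * z) - 1) / complex_of_real h - z) * norm x) \<longlongrightarrow> 0) (at_right 0)"
    by (intro tendsto_mult_left_zero tendsto_norm_zero LIM_zero exp_difference_quotient)
  ultimately have sum0: "((\<lambda>h. norm (complex_of_real (1 / h) *C (S h x - x) - z *C x)
      + norm ((exp (of_real h * z) - 1) / complex_of_real h - z) * norm x) \<longlongrightarrow> 0) (at_right 0)"
    using tendsto_add_zero by blast
  have v0: "((\<lambda>h. norm (v h) / h) \<longlongrightarrow> 0) (at_right 0)"
  proof (rule tendsto_sandwich[OF _ _ tendsto_const sum0])
    show "\<forall>\<^sub>F h in at_right 0. 0 \<le> norm (v h) / h"
      by (intro eventually_at_rightI[of 0 1]) auto
    have "norm (v h) / h \<le> norm (complex_of_real (1 / h) *C (S h x - x) - z *C x)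
        + norm ((exp (of_real h * z) - 1) / complex_of_real h - z) * norm x" if h: "h > 0" for h
    proof -
      have "norm (v h) / h = norm (complex_of_real (1 / h) *C v h)"
        using h by (simp add: norm_scaleC norm_divide)
      also have "complex_of_real (1 / h) *C v h = (complex_of_real (1 / h) *C (S h x - x) - z *C x)
          - ((exp (of_real h * z) - 1) / complex_of_real h - z) *C x"
        by (simp add: v_def complex_vector.scale_right_diff_distrib complex_vector.scale_left_diff_distrib
            diff_divide_distrib scaleC_scaleC mult.commute)
      finally show ?thesis unfolding norm_scaleC[symmetric] by (simp only: norm_triangle_ineq4)
    qed
    then show "\<forall>\<^sub>F h in at_right 0. norm (v h) / h \<le> norm (complex_of_real (1 / h) *C (S h x - x) - z *C x)
        + norm ((exp (of_real h * z) - 1) / complex_of_real h - z) * norm x"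
      by (intro eventually_at_rightI[of 0 1]) auto
  qed
  have "filterlim (\<lambda>n. t / real n) (at_right 0) sequentially"
    unfolding filterlim_at
    using t by (auto intro!: tendsto_divide_0[OF tendsto_const] filterlim_at_top_imp_at_infinity
        filterlim_real_sequentially eventually_mono[OF eventually_gt_at_top[of 0]])
  from filterlim_compose[OF v0 this]
  have "(\<lambda>n. M' * exp (w * t) * t * (norm (v (t / real n)) / (t / real n))) \<longlonglongrightarrow> M' * exp (w * t) * t * 0"
    by (intro tendsto_mult tendsto_const)
  moreover have "norm (v t) \<le> M' * exp (w * t) * t * (norm (v (t / real n)) / (t / real n))" if "n \<ge> 1" for n
    using step[of "t / real n" n] that t by (simp add: mult_ac)
  ultimately have "norm (v t) \<le> 0"
    by (intro LIMSEQ_le_const[of _ 0]) auto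
  then show ?thesis by (simp add: v_def)
qed

text \<open>The semigroup multiplies the norm of the eigenvector by \<open>exp (Re z * t)\<close>, which cannot outgrow
  the bound for large \<open>t\<close>.\<close>

lemma eigenvalue_growth_bound:
  fixes S :: "real \<Rightarrow> 'a::complex_hilbert \<Rightarrow> 'a"
  assumes gen: "generates UNIV norm D A S"
    and growth: "\<forall>t\<ge>0. \<forall>f. norm (S t f) \<le> M * exp (\<omega> * t) * norm f"
    and x: "x \<in> D" "A x = z *C x" "x \<noteq> 0"
  shows "Re z \<le> \<omega>"
proof (rule ccontr)
  assume "\<not> Re z \<le> \<omega>"
  then have pos: "Re z - \<omega> > 0" by simp
  define t where "t = (\<bar>M\<bar> + 1) / (Re z - \<omega>)"
  have t: "t > 0" using pos by (simp add: t_def)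
  have "exp (Re z * t) * norm x = norm (S t x)"
    using semigroup_eigenvector[OF gen growth x(1,2) t] by (simp add: norm_scaleC)
  also have "\<dots> \<le> M * exp (\<omega> * t) * norm x" using growth t by simp
  finally have "exp (Re z * t) \<le> M * exp (\<omega> * t)" using x(3) by simp
  then have "exp ((Re z - \<omega>) * t) \<le> M" by (simp add: left_diff_distrib exp_diff field_simps)
  moreover have "exp ((Re z - \<omega>) * t) \<ge> 1 + (Re z - \<omega>) * t" by (rule exp_ge_add_one_self)
  moreover have "(Re z - \<omega>) * t = \<bar>M\<bar> + 1" using pos by (simp add: t_def)
  ultimately show False by linarith
qed

section \<open>Diagonal semigroups\<close>

lemma norm_exp_minus_one_le:
  assumes "Re z \<le> 0"
  shows "cmod (exp z - 1) \<le> cmod z"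
proof -
  have "cmod (exp z - exp 0) \<le> 1 * cmod (z - 0)"
    by (rule field_differentiable_bound[of "{z. Re z \<le> 0}" exp exp])
      (use assms in \<open>auto intro!: derivative_eq_intros convex_halfspace_Re_le\<close>)
  then show ?thesis by simp
qed

definition diagonal_semigroup ::
  "('m \<Rightarrow> nat \<Rightarrow> complex) \<Rightarrow> real \<Rightarrow> ('m \<Rightarrow> nat \<Rightarrow> complex) \<Rightarrow> 'm \<Rightarrow> nat \<Rightarrow> complex" where
  "diagonal_semigroup d t f = (\<lambda>i n. exp (of_real t * d i n) * f i n)"

lemma diagonal_semigroup_HH:
  assumes d: "\<forall>i. \<forall>n\<ge>1. Re (d i n) \<le> - \<mu>" and t: "t \<ge> 0" and f: "f \<in> HH r"
  shows "diagonal_semigroup d t f \<in> HH r"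
    and "HH_norm r (diagonal_semigroup d t f) \<le> exp (- \<mu> * t) * HH_norm r f"
proof -
  have *: "\<forall>i. \<forall>n\<ge>1. wt (r i) (diagonal_semigroup d t f i) n \<le> exp (- \<mu> * t) * wt (r i) (f i) n"
  proof (intro allI impI)
    fix i n assume "n \<ge> (1::nat)"
    then have "t * Re (d i n) \<le> t * (- \<mu>)" using d t by (intro mult_left_mono) auto
    then have "exp (t * Re (d i n)) * wt (r i) (f i) n \<le> exp (- \<mu> * t) * wt (r i) (f i) n"
      by (intro mult_right_mono) (auto simp: mult.commute)
    then show "wt (r i) (diagonal_semigroup d t f i) n \<le> exp (- \<mu> * t) * wt (r i) (f i) n"
      by (simp add: diagonal_semigroup_def norm_mult mult_ac)
  qed
  have 0: "\<forall>i. diagonal_semigroup d t f i 0 = 0" using HH_0[OF f] by (simp add: diagonal_semigroup_def)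
  show "diagonal_semigroup d t f \<in> HH r"
    "HH_norm r (diagonal_semigroup d t f) \<le> exp (- \<mu> * t) * HH_norm r f"
    using HH_dominated[OF f exp_ge_zero 0 *] .
qed

text \<open>The difference quotient of the semigroup at \<open>f\<close> is a multiplier applied to \<open>diagonal d f\<close>, and
  this multiplier is bounded uniformly in the time step because \<open>exp z - 1\<close> is at most \<open>z\<close> in modulus
  on the left half plane. So it converges as soon as \<open>diagonal d f\<close> lies in the space, and
  coefficientwise limits exclude any other generator.\<close>

lemma diagonal_semigroup_generates:
  fixes d :: "'m::finite \<Rightarrow> nat \<Rightarrow> complex"
  assumes d: "\<forall>i. \<forall>n\<ge>1. Re (d i n) \<le> - \<mu>" and \<mu>: "\<mu> > 0"
  shows "generates (HH r) (HH_norm r) {f \<in> HH r. diagonal d f \<in> HH r} (diagonal d) (diagonal_semigroup d)"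
proof -
  let ?S = "diagonal_semigroup d"
  note S = diagonal_semigroup_HH[OF d]
  have neg: "cmod (exp (of_real h * d i n)) \<le> 1" and nz: "d i n \<noteq> 0" if "h \<ge> 0" "n \<ge> 1" for h i n
  proof -
    have "Re (d i n) < 0" using d \<mu> that(2) by (metis le_less_trans neg_less_0_iff_less)
    then show "cmod (exp (of_real h * d i n)) \<le> 1" "d i n \<noteq> 0"
      using that(1) by (auto simp: mult_nonneg_nonpos)
  qed
  have pos: "\<forall>\<^sub>F h in at_right (0::real). h > 0" by (rule eventually_at_right_less)
  have op: "bounded_op (HH r) (HH_norm r) (HH r) (HH_norm r) (?S t)" if "t \<ge> 0" for t
    unfolding bounded_op_def clinear_on_def
  proof (intro conjI ballI allI exI)
    show "HH_norm r (?S t f) \<le> exp (- \<mu> * t) * HH_norm r f" if "f \<in> HH r" for f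
      by (rule S(2)[OF \<open>t \<ge> 0\<close> that])
  qed (use S(1)[OF that] in \<open>auto simp: diagonal_semigroup_def fun_eq_iff scaleC_fun_def scaleC_complex_def algebra_simps\<close>)
  have cont: "((\<lambda>t. HH_norm r (?S t f - f)) \<longlongrightarrow> 0) (at_right 0)" if f: "f \<in> HH r" for f
  proof -
    have "((\<lambda>t. HH_norm r (\<lambda>i n. (exp (of_real t * d i n) - 1) * f i n)) \<longlongrightarrow> 0) (at_right 0)"
    proof (rule HH_multiplier_tendsto_0[OF f, where C = 2])
      show "\<forall>\<^sub>F h in at_right 0. \<forall>i. \<forall>n\<ge>1. cmod (exp (of_real h * d i n) - 1) \<le> 2"
        using pos
      proof eventually_elim
        case (elim h)
        show ?case
        proof (intro allI impI)
          fix i n assume "n \<ge> (1::nat)"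
          then have "cmod (exp (of_real h * d i n)) \<le> 1" using neg(1)[of h n i] elim by simp
          then show "cmod (exp (of_real h * d i n) - 1) \<le> 2"
            using norm_triangle_ineq4[of "exp (of_real h * d i n)" 1] unfolding norm_one by linarith
        qed
      qed
      have "((\<lambda>h. exp (complex_of_real h * d i n) - 1) \<longlongrightarrow> exp (complex_of_real 0 * d i n) - 1) (at_right 0)" for i n
        by (intro tendsto_intros)
      then show "((\<lambda>h. exp (complex_of_real h * d i n) - 1) \<longlongrightarrow> 0) (at_right 0)" for i n by simp
    qed simp
    moreover have "?S t f - f = (\<lambda>i n. (exp (of_real t * d i n) - 1) * f i n)" for t
      by (auto simp: diagonal_semigroup_def fun_eq_iff left_diff_distrib)
    ultimately show ?thesis by simp
  qed
  have sg: "c0_semigroup (HH r) (HH_norm r) ?S"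
    unfolding c0_semigroup_def using op cont
    by (auto simp: diagonal_semigroup_def fun_eq_iff exp_add[symmetric] distrib_right mult.assoc[symmetric])
  let ?q = "\<lambda>h f g. complex_of_real (1 / h) *C (?S h f - f) - g"
  have q: "?q h f g = (\<lambda>i n. (exp (of_real h * d i n) - 1) / of_real h * f i n - g i n)" for h f g
    by (auto simp: diagonal_semigroup_def fun_eq_iff scaleC_fun_def scaleC_complex_def algebra_simps diff_divide_distrib)
  have "((\<lambda>h. HH_norm r (?q h f g)) \<longlongrightarrow> 0) (at_right 0) \<longleftrightarrow>
      f \<in> {f \<in> HH r. diagonal d f \<in> HH r} \<and> diagonal d f = g" if f: "f \<in> HH r" and g: "g \<in> HH r" for f g
  proof
    assume lim: "((\<lambda>h. HH_norm r (?q h f g)) \<longlongrightarrow> 0) (at_right 0)"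
    have "diagonal d f i n = g i n" for i n
    proof -
      \<comment> \<open>\<open>max h 0\<close> keeps the quotient in the space for every real \<open>h\<close>\<close>
      have "\<forall>\<^sub>F h in at_right 0. ?q (max h 0) f g = ?q h f g"
        using pos by eventually_elim (simp add: max_def)
      then have "\<forall>\<^sub>F h in at_right 0. HH_norm r (?q h f g) = HH_norm r (?q (max h 0) f g)"
        by eventually_elim simp
      then have "((\<lambda>h. HH_norm r (?q (max h 0) f g)) \<longlongrightarrow> 0) (at_right 0)"
        by (rule Lim_transform_eventually[OF lim])
      then have "((\<lambda>h. ?q (max h 0) f g i n) \<longlongrightarrow> 0) (at_right 0)"
        by (rule HH_coeff_tendsto[rotated]) (intro HH_diff HH_scale S(1) f g, simp)
      then have "((\<lambda>h. ?q h f g i n) \<longlongrightarrow> 0) (at_right 0)"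
        by (rule Lim_transform_eventually) (use pos in \<open>eventually_elim, simp add: max_def\<close>)
      then have "((\<lambda>h. (exp (of_real h * d i n) - 1) / of_real h * f i n - g i n) \<longlongrightarrow> 0) (at_right 0)"
        by (simp only: q)
      moreover have "((\<lambda>h. (exp (of_real h * d i n) - 1) / of_real h * f i n - g i n) \<longlongrightarrow> d i n * f i n - g i n) (at_right 0)"
        by (intro tendsto_intros exp_difference_quotient)
      ultimately have "d i n * f i n - g i n = 0"
        using tendsto_unique[of "at_right (0::real)"] by force
      then show ?thesis by (simp add: diagonal_def)
    qed
    then have "diagonal d f = g" by (intro ext)
    then show "f \<in> {f \<in> HH r. diagonal d f \<in> HH r} \<and> diagonal d f = g" using f g by simp
  next
    assume *: "f \<in> {f \<in> HH r. diagonal d f \<in> HH r} \<and> diagonal d f = g"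
    \<comment> \<open>the difference quotients of the exponential act on \<open>g\<close> as multipliers that stay bounded\<close>
    let ?a = "\<lambda>h i n. (exp (of_real h * d i n) - 1) / (of_real h * d i n) - 1"
    have "((\<lambda>h. HH_norm r (\<lambda>i n. ?a h i n * g i n)) \<longlongrightarrow> 0) (at_right 0)"
    proof (rule HH_multiplier_tendsto_0[OF g, where C = 2])
      show "\<forall>\<^sub>F h in at_right 0. \<forall>i. \<forall>n\<ge>1. cmod (?a h i n) \<le> 2"
        using pos
      proof (eventually_elim, intro allI impI)
        fix h :: real and i n assume h: "h > 0" and n: "n \<ge> (1::nat)"
        have "Re (of_real h * d i n) \<le> 0"
          using neg[of h n i] h n by simp
        then have "cmod (exp (of_real h * d i n) - 1) \<le> cmod (of_real h * d i n)"
          by (rule norm_exp_minus_one_le)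
        moreover have "cmod (of_real h * d i n) > 0" using h nz[of h n i] n by simp
        ultimately have "cmod ((exp (of_real h * d i n) - 1) / (of_real h * d i n)) \<le> 1"
          unfolding norm_divide by (simp only: divide_le_eq_1_pos)
        then show "cmod (?a h i n) \<le> 2"
          using norm_triangle_ineq4[of "(exp (of_real h * d i n) - 1) / (of_real h * d i n)" 1] by simp
      qed
      show "((\<lambda>h. ?a h i n) \<longlongrightarrow> 0) (at_right 0)" if n: "n \<ge> 1" for i n
      proof -
        have "((\<lambda>h. (exp (of_real h * d i n) - 1) / of_real h / d i n - 1) \<longlongrightarrow> d i n / d i n - 1) (at_right 0)"
          using nz[of 0 n i] n by (intro tendsto_intros exp_difference_quotient) auto
        then show ?thesis using nz[of 0 n i] n by simp
      qed
    qed simp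
    moreover have "?q h f g i n = ?a h i n * g i n" for h i n
    proof (cases "n = 0")
      case False
      then have "d i n \<noteq> 0" using nz[of 0 n i] by simp
      moreover have "g i n = d i n * f i n" using * by (auto simp: diagonal_def)
      moreover have "(exp (of_real h * d i n) - 1) / (of_real h * d i n) * d i n
          = (exp (of_real h * d i n) - 1) / of_real h" using \<open>d i n \<noteq> 0\<close> by simp
      ultimately show ?thesis unfolding q left_diff_distrib by (simp only: mult.assoc[symmetric] mult_1)
    next
      case True
      then show ?thesis unfolding q using HH_0[OF f] HH_0[OF g] by simp
    qed
    ultimately show "((\<lambda>h. HH_norm r (?q h f g)) \<longlongrightarrow> 0) (at_right 0)" by presburger
  qed
  then show ?thesis using sg by (auto simp: generates_def)
qed

section \<open>Conjugation of generators\<close>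

lemma bounded_op_HHE:
  assumes "bounded_op V N W M F"
  obtains C where "C \<ge> 0" "\<And>f. f \<in> V \<Longrightarrow> N f \<ge> 0 \<Longrightarrow> M (F f) \<le> C * N f"
proof -
  obtain C where C: "\<forall>f\<in>V. M (F f) \<le> C * N f" using assms by (auto simp: bounded_op_def)
  show thesis
  proof (rule that[of "max C 0"])
    fix f assume "f \<in> V" "N f \<ge> 0"
    then have "M (F f) \<le> C * N f" using C by blast
    also have "\<dots> \<le> max C 0 * N f" using \<open>N f \<ge> 0\<close> by (intro mult_right_mono) auto
    finally show "M (F f) \<le> max C 0 * N f" .
  qed simp
qed

lemma clinear_on_diff:
  fixes F :: "('m::finite \<Rightarrow> nat \<Rightarrow> complex) \<Rightarrow> 'b::complex_vector"
  assumes "clinear_on (HH r) F" "f \<in> HH r" "g \<in> HH r"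
  shows "F (f - g) = F f - F g"
proof -
  have "f = (f - g) + g" by simp
  then have "F f = F (f - g) + F g"
    using assms HH_diff(1)[OF assms(2,3)] unfolding clinear_on_def by metis
  then show ?thesis by simp
qed

locale HH_isomorphism =
  fixes r :: "'m::finite \<Rightarrow> real" and T :: "('m \<Rightarrow> nat \<Rightarrow> complex) \<Rightarrow> 'm \<Rightarrow> nat \<Rightarrow> complex"
  assumes iso: "isomorphism (HH r) (HH_norm r) (HH r) (HH_norm r) T"
begin

abbreviation "Ti \<equiv> inv_into (HH r) T"

lemma bij: "bij_betw T (HH r) (HH r)" using iso by (simp add: isomorphism_def)

lemma T_mem: "f \<in> HH r \<Longrightarrow> T f \<in> HH r"
  and Ti_mem: "f \<in> HH r \<Longrightarrow> Ti f \<in> HH r"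
  and T_Ti: "f \<in> HH r \<Longrightarrow> T (Ti f) = f"
  and Ti_T: "f \<in> HH r \<Longrightarrow> Ti (T f) = f"
  using bij_betwE[OF bij] bij_betwE[OF bij_betw_inv_into[OF bij]]
    bij_betw_inv_into_right[OF bij] bij_betw_inv_into_left[OF bij] by auto

lemma T_linear: "clinear_on (HH r) T" and Ti_linear: "clinear_on (HH r) Ti"
  using iso by (auto simp: isomorphism_def bounded_op_def)

lemma T_inj: "f \<in> HH r \<Longrightarrow> g \<in> HH r \<Longrightarrow> T f = T g \<Longrightarrow> f = g"
  by (metis Ti_T)

lemma T_bounded: obtains C where "C \<ge> 0" "\<And>f. f \<in> HH r \<Longrightarrow> HH_norm r (T f) \<le> C * HH_norm r f"
  using iso bounded_op_HHE[of "HH r" "HH_norm r" "HH r" "HH_norm r" T] unfolding isomorphism_def by auto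

lemma Ti_bounded: obtains C where "C \<ge> 0" "\<And>f. f \<in> HH r \<Longrightarrow> HH_norm r (Ti f) \<le> C * HH_norm r f"
  using iso bounded_op_HHE[of "HH r" "HH_norm r" "HH r" "HH_norm r" Ti] unfolding isomorphism_def by auto

lemma T_tendsto_0:
  assumes "\<forall>\<^sub>F h in F. g h \<in> HH r" "((\<lambda>h. HH_norm r (g h)) \<longlongrightarrow> 0) F"
  shows "((\<lambda>h. HH_norm r (T (g h))) \<longlongrightarrow> 0) F"
proof -
  obtain C where C: "C \<ge> 0" "\<And>f. f \<in> HH r \<Longrightarrow> HH_norm r (T f) \<le> C * HH_norm r f"
    using T_bounded by blast
  show ?thesis
  proof (rule tendsto_sandwich[OF _ _ tendsto_const])
    show "((\<lambda>h. C * HH_norm r (g h)) \<longlongrightarrow> 0) F" by (intro tendsto_mult_right_zero assms)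
    show "\<forall>\<^sub>F h in F. HH_norm r (T (g h)) \<le> C * HH_norm r (g h)"
      using assms(1) by eventually_elim (rule C)
  qed simp
qed

lemma inverse_iso: "HH_isomorphism r Ti"
proof
  show "isomorphism (HH r) (HH_norm r) (HH r) (HH_norm r) Ti"
    using iso by (intro isomorphismI[where G = T]) (auto simp: isomorphism_def T_Ti Ti_T)
qed

lemma T_quotient:
  assumes "f \<in> HH r" "g \<in> HH r" "h \<in> HH r"
  shows "T (c *C (f - g) - h) = c *C (T f - T g) - T h"
proof -
  have fg: "f - g \<in> HH r" by (intro HH_diff assms)
  have "T (c *C (f - g)) = c *C T (f - g)" using T_linear fg by (simp add: clinear_on_def)
  then show ?thesis
    using clinear_on_diff[OF T_linear HH_scale(1)[OF fg] assms(3)] clinear_on_diff[OF T_linear assms(1,2)]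
    by simp
qed

lemma conjugate_generates:
  assumes gen: "generates (HH r) (HH_norm r) D A S"
    and D': "\<And>f. f \<in> D' \<longleftrightarrow> f \<in> HH r \<and> T f \<in> D"
    and A': "\<And>f. f \<in> D' \<Longrightarrow> A' f \<in> HH r \<and> T (A' f) = A (T f)"
  shows "generates (HH r) (HH_norm r) D' A' (\<lambda>t f. Ti (S t (T f)))"
proof -
  interpret inv: HH_isomorphism r Ti by (rule inverse_iso)
  let ?S = "\<lambda>t f. Ti (S t (T f))"
  have sg: "c0_semigroup (HH r) (HH_norm r) S"
    and lim: "\<And>f g. f \<in> HH r \<Longrightarrow> g \<in> HH r \<Longrightarrow>
      ((\<lambda>h. HH_norm r (complex_of_real (1 / h) *C (S h f - f) - g)) \<longlongrightarrow> 0) (at_right 0)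
        \<longleftrightarrow> f \<in> D \<and> A f = g"
    using gen by (auto simp: generates_def)
  have op: "bounded_op (HH r) (HH_norm r) (HH r) (HH_norm r) (S t)" if "t \<ge> 0" for t
    using sg that by (simp add: c0_semigroup_def)
  have S_mem: "S t f \<in> HH r" if "t \<ge> 0" "f \<in> HH r" for t f
    using op[OF that(1)] that(2) by (auto simp: bounded_op_def)
  have mem: "?S t f \<in> HH r" if "t \<ge> 0" "f \<in> HH r" for t f
    by (intro Ti_mem S_mem T_mem that)
  have TS: "T (?S t f) = S t (T f)" if "t \<ge> 0" "f \<in> HH r" for t f
    by (intro T_Ti S_mem T_mem that)
  have pos: "\<forall>\<^sub>F h in at_right (0::real). h > 0" by (rule eventually_at_right_less)
  have "bounded_op (HH r) (HH_norm r) (HH r) (HH_norm r) (?S t)" if t: "t \<ge> 0" for t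
  proof -
    obtain C1 where C1: "C1 \<ge> 0" "\<And>f. f \<in> HH r \<Longrightarrow> HH_norm r (T f) \<le> C1 * HH_norm r f"
      using T_bounded by blast
    obtain C2 where C2: "C2 \<ge> 0" "\<And>f. f \<in> HH r \<Longrightarrow> HH_norm r (Ti f) \<le> C2 * HH_norm r f"
      using Ti_bounded by blast
    obtain C3 where C3: "C3 \<ge> 0" "\<And>f. f \<in> HH r \<Longrightarrow> HH_norm r (S t f) \<le> C3 * HH_norm r f"
      using bounded_op_HHE[OF op[OF t]] by auto
    have "HH_norm r (?S t f) \<le> (C2 * (C3 * C1)) * HH_norm r f" if f: "f \<in> HH r" for f
    proof -
      have "HH_norm r (?S t f) \<le> C2 * HH_norm r (S t (T f))" by (intro C2 S_mem T_mem t f)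
      also have "\<dots> \<le> C2 * (C3 * HH_norm r (T f))" by (intro mult_left_mono C2 C3 T_mem f)
      also have "\<dots> \<le> C2 * (C3 * (C1 * HH_norm r f))" by (intro mult_left_mono C1 C2 C3 f)
      finally show ?thesis by (simp add: mult.assoc)
    qed
    moreover have "clinear_on (HH r) (?S t)"
      using T_linear Ti_linear op[OF t] by (simp add: clinear_on_def bounded_op_def T_mem S_mem t)
    ultimately show ?thesis using mem[OF t] by (auto simp: bounded_op_def)
  qed
  moreover have "((\<lambda>t. HH_norm r (?S t f - f)) \<longlongrightarrow> 0) (at_right 0)" if f: "f \<in> HH r" for f
  proof -
    have ev: "\<forall>\<^sub>F t in at_right 0. S t (T f) - T f \<in> HH r"
      using pos by eventually_elim (intro HH_diff S_mem T_mem f, simp)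
    have "((\<lambda>t. HH_norm r (Ti (S t (T f) - T f))) \<longlongrightarrow> 0) (at_right 0)"
      using sg f T_mem by (intro inv.T_tendsto_0 ev) (simp add: c0_semigroup_def)
    then show ?thesis
    proof (rule Lim_transform_eventually)
      show "\<forall>\<^sub>F t in at_right 0. HH_norm r (Ti (S t (T f) - T f)) = HH_norm r (?S t f - f)"
        using pos by eventually_elim (simp add: clinear_on_diff[OF Ti_linear] S_mem T_mem f Ti_T)
    qed
  qed
  ultimately have "c0_semigroup (HH r) (HH_norm r) ?S"
    using sg by (simp add: c0_semigroup_def TS T_mem Ti_T)
  moreover have "((\<lambda>h. HH_norm r (complex_of_real (1 / h) *C (?S h f - f) - g)) \<longlongrightarrow> 0) (at_right 0)
      \<longleftrightarrow> f \<in> D' \<and> A' f = g" if f: "f \<in> HH r" and g: "g \<in> HH r" for f g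
  proof -
    let ?q = "\<lambda>h. complex_of_real (1 / h) *C (?S h f - f) - g"
    let ?q' = "\<lambda>h. complex_of_real (1 / h) *C (S h (T f) - T f) - T g"
    have T_q: "\<forall>\<^sub>F h in at_right 0. T (?q h) = ?q' h \<and> ?q h \<in> HH r \<and> ?q' h \<in> HH r \<and> Ti (?q' h) = ?q h"
      using pos
    proof eventually_elim
      case (elim h)
      have m: "?q h \<in> HH r" using elim by (intro HH_diff(1) HH_scale(1) mem f g) simp
      have "T (?q h) = ?q' h"
        using elim f g by (simp only: T_quotient mem less_imp_le TS)
      then show ?case using m T_mem[OF m] Ti_T[OF m] by simp
    qed
    have "((\<lambda>h. HH_norm r (?q h)) \<longlongrightarrow> 0) (at_right 0) \<longleftrightarrow> ((\<lambda>h. HH_norm r (?q' h)) \<longlongrightarrow> 0) (at_right 0)"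
    proof
      assume "((\<lambda>h. HH_norm r (?q h)) \<longlongrightarrow> 0) (at_right 0)"
      then have "((\<lambda>h. HH_norm r (T (?q h))) \<longlongrightarrow> 0) (at_right 0)"
        by (rule T_tendsto_0[rotated]) (use T_q in \<open>eventually_elim, simp\<close>)
      then show "((\<lambda>h. HH_norm r (?q' h)) \<longlongrightarrow> 0) (at_right 0)"
        by (rule Lim_transform_eventually) (use T_q in \<open>eventually_elim, simp\<close>)
    next
      assume "((\<lambda>h. HH_norm r (?q' h)) \<longlongrightarrow> 0) (at_right 0)"
      then have "((\<lambda>h. HH_norm r (Ti (?q' h))) \<longlongrightarrow> 0) (at_right 0)"
        by (rule inv.T_tendsto_0[rotated]) (use T_q in \<open>eventually_elim, simp\<close>)
      then show "((\<lambda>h. HH_norm r (?q h)) \<longlongrightarrow> 0) (at_right 0)"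
        by (rule Lim_transform_eventually) (use T_q in \<open>eventually_elim, simp\<close>)
    qed
    also have "\<dots> \<longleftrightarrow> T f \<in> D \<and> A (T f) = T g" by (intro lim T_mem f g)
    also have "\<dots> \<longleftrightarrow> f \<in> D' \<and> A' f = g"
      using D' A' T_inj f g by metis
    finally show ?thesis .
  qed
  ultimately show ?thesis using D' A' by (auto simp: generates_def)
qed

end

section \<open>Extension of the feedback and regularity of the closed loop\<close>

lemma tendsto_scaleC_vec:
  fixes y :: "complex ^ 'm"
  assumes "(g \<longlongrightarrow> y) F"
  shows "((\<lambda>x. a *C g x) \<longlongrightarrow> a *C y) F"
  by (rule vec_tendstoI)
    (simp add: scaleC_vec_def scaleC_complex_def, intro tendsto_mult_left tendsto_vec_nth assms)

locale closed_loop_equivalence =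
  fixes \<alpha> \<gamma> :: "'m::finite \<Rightarrow> real" and lam B :: "'m \<Rightarrow> nat \<Rightarrow> complex" and l c C c1 :: real
    and K :: "('m \<Rightarrow> nat \<Rightarrow> complex) \<Rightarrow> complex ^ 'm"
    and T :: "('m \<Rightarrow> nat \<Rightarrow> complex) \<Rightarrow> 'm \<Rightarrow> nat \<Rightarrow> complex"
  assumes \<gamma>: "\<And>i. 0 \<le> \<gamma> i" "\<And>i. \<gamma> i < (\<alpha> i - 1) / 2"
    and c: "c > 0" and C: "C > 0"
    and lam: "\<And>i n. n \<ge> 1 \<Longrightarrow> c * real n powr \<alpha> i \<le> cmod (lam i n) + 1"
      "\<And>i n. n \<ge> 1 \<Longrightarrow> cmod (lam i n) + 1 \<le> C * real n powr \<alpha> i"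
    and B: "B \<in> HH (\<lambda>i. - \<alpha> i / 2)"
    and c1: "c1 > 0" "\<And>i. c1 \<le> cmod (B i 1)"
    and pair: "equivalence_pair \<alpha> \<gamma> lam B l K T"
begin

abbreviation "s \<equiv> (\<lambda>i. \<alpha> i / 2)"

lemma isoT: "admissible \<alpha> \<gamma> r \<Longrightarrow> HH_isomorphism r T"
  using pair unfolding HH_isomorphism_def equivalence_pair_def by blast

lemma lam_le: "\<forall>i. \<forall>n\<ge>1. cmod (lam i n) \<le> C * real n powr \<alpha> i"
proof (intro allI impI)
  show "cmod (lam i n) \<le> C * real n powr \<alpha> i" if "n \<ge> 1" for i n
    using lam(2)[OF that, of i] by linarith
qed

lemma damped:
  "f \<in> HH s \<Longrightarrow> T (closed_loop lam B K f) = diagonal lam (T f) - complex_of_real l *C T f"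
  using pair unfolding equivalence_pair_def maps_to_damped_def by blast

lemma K_linear: "clinear_on (HH s) K"
  and K_bounded: "bounded_op (HH s) (HH_norm s) UNIV norm K"
  using pair unfolding equivalence_pair_def bounded_op_def by blast+

text \<open>The preimage of \<open>T u\<close> in \<open>HH b\<close> is \<open>u\<close> itself, because \<open>T\<close> is injective on an admissible space
  that contains both \<open>HH a\<close> and \<open>HH b\<close>.\<close>

lemma T_regularity:
  assumes a: "admissible \<alpha> \<gamma> a" and b: "admissible \<alpha> \<gamma> b" and u: "u \<in> HH a" "T u \<in> HH b"
  shows "u \<in> HH b"
proof -
  define e where "e i = min (a i) (b i)" for i
  have e: "admissible \<alpha> \<gamma> e"
    unfolding admissible_def
  proof
    show "e i \<in> {1/2 - \<alpha> i + \<gamma> i <..< \<alpha> i - 1/2 - \<gamma> i}" for i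
      using a[unfolded admissible_def, rule_format, of i] b[unfolded admissible_def, rule_format, of i]
      unfolding e_def min_def by (cases "a i \<le> b i") simp_all
  qed
  interpret b: HH_isomorphism b T by (rule isoT[OF b])
  interpret e: HH_isomorphism e T by (rule isoT[OF e])
  have 1: "u \<in> HH e" by (rule HH_mono[OF u(1)]) (simp add: e_def)
  have 2: "b.Ti (T u) \<in> HH e" by (rule HH_mono[OF b.Ti_mem[OF u(2)]]) (simp add: e_def)
  have "b.Ti (T u) = u" by (rule e.T_inj[OF 2 1 b.T_Ti[OF u(2)]])
  then show ?thesis using b.Ti_mem[OF u(2)] by simp
qed

text \<open>The additional term \<open>u\<close> covers the finitely many eigenvalues that may be small or zero: only
  \<open>cmod (lam i n) + 1\<close> is bounded below by the power of \<open>n\<close>.\<close>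

lemma diagonal_regularity:
  assumes u: "u \<in> HH t" and Au: "diagonal lam u \<in> HH t"
  shows "u \<in> HH (\<lambda>i. t i + \<alpha> i)"
proof -
  define v where "v = (\<lambda>i n. complex_of_real (cmod (diagonal lam u i n)))
      + (\<lambda>i n. complex_of_real (cmod (u i n)))"
  have abs: "(\<lambda>i n. complex_of_real (cmod (w i n))) \<in> HH t" if w: "w \<in> HH t" for w :: "'m \<Rightarrow> nat \<Rightarrow> complex"
    by (rule HH_dominated(1)[OF w, of 1]) (use HH_0[OF w] in auto)
  have "v \<in> HH t" unfolding v_def by (intro HH_add abs u Au)
  then show ?thesis
  proof (rule HH_dominated(1))
    show "0 \<le> 1 / c" using c by simp
    show "\<forall>i. u i 0 = 0" using HH_0[OF u] by simp
    show "\<forall>i. \<forall>n\<ge>1. wt (t i + \<alpha> i) (u i) n \<le> 1 / c * wt (t i) (v i) n"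
    proof (intro allI impI)
      fix i n assume n: "n \<ge> (1::nat)"
      have v: "cmod (v i n) = (cmod (lam i n) + 1) * cmod (u i n)"
      proof -
        have "v i n = complex_of_real ((cmod (lam i n) + 1) * cmod (u i n))"
          by (simp add: v_def diagonal_def norm_mult algebra_simps)
        then show ?thesis by (simp only: norm_of_real) simp
      qed
      have "c * wt (t i + \<alpha> i) (u i) n = real n powr t i * (c * real n powr \<alpha> i * cmod (u i n))"
        by (simp add: powr_add)
      also have "\<dots> \<le> wt (t i) (v i) n"
        unfolding v by (intro mult_left_mono mult_right_mono lam n) auto
      finally show "wt (t i + \<alpha> i) (u i) n \<le> 1 / c * wt (t i) (v i) n"
        using c by (simp add: field_simps)
    qed
  qed
qed

text \<open>Every continuous extension of \<open>K\<close> is a limit along truncations; this makes the extended value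
  independent of the space in which the extension is taken.\<close>

definition Kext :: "('m \<Rightarrow> nat \<Rightarrow> complex) \<Rightarrow> complex ^ 'm" where
  "Kext f = lim (\<lambda>N. K (trunc N f))"

lemma feedback_extension_eq:
  assumes "feedback_extension s K \<sigma> L" "f \<in> HH \<sigma>"
  shows "(\<lambda>N. K (trunc N f)) \<longlonglongrightarrow> L f"
proof -
  have L: "bounded_op (HH \<sigma>) (HH_norm \<sigma>) UNIV norm L" "\<And>f. f \<in> HH s \<Longrightarrow> L f = K f"
    using assms by (auto simp: feedback_extension_def)
  obtain E where E: "E \<ge> 0" "\<And>f. f \<in> HH \<sigma> \<Longrightarrow> norm (L f) \<le> E * HH_norm \<sigma> f"
    using bounded_op_HHE[OF L(1)] by auto
  have lin: "clinear_on (HH \<sigma>) L" using L(1) by (simp add: bounded_op_def)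
  have t: "trunc N f - f \<in> HH \<sigma>" for N by (intro HH_diff trunc_HH[OF assms(2)] assms(2))
  have d: "L (trunc N f - f) = K (trunc N f) - L f" for N
    using clinear_on_diff[OF lin trunc_HH[OF assms(2)] assms(2)] L(2)[OF trunc_HH[OF assms(2)]] by simp
  have "(\<lambda>N. L (trunc N f - f)) \<longlonglongrightarrow> 0"
  proof (rule Lim_null_comparison)
    show "\<forall>\<^sub>F N in sequentially. norm (L (trunc N f - f)) \<le> E * HH_norm \<sigma> (trunc N f - f)"
      using E t by (intro always_eventually allI) auto
    show "(\<lambda>N. E * HH_norm \<sigma> (trunc N f - f)) \<longlonglongrightarrow> 0"
      by (intro tendsto_mult_right_zero trunc_tendsto assms)
  qed
  then show ?thesis unfolding d by (rule LIM_zero_cancel)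
qed

lemma ext_feedback_eq:
  assumes "f \<in> ext_domain s K"
  shows "ext_feedback s K f = Kext f"
proof -
  have *: "L f = Kext f" if "feedback_extension s K \<sigma> L" "f \<in> HH \<sigma>" for \<sigma> L
    using limI[OF feedback_extension_eq[OF that]] by (simp add: Kext_def)
  obtain \<sigma> L where L: "feedback_extension s K \<sigma> L" "f \<in> HH \<sigma>" using assms by (auto simp: ext_domain_def)
  show ?thesis
    unfolding ext_feedback_def
  proof (rule the_equality)
    show "\<exists>\<sigma> L. feedback_extension s K \<sigma> L \<and> f \<in> HH \<sigma> \<and> L f = Kext f" using L *[OF L] by blast
    show "y = Kext f" if "\<exists>\<sigma> L. feedback_extension s K \<sigma> L \<and> f \<in> HH \<sigma> \<and> L f = y" for y
      using that * by blast
  qed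
qed

end

text \<open>The exponents for which the relation between \<open>T\<close> and \<open>K\<close> makes sense in the two admissible
  spaces with exponents \<open>\<sigma>\<close> and \<open>\<sigma> - \<alpha>\<close>; solving it for \<open>control B (K f)\<close> bounds \<open>K\<close> on \<open>HH \<sigma>\<close>.\<close>

locale closed_loop_extension = closed_loop_equivalence +
  fixes \<sigma> :: "'a \<Rightarrow> real"
  assumes \<sigma>: "\<And>i. 1/2 + \<gamma> i < \<sigma> i" "\<And>i. \<sigma> i \<le> \<alpha> i / 2"
begin

abbreviation "\<tau> \<equiv> (\<lambda>i. \<sigma> i - \<alpha> i)"

lemma adm: "admissible \<alpha> \<gamma> \<sigma>" "admissible \<alpha> \<gamma> \<tau>"
proof -
  have "1/2 - \<alpha> i + \<gamma> i < \<sigma> i \<and> \<sigma> i < \<alpha> i - 1/2 - \<gamma> i \<and> 1/2 - \<alpha> i + \<gamma> i < \<tau> i \<and> \<tau> i < \<alpha> i - 1/2 - \<gamma> i" for i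
    using \<sigma>[of i] \<gamma>[of i] by (auto simp: field_simps)
  then show "admissible \<alpha> \<gamma> \<sigma>" "admissible \<alpha> \<gamma> \<tau>" by (auto simp: admissible_def)
qed

sublocale S: HH_isomorphism \<sigma> T by (rule isoT[OF adm(1)])
sublocale R: HH_isomorphism \<tau> T by (rule isoT[OF adm(2)])

lemma B_mem: "B \<in> HH \<tau>"
  by (rule HH_mono[OF B]) (use \<sigma>(2) in \<open>simp add: field_simps\<close>)

lemma sub: "f \<in> HH s \<Longrightarrow> f \<in> HH \<sigma>" and sub': "f \<in> HH \<sigma> \<Longrightarrow> f \<in> HH \<tau>"
  and sub_norm: "f \<in> HH \<sigma> \<Longrightarrow> HH_norm \<tau> f \<le> HH_norm \<sigma> f"
proof -
  have le: "\<tau> i \<le> \<sigma> i" for i using \<gamma>[of i] by (simp add: field_simps)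
  show "f \<in> HH \<tau>" "HH_norm \<tau> f \<le> HH_norm \<sigma> f" if "f \<in> HH \<sigma>"
    using HH_mono[OF that le] .
  show "f \<in> HH \<sigma>" if "f \<in> HH s"
    by (rule HH_mono(1)[OF that \<sigma>(2)])
qed

lemma diag_mem: "f \<in> HH \<sigma> \<Longrightarrow> diagonal lam f \<in> HH \<tau>"
  and diag_norm: "f \<in> HH \<sigma> \<Longrightarrow> HH_norm \<tau> (diagonal lam f) \<le> C * HH_norm \<sigma> f"
  using diagonal_HH[OF lam_le less_imp_le[OF C], of f \<sigma> \<tau>] by simp_all

text \<open>A bound of \<open>control B (K f)\<close> controls every component of \<open>K f\<close> through the coefficient with
  index \<open>1\<close>, since the first coefficients of \<open>B\<close> do not vanish.\<close>

lemma K_bound: "\<exists>E\<ge>0. \<forall>f\<in>HH s. norm (K f) \<le> E * HH_norm \<sigma> f"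
proof -
  obtain E1 where E1: "E1 \<ge> 0" "\<And>f. f \<in> HH \<sigma> \<Longrightarrow> HH_norm \<sigma> (T f) \<le> E1 * HH_norm \<sigma> f"
    using S.T_bounded by blast
  obtain E2 where E2: "E2 \<ge> 0" "\<And>f. f \<in> HH \<tau> \<Longrightarrow> HH_norm \<tau> (R.Ti f) \<le> E2 * HH_norm \<tau> f"
    using R.Ti_bounded by blast
  define E where "E = (E2 * ((C + \<bar>l\<bar>) * E1) + C) / c1"
  have E0: "E \<ge> 0" using E1(1) E2(1) C c1(1) by (simp add: E_def)
  have cE: "c1 * E = E2 * ((C + \<bar>l\<bar>) * E1) + C" using c1(1) by (simp add: E_def)
  have le: "cmod (K f $ i) \<le> E * HH_norm \<sigma> f" if f: "f \<in> HH s" for f i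
  proof -
    define u where "u = closed_loop lam B K f"
    have u: "u \<in> HH \<tau>"
      unfolding u_def closed_loop_def
      by (intro HH_add control_HH B_mem diag_mem sub f)
    have Tf: "T f \<in> HH \<sigma>" by (intro S.T_mem sub f)
    have "HH_norm \<tau> (T u) \<le> HH_norm \<tau> (diagonal lam (T f)) + HH_norm \<tau> (complex_of_real l *C T f)"
      unfolding u_def damped[OF f] by (intro HH_diff(2) HH_scale diag_mem sub' Tf)
    also have "\<dots> \<le> C * HH_norm \<sigma> (T f) + \<bar>l\<bar> * HH_norm \<sigma> (T f)"
    proof (rule add_mono[OF diag_norm[OF Tf]])
      have "HH_norm \<tau> (complex_of_real l *C T f) \<le> \<bar>l\<bar> * HH_norm \<tau> (T f)"
        using HH_scale(2)[OF sub'[OF Tf], of "complex_of_real l"] by simp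
      also have "\<dots> \<le> \<bar>l\<bar> * HH_norm \<sigma> (T f)" by (intro mult_left_mono sub_norm Tf) simp
      finally show "HH_norm \<tau> (complex_of_real l *C T f) \<le> \<bar>l\<bar> * HH_norm \<sigma> (T f)" .
    qed
    also have "\<dots> = (C + \<bar>l\<bar>) * HH_norm \<sigma> (T f)" by (simp add: distrib_right)
    also have "\<dots> \<le> (C + \<bar>l\<bar>) * (E1 * HH_norm \<sigma> f)" using C by (intro mult_left_mono E1 sub f) simp
    finally have Tu: "HH_norm \<tau> (T u) \<le> (C + \<bar>l\<bar>) * (E1 * HH_norm \<sigma> f)" .
    have "HH_norm \<tau> u \<le> E2 * HH_norm \<tau> (T u)" using E2(2)[OF R.T_mem[OF u]] by (simp add: R.Ti_T[OF u])
    also have "\<dots> \<le> E2 * ((C + \<bar>l\<bar>) * (E1 * HH_norm \<sigma> f))" by (intro mult_left_mono Tu E2)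
    finally have nu: "HH_norm \<tau> u \<le> E2 * ((C + \<bar>l\<bar>) * (E1 * HH_norm \<sigma> f))" .
    have "control B (K f) = u - diagonal lam f" by (simp add: u_def closed_loop_def)
    then have "HH_norm \<tau> (control B (K f)) \<le> HH_norm \<tau> u + HH_norm \<tau> (diagonal lam f)"
      using HH_diff(2)[OF u diag_mem[OF sub[OF f]]] by simp
    also have "\<dots> \<le> E2 * ((C + \<bar>l\<bar>) * (E1 * HH_norm \<sigma> f)) + C * HH_norm \<sigma> f"
      by (intro add_mono nu diag_norm sub f)
    finally have BK: "HH_norm \<tau> (control B (K f)) \<le> c1 * E * HH_norm \<sigma> f"
      unfolding cE by (simp add: algebra_simps)
    have "c1 * cmod (K f $ i) \<le> cmod (B i 1) * cmod (K f $ i)" by (intro mult_right_mono c1) simp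
    also have "\<dots> = real 1 powr \<tau> i * cmod (control B (K f) i 1)" by (simp add: control_def norm_mult)
    also have "\<dots> \<le> HH_norm \<tau> (control B (K f))" by (intro HH_coeff control_HH B_mem)
    also note BK
    finally show ?thesis using c1 by (simp add: mult.assoc)
  qed
  show ?thesis
  proof (intro exI[of _ "of_nat CARD('a) * E"] conjI ballI)
    show "0 \<le> of_nat CARD('a) * E" using E0 by simp
    fix f assume f: "f \<in> HH s"
    have "norm (K f) \<le> (\<Sum>i\<in>UNIV. cmod (K f $ i))" unfolding norm_vec_def by (rule L2_set_le_sum) simp
    also have "\<dots> \<le> of_nat CARD('a) * (E * HH_norm \<sigma> f)" by (rule sum_bounded_above) (rule le[OF f])
    finally show "norm (K f) \<le> of_nat CARD('a) * E * HH_norm \<sigma> f" by (simp add: mult.assoc)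
  qed
qed

lemma Kext_tendsto:
  assumes f: "f \<in> HH \<sigma>"
  shows "(\<lambda>N. K (trunc N f)) \<longlonglongrightarrow> Kext f"
proof -
  obtain E where E: "E \<ge> 0" "\<And>f. f \<in> HH s \<Longrightarrow> norm (K f) \<le> E * HH_norm \<sigma> f" using K_bound by blast
  define e where "e N = HH_norm \<sigma> (trunc N f - f)" for N
  have e: "e \<longlonglongrightarrow> 0" unfolding e_def by (rule trunc_tendsto[OF f])
  have le: "dist (K (trunc M f)) (K (trunc N f)) \<le> E * (e M + e N)" for M N
  proof -
    have "K (trunc M f) - K (trunc N f) = K (trunc M f - trunc N f)"
      by (rule clinear_on_diff[OF K_linear, symmetric]) (rule trunc_HH[OF f])+
    also have "norm \<dots> \<le> E * HH_norm \<sigma> (trunc M f - trunc N f)"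
      by (intro E HH_diff trunc_HH[OF f])
    also have "trunc M f - trunc N f = (trunc M f - f) - (trunc N f - f)" by simp
    also have "HH_norm \<sigma> \<dots> \<le> e M + e N"
      unfolding e_def by (intro HH_diff trunc_HH[OF f] f)
    finally show ?thesis using E(1) by (simp add: dist_norm mult_left_mono)
  qed
  have "Cauchy (\<lambda>N. K (trunc N f))"
  proof (rule metric_CauchyI)
    fix \<epsilon> :: real assume "\<epsilon> > 0"
    have "(\<lambda>N. E * (2 * e N)) \<longlonglongrightarrow> 0" using e by (intro tendsto_mult_right_zero) 
    then have "\<forall>\<^sub>F N in sequentially. E * (2 * e N) < \<epsilon>" by (rule order_tendstoD(2)) fact
    then obtain N0 where N0: "\<And>N. N \<ge> N0 \<Longrightarrow> E * (2 * e N) < \<epsilon>" by (auto simp: eventually_sequentially)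
    show "\<exists>N0. \<forall>M\<ge>N0. \<forall>N\<ge>N0. dist (K (trunc M f)) (K (trunc N f)) < \<epsilon>"
    proof (intro exI allI impI)
      fix M N assume "M \<ge> N0" "N \<ge> N0"
      then show "dist (K (trunc M f)) (K (trunc N f)) < \<epsilon>"
        using le[of M N] N0[of M] N0[of N] by (simp add: distrib_left)
    qed
  qed
  then show ?thesis by (simp add: Kext_def Cauchy_convergent_iff convergent_LIMSEQ_iff)
qed

lemma Kext_eq: "f \<in> HH s \<Longrightarrow> Kext f = K f"
proof -
  assume f: "f \<in> HH s"
  have "feedback_extension s K s K" using K_bounded by (simp add: feedback_extension_def)
  from feedback_extension_eq[OF this f] show ?thesis by (simp add: Kext_def limI)
qed

lemma Kext_extension: "feedback_extension s K \<sigma> Kext"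
proof -
  obtain E where E: "E \<ge> 0" "\<And>f. f \<in> HH s \<Longrightarrow> norm (K f) \<le> E * HH_norm \<sigma> f" using K_bound by blast
  have "bounded_op (HH \<sigma>) (HH_norm \<sigma>) UNIV norm Kext"
    unfolding bounded_op_def clinear_on_def
  proof (intro conjI ballI allI exI)
    fix f g assume f: "f \<in> HH \<sigma>" and g: "g \<in> HH \<sigma>"
    have "K (trunc N (f + g)) = K (trunc N f) + K (trunc N g)" for N
      using K_linear trunc_HH[OF f] trunc_HH[OF g] by (simp add: trunc_linear clinear_on_def)
    then have "(\<lambda>N. K (trunc N (f + g))) \<longlonglongrightarrow> Kext f + Kext g"
      using tendsto_add[OF Kext_tendsto[OF f] Kext_tendsto[OF g]] by simp
    then show "Kext (f + g) = Kext f + Kext g" by (simp add: Kext_def[of "f + g"] limI)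
  next
    fix a f assume f: "f \<in> HH \<sigma>"
    have "K (trunc N (a *C f)) = a *C K (trunc N f)" for N
      using K_linear trunc_HH[OF f] by (simp add: trunc_linear clinear_on_def)
    then have "(\<lambda>N. K (trunc N (a *C f))) \<longlonglongrightarrow> a *C Kext f"
      using tendsto_scaleC_vec[OF Kext_tendsto[OF f]] by simp
    then show "Kext (a *C f) = a *C Kext f" by (simp add: Kext_def[of "a *C f"] limI)
  next
    fix f assume f: "f \<in> HH \<sigma>"
    show "norm (Kext f) \<le> E * HH_norm \<sigma> f"
    proof (rule LIMSEQ_le_const2[OF tendsto_norm[OF Kext_tendsto[OF f]]])
      have "norm (K (trunc N f)) \<le> E * HH_norm \<sigma> f" for N
      proof -
        have "norm (K (trunc N f)) \<le> E * HH_norm \<sigma> (trunc N f)" by (intro E trunc_HH[OF f])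
        also have "\<dots> \<le> E * HH_norm \<sigma> f" by (intro mult_left_mono trunc_HH_norm_le f E)
        finally show ?thesis .
      qed
      then show "\<exists>N0. \<forall>N\<ge>N0. norm (K (trunc N f)) \<le> E * HH_norm \<sigma> f" by blast
    qed
  qed simp
  then show ?thesis using \<sigma>(2) Kext_eq by (simp add: feedback_extension_def)
qed

lemma closed_loop_mem: "f \<in> HH \<sigma> \<Longrightarrow> closed_loop lam B Kext f \<in> HH \<tau>"
  unfolding closed_loop_def by (intro HH_add control_HH B_mem diag_mem)

text \<open>The relation extends to \<open>HH \<sigma>\<close> by passing to the limit along truncations.\<close>

lemma damped_ext:
  assumes f: "f \<in> HH \<sigma>"
  shows "T (closed_loop lam B Kext f) = diagonal lam (T f) - complex_of_real l *C T f"
proof (intro ext)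
  fix i n
  define g where "g N = closed_loop lam B K (trunc N f)" for N
  define u where "u = closed_loop lam B Kext f"
  have u: "u \<in> HH \<tau>" unfolding u_def by (rule closed_loop_mem[OF f])
  have t: "trunc N f - f \<in> HH \<sigma>" for N by (intro HH_diff trunc_HH[OF f] f)
  have gu: "g N - u = diagonal lam (trunc N f - f) + control B (K (trunc N f) - Kext f)" for N
    by (auto simp: g_def u_def closed_loop_def diagonal_def control_def fun_eq_iff algebra_simps)
  have g: "g N \<in> HH \<tau>" for N
    unfolding g_def closed_loop_def by (intro HH_add control_HH B_mem diag_mem trunc_HH[OF f])
  have "(\<lambda>N. HH_norm \<tau> (g N - u)) \<longlonglongrightarrow> 0"
  proof (rule tendsto_sandwich[OF _ _ tendsto_const])
    show "\<forall>\<^sub>F N in sequentially. HH_norm \<tau> (g N - u)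
        \<le> C * HH_norm \<sigma> (trunc N f - f) + norm (K (trunc N f) - Kext f) * HH_norm \<tau> B"
    proof (intro always_eventually allI)
      fix N
      have "HH_norm \<tau> (g N - u) \<le> HH_norm \<tau> (diagonal lam (trunc N f - f))
          + HH_norm \<tau> (control B (K (trunc N f) - Kext f))"
        unfolding gu by (intro HH_add(2) diag_mem t control_HH B_mem)
      also have "\<dots> \<le> C * HH_norm \<sigma> (trunc N f - f) + norm (K (trunc N f) - Kext f) * HH_norm \<tau> B"
        by (intro add_mono diag_norm t control_HH B_mem)
      finally show "HH_norm \<tau> (g N - u)
        \<le> C * HH_norm \<sigma> (trunc N f - f) + norm (K (trunc N f) - Kext f) * HH_norm \<tau> B" .
    qed
    have "(\<lambda>N. C * HH_norm \<sigma> (trunc N f - f) + norm (K (trunc N f) - Kext f) * HH_norm \<tau> B)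
        \<longlonglongrightarrow> C * 0 + 0 * HH_norm \<tau> B"
      by (intro tendsto_intros trunc_tendsto f tendsto_norm_zero LIM_zero Kext_tendsto)
    then show "(\<lambda>N. C * HH_norm \<sigma> (trunc N f - f) + norm (K (trunc N f) - Kext f) * HH_norm \<tau> B)
        \<longlonglongrightarrow> 0" by simp
  qed simp
  then have "(\<lambda>N. HH_norm \<tau> (T (g N - u))) \<longlonglongrightarrow> 0"
    by (intro R.T_tendsto_0 always_eventually allI HH_diff g u)
  then have "(\<lambda>N. T (g N - u) i n) \<longlonglongrightarrow> 0"
    by (intro HH_coeff_tendsto[of _ \<tau>] R.T_mem HH_diff g u)
  then have "(\<lambda>N. T (g N) i n - T u i n) \<longlonglongrightarrow> 0"
    by (simp add: clinear_on_diff[OF R.T_linear g u])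
  then have 1: "(\<lambda>N. T (g N) i n) \<longlonglongrightarrow> T u i n" by (rule LIM_zero_cancel)
  have "(\<lambda>N. HH_norm \<sigma> (T (trunc N f - f))) \<longlonglongrightarrow> 0"
    by (intro S.T_tendsto_0 always_eventually allI t trunc_tendsto f)
  then have "(\<lambda>N. T (trunc N f - f) i n) \<longlonglongrightarrow> 0"
    by (intro HH_coeff_tendsto[of _ \<sigma>] S.T_mem t)
  then have "(\<lambda>N. T (trunc N f) i n - T f i n) \<longlonglongrightarrow> 0"
    by (simp add: clinear_on_diff[OF S.T_linear trunc_HH[OF f] f])
  then have "(\<lambda>N. T (trunc N f) i n) \<longlonglongrightarrow> T f i n" by (rule LIM_zero_cancel)
  then have "(\<lambda>N. lam i n * T (trunc N f) i n - l * T (trunc N f) i n) \<longlonglongrightarrow> lam i n * T f i n - l * T f i n"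
    by (intro tendsto_intros)
  moreover have "lam i n * T (trunc N f) i n - l * T (trunc N f) i n = T (g N) i n" for N
    unfolding g_def damped[OF trunc_HH[OF f]] by (simp add: diagonal_def scaleC_fun_def scaleC_complex_def)
  ultimately have "(\<lambda>N. T (g N) i n) \<longlonglongrightarrow> lam i n * T f i n - l * T f i n" by (simp only:)
  from LIMSEQ_unique[OF 1 this] have "T u i n = lam i n * T f i n - l * T f i n" .
  then show "T (closed_loop lam B Kext f) i n = (diagonal lam (T f) - complex_of_real l *C T f) i n"
    by (simp add: u_def diagonal_def scaleC_fun_def scaleC_complex_def)
qed

end

context closed_loop_equivalence
begin

lemma diagonal_shift: "diagonal (\<lambda>i n. lam i n - complex_of_real l) h = diagonal lam h - complex_of_real l *C h"
  by (simp add: fun_eq_iff diagonal_def scaleC_fun_def scaleC_complex_def left_diff_distrib)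

text \<open>The exponent \<open>\<sigma>\<close> is the best one that both descriptions of the domain guarantee: solving the
  equation for \<open>diagonal lam f\<close> loses regularity to \<open>B\<close>, and solving it for \<open>T f\<close> gains \<open>\<alpha>\<close> over \<open>r\<close>.
  The admissibility of \<open>r\<close> makes \<open>\<sigma>\<close> larger than \<open>1/2 + \<gamma>\<close>, so the extended relation holds on
  \<open>HH \<sigma>\<close>.\<close>

lemma closed_loop_domain_iff:
  assumes r: "admissible \<alpha> \<gamma> r"
  shows "f \<in> closed_loop_domain s lam B K r \<longleftrightarrow>
      f \<in> HH r \<and> T f \<in> {h \<in> HH r. diagonal (\<lambda>i n. lam i n - complex_of_real l) h \<in> HH r}" (is ?iff)
    and "f \<in> closed_loop_domain s lam B K r \<Longrightarrow>
      T (closed_loop lam B (ext_feedback s K) f) = diagonal (\<lambda>i n. lam i n - complex_of_real l) (T f)"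
proof -
  let ?d = "\<lambda>i n. lam i n - complex_of_real l" and ?A = "closed_loop lam B (ext_feedback s K)"
  define \<sigma> where "\<sigma> i = min (\<alpha> i / 2) (r i + \<alpha> i)" for i
  have "1/2 + \<gamma> i < \<sigma> i" for i
    using r[unfolded admissible_def, rule_format, of i] \<gamma>[of i] by (simp add: \<sigma>_def)
  moreover have "\<sigma> i \<le> \<alpha> i / 2" for i
    unfolding \<sigma>_def by (rule min.cobounded1)
  ultimately interpret closed_loop_extension \<alpha> \<gamma> lam B l c C c1 K T \<sigma>
    by unfold_locales
  interpret r: HH_isomorphism r T by (rule isoT[OF r])
  have sub_r: "u \<in> HH \<tau>" if "u \<in> HH r" for u
    by (rule HH_mono(1)[OF that]) (simp add: \<sigma>_def)
  have reg: "u \<in> HH \<sigma>" if "u \<in> HH \<tau>" "diagonal lam u \<in> HH \<tau>" for u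
    using diagonal_regularity[OF that] by simp
  have ext: "f \<in> ext_domain s K" if "f \<in> HH \<sigma>" for f
    using Kext_extension that by (auto simp: ext_domain_def)
  have A: "?A f = closed_loop lam B Kext f" if "f \<in> ext_domain s K" for f
    by (simp add: closed_loop_def ext_feedback_eq[OF that])
  have T_A: "T (?A f) = diagonal ?d (T f)" if "f \<in> HH \<sigma>" for f
    by (simp add: A ext that damped_ext diagonal_shift)
  \<comment> \<open>the equation for \<open>f\<close> gains \<open>\<alpha>\<close> derivatives over the worse of \<open>r\<close> and the space of \<open>B\<close>\<close>
  have fwd: "f \<in> HH \<sigma>" if f: "f \<in> closed_loop_domain s lam B K r" for f
  proof (rule reg)
    have "f \<in> HH r" "?A f \<in> HH r" using f by (auto simp: closed_loop_domain_def)
    then show "f \<in> HH \<tau>" by (intro sub_r)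
    have "diagonal lam f = ?A f - control B (ext_feedback s K f)" by (simp add: closed_loop_def)
    then show "diagonal lam f \<in> HH \<tau>"
      using \<open>?A f \<in> HH r\<close> by (simp add: HH_diff control_HH B_mem sub_r)
  qed
  show "T (?A f) = diagonal ?d (T f)" if "f \<in> closed_loop_domain s lam B K r"
    by (rule T_A[OF fwd[OF that]])
  show ?iff
  proof
    assume f: "f \<in> closed_loop_domain s lam B K r"
    then have "f \<in> HH r" "?A f \<in> HH r" by (auto simp: closed_loop_domain_def)
    then show "f \<in> HH r \<and> T f \<in> {h \<in> HH r. diagonal ?d h \<in> HH r}"
      using T_A[OF fwd[OF f]] r.T_mem by force
  next
    assume "f \<in> HH r \<and> T f \<in> {h \<in> HH r. diagonal ?d h \<in> HH r}"
    then have f: "f \<in> HH r" and Tf: "T f \<in> HH r" and dTf: "diagonal ?d (T f) \<in> HH r" by auto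
    have "diagonal lam (T f) = diagonal ?d (T f) + complex_of_real l *C T f"
      by (simp add: diagonal_shift)
    also have "\<dots> \<in> HH r" by (intro HH_add HH_scale dTf Tf)
    finally have "T f \<in> HH \<sigma>" by (intro reg sub_r Tf)
    then have f\<sigma>: "f \<in> HH \<sigma>" by (rule T_regularity[OF r adm(1) f])
    have "?A f \<in> HH \<tau>" unfolding A[OF ext[OF f\<sigma>]] by (rule closed_loop_mem[OF f\<sigma>])
    moreover have "T (?A f) \<in> HH r" using T_A[OF f\<sigma>] dTf by simp
    ultimately have "?A f \<in> HH r" by (rule T_regularity[OF adm(2) r])
    then show "f \<in> closed_loop_domain s lam B K r"
      using f ext[OF f\<sigma>] by (simp add: closed_loop_domain_def)
  qed
qed

theorem closed_loop_stableI:
  assumes \<omega>: "\<And>i n. n \<ge> 1 \<Longrightarrow> Re (lam i n) \<le> \<omega>" and \<mu>: "\<mu> > 0" and l: "\<omega> + \<mu> \<le> l"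
    and r: "admissible \<alpha> \<gamma> r"
  shows "closed_loop_stable s lam B K r \<mu>"
proof -
  let ?d = "\<lambda>i n. lam i n - complex_of_real l" and ?A = "closed_loop lam B (ext_feedback s K)"
  interpret r: HH_isomorphism r T by (rule isoT[OF r])
  have d: "\<forall>i. \<forall>n\<ge>1. Re (?d i n) \<le> - \<mu>" 
  proof (intro allI impI)
    show "Re (?d i n) \<le> - \<mu>" if "n \<ge> 1" for i n using \<omega>[OF that, of i] l by simp
  qed
  let ?S = "\<lambda>t f. r.Ti (diagonal_semigroup ?d t (T f))"
  have "?A f \<in> HH r \<and> T (?A f) = diagonal ?d (T f)" if "f \<in> closed_loop_domain s lam B K r" for f
    using closed_loop_domain_iff(2)[OF r that] that by (simp add: closed_loop_domain_def)
  then have gen: "generates (HH r) (HH_norm r) (closed_loop_domain s lam B K r) ?A ?S"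
    by (rule r.conjugate_generates[OF diagonal_semigroup_generates[OF d \<mu>] closed_loop_domain_iff(1)[OF r]])
  obtain C1 where C1: "C1 \<ge> 0" "\<And>f. f \<in> HH r \<Longrightarrow> HH_norm r (T f) \<le> C1 * HH_norm r f"
    using r.T_bounded by blast
  obtain C2 where C2: "C2 \<ge> 0" "\<And>f. f \<in> HH r \<Longrightarrow> HH_norm r (r.Ti f) \<le> C2 * HH_norm r f"
    using r.Ti_bounded by blast
  have "HH_norm r (?S t u) \<le> (C2 * C1 + 1) * exp (- \<mu> * t) * HH_norm r u" if u: "u \<in> HH r" and t: "t \<ge> 0" for u t
  proof -
    note D = diagonal_semigroup_HH[OF d t r.T_mem[OF u]]
    have "HH_norm r (?S t u) \<le> C2 * HH_norm r (diagonal_semigroup ?d t (T u))" by (rule C2(2)[OF D(1)])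
    also have "\<dots> \<le> C2 * (exp (- \<mu> * t) * HH_norm r (T u))" by (rule mult_left_mono[OF D(2) C2(1)])
    also have "\<dots> \<le> C2 * (exp (- \<mu> * t) * (C1 * HH_norm r u))" by (intro mult_left_mono C1 C2 u) simp
    also have "\<dots> = C2 * C1 * (exp (- \<mu> * t) * HH_norm r u)" by (simp add: mult_ac)
    also have "\<dots> \<le> (C2 * C1 + 1) * (exp (- \<mu> * t) * HH_norm r u)"
      by (intro mult_right_mono mult_nonneg_nonneg) auto
    finally show ?thesis by (simp add: mult.assoc)
  qed
  moreover have "C2 * C1 + 1 > 0" using C1(1) C2(1) by (simp add: add_nonneg_pos)
  ultimately show ?thesis
    unfolding closed_loop_stable_def exponentially_stable_def using gen by blast
qed

end

section \<open>Rapid stabilization\<close>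

lemma ex_nonresonant:
  fixes lam :: "'m::finite \<Rightarrow> nat \<Rightarrow> complex"
  shows "\<exists>l>l0. \<forall>i p n. lam i p - lam i n \<noteq> complex_of_real l"
proof -
  let ?R = "\<Union>i. range (\<lambda>(p, n). Re (lam i p - lam i n))"
  have idx: "countable (UNIV :: 'm set)" by (rule countable_finite) simp
  have rng: "countable (range (\<lambda>(p, n). Re (lam i p - lam i n)))" for i
    by (rule countable_image) (rule countableI_type)
  have "countable ?R" by (rule countable_UN[OF idx rng])
  moreover have "uncountable {l0<..<l0 + 1}" by (simp add: uncountable_open_interval)
  ultimately have "\<not> {l0<..<l0 + 1} \<subseteq> ?R" using countable_subset by blast
  then obtain l where l: "l \<in> {l0<..<l0 + 1}" "l \<notin> ?R" by (meson subsetI)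
  have "lam i p - lam i n \<noteq> complex_of_real l" for i p n
  proof
    assume "lam i p - lam i n = complex_of_real l"
    then have "l = Re (lam i p - lam i n)" by simp
    then have "l \<in> ?R" by (intro UN_I[of i] range_eqI[of _ _ "(p, n)"]) simp_all
    with l(2) show False ..
  qed
  moreover have "l > l0" using l(1) by simp
  ultimately show ?thesis by blast
qed

theorem theorem3p1:
  fixes D :: "'a::complex_hilbert set" and A :: "'a \<Rightarrow> 'a"
    and \<phi> :: "'m::finite \<Rightarrow> nat \<Rightarrow> 'a"
    and lam B :: "'m \<Rightarrow> nat \<Rightarrow> complex"
    and \<alpha> \<gamma> :: "'m \<Rightarrow> real"
    and c C c1 c2 :: real
  assumes "\<exists>S. generates UNIV norm D A S \<and> finite_growth_bound UNIV norm S"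
    and "highest_multiplicity D A CARD('m)"
    and "riesz_basis (UNIV \<times> {1..}) (\<lambda>(i, n). \<phi> i n)"
    and "\<forall>i. \<forall>n\<ge>1. \<phi> i n \<in> D \<and> A (\<phi> i n) = lam i n *C \<phi> i n"
    and "\<forall>i. \<forall>n\<ge>1. \<forall>p\<ge>1. n \<noteq> p \<longrightarrow> lam i n \<noteq> lam i p"
    and "\<forall>i. \<alpha> i > 1"
    and "c > 0" and "C > 0"
    and "\<forall>i. \<forall>n\<ge>1. c * real n powr \<alpha> i \<le> cmod (lam i n) + 1
                  \<and> cmod (lam i n) + 1 \<le> C * real n powr \<alpha> i"
    and "\<forall>i. \<forall>n\<ge>1. \<forall>p\<ge>1. cmod (lam i n - lam i p)
                  \<ge> c * real n powr (\<alpha> i - 1) * \<bar>real n - real p\<bar>"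
    and "\<forall>i. B i \<in> Hs (- \<alpha> i / 2)"
    and "c1 > 0" and "c2 > 0"
    and "\<forall>i. 0 \<le> \<gamma> i \<and> \<gamma> i < (\<alpha> i - 1) / 2"
    and "\<forall>i. \<forall>n\<ge>1. c1 \<le> cmod (B i n) \<and> cmod (B i n) \<le> c2 * real n powr \<gamma> i"
  shows "(\<forall>l0>0. \<exists>l>l0. \<exists>K T. equivalence_pair \<alpha> \<gamma> lam B l K T) \<and>
         (\<forall>\<mu>>0. \<exists>l0>0. \<forall>l>l0. \<forall>K T. equivalence_pair \<alpha> \<gamma> lam B l K T \<longrightarrow>
            (\<forall>r. admissible \<alpha> \<gamma> r \<longrightarrow>
               closed_loop_stable (\<lambda>i. \<alpha> i / 2) lam B K r \<mu>))"
proof (intro conjI allI impI)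
  have B: "B \<in> HH (\<lambda>i. - \<alpha> i / 2)" using assms(11) by (simp add: HH_def)
  have lam_le: "\<forall>i. \<forall>n\<ge>1. cmod (lam i n) \<le> C * real n powr \<alpha> i"
  proof (intro allI impI)
    show "cmod (lam i n) \<le> C * real n powr \<alpha> i" if "n \<ge> 1" for i n
      using assms(9)[rule_format, OF that, of i] by linarith
  qed
  fix l0 :: real assume l0: "l0 > 0"
  obtain l where l: "l > l0" and nr: "\<forall>i p n. lam i p - lam i n \<noteq> complex_of_real l"
    using ex_nonresonant by blast
  have "controlled_block (lam i) (\<alpha> i) c (complex_of_real l) (B i) (\<gamma> i) c1 c2" for i
  proof
    fix n p :: nat assume np: "n \<ge> 1" "p \<ge> 1"
    show "c * real (max n p) powr (\<alpha> i - 1) * \<bar>real n - real p\<bar> \<le> cmod (lam i n - lam i p)"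
    proof (cases "p \<le> n")
      case True
      then show ?thesis using assms(10)[rule_format, OF np, of i] by (simp add: max_def)
    next
      case False
      then show ?thesis using assms(10)[rule_format, OF np(2,1), of i]
        by (simp add: max_def abs_minus_commute norm_minus_commute)
    qed
  next
    have g: "\<gamma> i < (\<alpha> i - 1) / 2" "\<alpha> i > 1" using assms(6,14) by simp_all
    then show "\<gamma> i < \<alpha> i - 1" by (simp add: field_simps)
    show "B i 0 = 0" using HH_0[OF B] .
    show "complex_of_real l \<noteq> 0" using l l0 by simp
  qed (use assms(6,7,12,13,14,15) nr in simp_all)
  then have "equivalence_pair \<alpha> \<gamma> lam B l (block_feedback lam B l) (blockwise (\<lambda>i. cauchy_mat (lam i) l (B i)))"
    using assms(8,14) B lam_le by (intro equivalence_pair_cauchy) auto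
  then show "\<exists>l>l0. \<exists>K T. equivalence_pair \<alpha> \<gamma> lam B l K T" using l by blast
next
  have B: "B \<in> HH (\<lambda>i. - \<alpha> i / 2)" using assms(11) by (simp add: HH_def)
  fix \<mu> :: real assume \<mu>: "\<mu> > 0"
  obtain S M \<omega> where gen: "generates UNIV norm D A S"
    and growth: "\<forall>t\<ge>0. \<forall>f. norm (S t f) \<le> M * exp (\<omega> * t) * norm f"
    using assms(1) by (auto simp: finite_growth_bound_def)
  have \<omega>: "Re (lam i n) \<le> \<omega>" if "n \<ge> 1" for i n
  proof (rule eigenvalue_growth_bound[OF gen growth])
    show "\<phi> i n \<in> D" "A (\<phi> i n) = lam i n *C \<phi> i n" using assms(4) that by auto
    show "\<phi> i n \<noteq> 0" using riesz_basis_nonzero[OF assms(3), of "(i, n)"] that by simp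
  qed
  show "\<exists>l0>0. \<forall>l>l0. \<forall>K T. equivalence_pair \<alpha> \<gamma> lam B l K T \<longrightarrow>
      (\<forall>r. admissible \<alpha> \<gamma> r \<longrightarrow> closed_loop_stable (\<lambda>i. \<alpha> i / 2) lam B K r \<mu>)"
    \<comment> \<open>for such \<open>l\<close> the eigenvalues of the damped system have real part at most \<open>- \<mu>\<close>\<close>
  proof (intro exI[of _ "\<bar>\<omega>\<bar> + \<mu>"] conjI allI impI)
    show "0 < \<bar>\<omega>\<bar> + \<mu>" using \<mu> by simp
    fix l K T r assume l: "\<bar>\<omega>\<bar> + \<mu> < l" and pair: "equivalence_pair \<alpha> \<gamma> lam B l K T"
      and r: "admissible \<alpha> \<gamma> r"
    interpret closed_loop_equivalence \<alpha> \<gamma> lam B l c C c1 K T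
      by unfold_locales (use assms B pair in auto)
    show "closed_loop_stable (\<lambda>i. \<alpha> i / 2) lam B K r \<mu>"
      using l by (intro closed_loop_stableI[OF \<omega> \<mu> _ r]) auto
  qed
qed

end
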